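(* For any integer $l\ge0$ there exists a family, analytic in $a\in\mathfrak h^*$, of sets $\{h^{\mathrm{inv}}_{a,l,\mu}\in\mathcal A_l\}_{\mu=1}^{\dim\mathcal A_l}$, which are bases of $\mathcal A_l$ for generic values of $a$, such that $$r_a(w)\,h^{\mathrm{inv}}_{a,l,\mu}=h^{\mathrm{inv}}_{wa,l,\mu}$$ for all $w\in\mathcal W$, all $\mu$ and generic $a$.
   Context: Fix an integer $L\ge2$ and an irrational $p\in(0,1)$; $\omega=e^{2\pi i/L}$ and $\omega^c:=e^{2\pi i c/L}$ for $c\in\mathbb C$. $\mathfrak h^*$ is the complex dual Cartan subalgebra of the Lie algebra $A_{L-1}$ with its invariant bilinear form $\langle\cdot,\cdot\rangle$ and simple roots $\alpha_1,\dots,\alpha_{L-1}$, $\langle\alpha_i,\alpha_j\rangle=2\delta_{ij}-\delta_{i,j+1}-\delta_{i,j-1}$. $H_1,\dots,H_L\in\mathfrak h^*$ are the weights of the first fundamental representation: $\langle\alpha_i,H_s\rangle=\delta_{is}-\delta_{i,s-1}$, $\sum_sH_s=0$. For $S\subseteq\{1,\dots,L\}$ put $H_S=\sum_{s\in S}H_s$. The Weyl group $\mathcal W$ is generated by $w_ia=a-\langle a,\alpha_i\rangle\alpha_i$, $i=1,\dots,L-1$. Let $$f(z)=\frac{(z-\omega^p)(z-\omega^{1-p})}{(z-1)(z-\omega)}.$$ "For generic $a$" means: for all $a\in\mathfrak h^*$ outside a countable union of zero sets of entire functions on $\mathfrak h^*$ that are not identically zero; the exceptional set may be taken $\mathcal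 W$-invariant. **Algebra.** $\mathcal A=\bigoplus_{l\ge0}\mathcal A_l$ is the free commutative (polynomial) $\mathbb C$-algebra on generators $\alpha_ic_{-n}$, $1\le i\le L-1$, $n\ge1$, graded by $\deg(\alpha_ic_{-n})=n$. "Analytic in $a$" means that the coefficients of $h^{\mathrm{inv}}_{a,l,\mu}$ in a fixed basis of the finite-dimensional space $\mathcal A_l$ are analytic functions of $a\in\mathfrak h^*$. **Rational functions $J^h_{N,a}$, $h\in\mathcal A$.** Let $N\ge0$, $k_1,\dots,k_N\in\{1,\dots,L-1\}$. For a tuple $\underline S=(S_1,\dots,S_N)$ of subsets of $\{1,\dots,L\}$ with $|S_n|=k_n$, $S_n=\{s^{(n)}_1<\dots<s^{(n)}_{k_n}\}$, put $y^{(n)}_j=x_n\omega^{(k_n+1-2j)/2}$. Define the algebra homomorphism $E_{\underline S}:\mathcal A\to\mathbb C[x_1,\dots,x_N]$ by $$E_{\underline S}(\alpha_ic_{-m})=\sum_{n=1}^N\sum_{j=1}^{k_n}\langle\alpha_i,H_{s^{(n)}_j}\rangle\,\omega^{-\frac{L+1-2s^{(n)}_j}2m}(y^{(n)}_j)^m.$$ Let $\Phi_{\underline S}(x_1,\dots,x_N)$ be the product, over all $m<n$ and all pairs $(j,j')$ with $s^{(m)}_j\ne s^{(n)}_{j'}$, of the factors $f(y^{(m)}_j/y^{(n)}_{j'})$ if $s^{(m)}_j<s^{(n)}_{j'}$ and $f(y^{(n)}_{j'}/y^{(m)}_j)$ if $s^{(m)}_j>s^{(n)}_{j'}$. Then $$J^h_{N,a}(x_1,\dots,x_N)_{k_1\dots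 k_N}=\sum_{\underline S}\omega^{\langle a,\sum_nH_{S_n}\rangle}\,\Phi_{\underline S}\,E_{\underline S}(h).$$ **Reflection maps.** For generic $a$ and $w\in\mathcal W$, $r_a(w):\mathcal A\to\mathcal A$ denotes the linear map characterized by $$J^h_{N,a}(x_1,\dots,x_N)_{k_1\dots k_N}=J^{r_a(w)h}_{N,wa}(x_1,\dots,x_N)_{k_1\dots k_N}\qquad\text{for all }h\in\mathcal A,\ N\ge0,\ k_1,\dots,k_N\in\{1,\dots,L-1\}$$ (for generic $a$ such a map exists and is unique). *)

theory Defs
  imports "HOL-Analysis.Analysis" "HOL-Library.Poly_Mapping"
begin

text \<open>
  The rank \<open>L - 1\<close> is carried by a finite index type \<^typ>\<open>'i\<close> with \<open>CARD('i) = L - 1\<close>, whose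
  elements are the nodes of the Dynkin diagram.  The dual Cartan subalgebra is then the whole type
  \<^typ>\<open>complex ^ 'i\<close>, a vector being given by its coordinates with respect to the simple roots.
  \<open>node\<close> fixes once and for all a numbering of the nodes by \<open>1, \<dots>, L - 1\<close>.
\<close>

definition node :: "'i::finite \<Rightarrow> nat" where
  "node = (SOME e. bij_betw e UNIV {1..CARD('i)})"

lemma bij_betw_node: "bij_betw (node :: 'i::finite \<Rightarrow> nat) UNIV {1..CARD('i)}"
proof -
  have "\<exists>e :: 'i \<Rightarrow> nat. bij_betw e UNIV {1..CARD('i)}"
    by (rule finite_same_card_bij) auto
  then show ?thesis
    unfolding node_def by (rule someI_ex)
qed

definition cartan :: "'i::finite \<Rightarrow> 'i \<Rightarrow> complex" where
  "cartan i j = (if node i = node j then 2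
                 else if node i = node j + 1 \<or> node j = node i + 1 then -1 else 0)"

definition form :: "complex ^ 'i::finite \<Rightarrow> complex ^ 'i \<Rightarrow> complex" where
  "form a b = (\<Sum>i\<in>UNIV. \<Sum>j\<in>UNIV. a $ i * cartan i j * b $ j)"

definition alpha :: "'i::finite \<Rightarrow> complex ^ 'i" where
  "alpha i = axis i 1"

text \<open>
  The weight \<open>H\<^sub>s\<close> is \<open>H\<^sub>1\<close> minus the simple roots with numbers below \<open>s\<close>, where
  \<open>H\<^sub>1 = \<Sum>\<^sub>i (L - i)/L \<alpha>\<^sub>i\<close>; the lemmas \<open>form_alpha_weight\<close> and \<open>sum_weight\<close> are its usual
  characterization.
\<close>

definition weight :: "nat \<Rightarrow> nat \<Rightarrow> complex ^ 'i::finite" where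
  "weight L s = (\<chi> i. (of_nat L - of_nat (node i)) / of_nat L - (if node i < s then 1 else 0))"

lemma form_alpha: "form (alpha i) b = (\<Sum>j\<in>UNIV. cartan i j * b $ j)"
proof -
  have "form (alpha i) b = (\<Sum>k\<in>UNIV. if k = i then \<Sum>j\<in>UNIV. cartan k j * b $ j else 0)"
    unfolding form_def alpha_def by (rule sum.cong) (auto simp: axis_def)
  then show ?thesis by simp
qed

lemma form_alpha_alpha: "form (alpha i) (alpha j) = cartan i j"
proof -
  have "form (alpha i) (alpha j) = (\<Sum>k\<in>UNIV. if k = j then cartan i k else 0)"
    unfolding form_alpha by (rule sum.cong) (auto simp: alpha_def axis_def)
  then show ?thesis by simp
qed

lemma form_alpha_weight:
  fixes i :: "'i::finite"
  assumes "L \<ge> 2" "CARD('i) = L - 1" "s \<in> {1..L}"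
  shows "form (alpha i) (weight L s) =
    (if node i = s then 1 else 0) - (if node i + 1 = s then 1 else 0)"
proof -
  define g :: "nat \<Rightarrow> complex" where
    "g n = (of_nat L - of_nat n) / of_nat L - (if n < s then 1 else 0)" for n
  define c :: "nat \<Rightarrow> nat \<Rightarrow> complex" where
    "c m n = (if m = n then 2 else if m = n + 1 \<or> n = m + 1 then -1 else 0)" for m n
  define m where "m = node i"
  have bij: "bij_betw (node :: 'i \<Rightarrow> nat) UNIV {1..L - 1}"
    using bij_betw_node[where 'i = 'i] assms by simp
  then have m: "m \<in> {1..L - 1}"
    unfolding m_def bij_betw_def by auto
  have ends: "g 0 = 0" "g L = 0"
    using assms by (auto simp: g_def)
  have "form (alpha i) (weight L s) = (\<Sum>j\<in>UNIV. c m (node (j::'i)) * g (node j))"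
    by (simp add: form_alpha weight_def cartan_def c_def g_def m_def)
  also have "\<dots> = (\<Sum>n\<in>{1..L - 1}. c m n * g n)"
    using sum.reindex_bij_betw[OF bij, of "\<lambda>n. c m n * g n"] by simp
  also have "\<dots> = (\<Sum>n\<in>{0..L}. c m n * g n)"
  proof (rule sum.mono_neutral_left)
    show "\<forall>n\<in>{0..L} - {1..L - 1}. c m n * g n = 0"
    proof
      fix n assume "n \<in> {0..L} - {1..L - 1}"
      then have "n = 0 \<or> n = L" by auto
      with ends show "c m n * g n = 0" by auto
    qed
  qed auto
  also have "\<dots> = (\<Sum>n\<in>{m - 1, m, m + 1}. c m n * g n)"
    by (rule sum.mono_neutral_right) (use m assms in \<open>auto simp: c_def\<close>)
  also have "\<dots> = 2 * g m - g (m - 1) - g (m + 1)"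
    using m by (cases m) (auto simp: c_def)
  also have "\<dots> = (if m = s then 1 else 0) - (if m + 1 = s then 1 else 0)"
    using m assms by (cases m) (auto simp: g_def field_simps)
  finally show ?thesis by (simp add: m_def)
qed

lemma sum_weight:
  assumes "L \<ge> 2" "CARD('i::finite) = L - 1"
  shows "(\<Sum>s\<in>{1..L}. weight L s :: complex ^ 'i) = 0"
proof (rule vec_eq_iff[THEN iffD2], rule allI)
  fix i :: 'i
  have "node i \<in> {1..L - 1}"
    using bij_betw_node[where 'i = 'i] assms unfolding bij_betw_def by auto
  then have "node i \<le> L"
    by auto
  moreover have "{s \<in> {1..L}. node i < s} = {node i <.. L}"
    by auto
  ultimately show "(\<Sum>s\<in>{1..L}. weight L s :: complex ^ 'i) $ i = 0 $ i"
    using assms by (simp add: weight_def sum_subtractf sum.If_cases Int_def of_nat_diff less_eq_Suc_le)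
qed

definition weight_set :: "nat \<Rightarrow> nat set \<Rightarrow> complex ^ 'i::finite" where
  "weight_set L S = (\<Sum>s\<in>S. weight L s)"

definition simple_reflection :: "'i::finite \<Rightarrow> complex ^ 'i \<Rightarrow> complex ^ 'i" where
  "simple_reflection i a = a - form a (alpha i) *s alpha i"

text \<open>The generators are involutions, so the monoid they generate is the group they generate.\<close>

inductive_set weyl_group :: "(complex ^ 'i::finite \<Rightarrow> complex ^ 'i) set" where
  id: "id \<in> weyl_group"
| step: "w \<in> weyl_group \<Longrightarrow> simple_reflection i \<circ> w \<in> weyl_group"

text \<open>Holomorphy on the dual Cartan subalgebra: complex differentiability at every point.\<close>

definition entire :: "(complex ^ 'i::finite \<Rightarrow> complex) \<Rightarrow> bool" where
  "entire F \<longleftrightarrow> (\<forall>a. \<exists>D. (F has_derivative D) (at a) \<and> (\<forall>c v. D (c *s v) = c * D v))"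

definition generic :: "(complex ^ 'i::finite \<Rightarrow> bool) \<Rightarrow> bool" where
  "generic P \<longleftrightarrow> (\<exists>F :: nat \<Rightarrow> complex ^ 'i \<Rightarrow> complex.
     (\<forall>n. entire (F n) \<and> (\<exists>a. F n a \<noteq> 0)) \<and> (\<forall>a. (\<forall>n. F n a \<noteq> 0) \<longrightarrow> P a))"

text \<open>
  The algebra \<open>\<A>\<close>, as finitely supported functions from monomials to coefficients.
  The pair \<open>(i, n)\<close> stands for the generator \<open>\<alpha>\<^sub>i c\<^bsub>-(n+1)\<^esub>\<close>, of degree \<open>n + 1\<close>:
  with this shift every pair is a generator, and \<open>\<A>\<close> is the whole type.
\<close>

type_synonym 'i monomial = "('i \<times> nat) \<Rightarrow>\<^sub>0 nat"
type_synonym 'i alg = "'i monomial \<Rightarrow>\<^sub>0 complex"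

definition mdegree :: "'i monomial \<Rightarrow> nat" where
  "mdegree m = (\<Sum>g\<in>Poly_Mapping.keys m. Poly_Mapping.lookup m g * (snd g + 1))"

definition alg_scale :: "complex \<Rightarrow> 'i alg \<Rightarrow> 'i alg" where
  "alg_scale c h = Poly_Mapping.single 0 c * h"

global_interpretation alg: vector_space alg_scale
  by unfold_locales
    (simp_all add: alg_scale_def algebra_simps single_add mult_single flip: mult.assoc)

definition alg_grade :: "nat \<Rightarrow> 'i alg set" where
  "alg_grade l = {h. \<forall>m\<in>Poly_Mapping.keys h. mdegree m = l}"

text \<open>The algebra homomorphism to the complex numbers with prescribed values on the generators.\<close>

definition alg_eval :: "('i \<times> nat \<Rightarrow> complex) \<Rightarrow> 'i alg \<Rightarrow> complex" where
  "alg_eval v h = (\<Sum>m\<in>Poly_Mapping.keys h. Poly_Mapping.lookup h m *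
     (\<Prod>g\<in>Poly_Mapping.keys m. v g ^ Poly_Mapping.lookup m g))"

definition omega_pow :: "nat \<Rightarrow> complex \<Rightarrow> complex" where
  "omega_pow L c = exp (2 * of_real pi * \<i> * c / of_nat L)"

definition f_fun :: "nat \<Rightarrow> real \<Rightarrow> complex \<Rightarrow> complex" where
  "f_fun L p z = ((z - omega_pow L (of_real p)) * (z - omega_pow L (1 - of_real p))) /
                 ((z - 1) * (z - omega_pow L 1))"

definition y_var :: "nat \<Rightarrow> nat \<Rightarrow> complex \<Rightarrow> nat \<Rightarrow> complex" where
  "y_var L k x j = x * omega_pow L ((of_nat k + 1 - 2 * of_nat j) / 2)"

text \<open>
  The pairs \<open>(n, j)\<close> are indexed by \<open>s = s\<^sub>j\<^sup>(\<^sup>n\<^sup>) \<in> S\<^sub>n\<close> instead, with \<open>j\<close> recovered as the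
  position of \<open>s\<close> in \<open>S\<^sub>n\<close>.
\<close>

definition position :: "nat set \<Rightarrow> nat \<Rightarrow> nat" where
  "position S s = card {t \<in> S. t \<le> s}"

definition y_at :: "nat \<Rightarrow> nat set \<Rightarrow> complex \<Rightarrow> nat \<Rightarrow> complex" where
  "y_at L S x s = y_var L (card S) x (position S s)"

definition Phi :: "nat \<Rightarrow> real \<Rightarrow> nat \<Rightarrow> (nat \<Rightarrow> nat set) \<Rightarrow> (nat \<Rightarrow> complex) \<Rightarrow> complex" where
  "Phi L p N S x = (\<Prod>n\<in>{1..N}. \<Prod>m\<in>{1..<n}. \<Prod>s\<in>S m. \<Prod>t\<in>S n.
     if s < t then f_fun L p (y_at L (S m) (x m) s / y_at L (S n) (x n) t)
     else if s > t then f_fun L p (y_at L (S n) (x n) t / y_at L (S m) (x m) s)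
     else 1)"

text \<open>\<open>E\<^sub>S(h)\<close>, evaluated at the point \<open>x\<close>.\<close>

definition E_hom :: "nat \<Rightarrow> nat \<Rightarrow> (nat \<Rightarrow> nat set) \<Rightarrow> (nat \<Rightarrow> complex) \<Rightarrow> 'i::finite alg \<Rightarrow> complex"
  where
  "E_hom L N S x = alg_eval (\<lambda>(i, q). let m = q + 1 in
     \<Sum>n\<in>{1..N}. \<Sum>s\<in>S n. form (alpha i) (weight L s) *
       omega_pow L (- ((of_nat L + 1 - 2 * of_nat s) / 2) * of_nat m) *
       y_at L (S n) (x n) s ^ m)"

definition J_fun :: "nat \<Rightarrow> real \<Rightarrow> nat \<Rightarrow> (nat \<Rightarrow> nat) \<Rightarrow> complex ^ 'i::finite \<Rightarrow> 'i alg \<Rightarrow>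
    (nat \<Rightarrow> complex) \<Rightarrow> complex" where
  "J_fun L p N k a h x =
     (\<Sum>S\<in>(\<Pi>\<^sub>E n\<in>{1..N}. {T. T \<subseteq> {1..L} \<and> card T = k n}).
        omega_pow L (form a (\<Sum>n\<in>{1..N}. weight_set L (S n))) * Phi L p N S x * E_hom L N S x h)"

text \<open>
  Rational functions are represented by their values away from all denominators: this set of points
  is the complement of a proper algebraic subset, so agreement on it is equality of rational
  functions.
\<close>

definition no_poles :: "nat \<Rightarrow> nat \<Rightarrow> (nat \<Rightarrow> nat) \<Rightarrow> (nat \<Rightarrow> complex) \<Rightarrow> bool" where
  "no_poles L N k x \<longleftrightarrow> (\<forall>n\<in>{1..N}. x n \<noteq> 0) \<and>
     (\<forall>m\<in>{1..N}. \<forall>n\<in>{1..N}. m \<noteq> n \<longrightarrow> (\<forall>j\<in>{1..k m}. \<forall>j'\<in>{1..k n}.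
        y_var L (k m) (x m) j / y_var L (k n) (x n) j' \<notin> {1, omega_pow L 1}))"

definition is_reflection_map :: "nat \<Rightarrow> real \<Rightarrow> complex ^ 'i::finite \<Rightarrow>
    (complex ^ 'i \<Rightarrow> complex ^ 'i) \<Rightarrow> ('i alg \<Rightarrow> 'i alg) \<Rightarrow> bool" where
  "is_reflection_map L p a w r \<longleftrightarrow> Vector_Spaces.linear alg_scale alg_scale r \<and>
     (\<forall>h N k. (\<forall>n\<in>{1..N}. k n \<in> {1..L - 1}) \<longrightarrow>
        (\<forall>x. no_poles L N k x \<longrightarrow> J_fun L p N k a h x = J_fun L p N k (w a) (r h) x))"

definition reflection_map :: "nat \<Rightarrow> real \<Rightarrow> complex ^ 'i::finite \<Rightarrow>
    (complex ^ 'i \<Rightarrow> complex ^ 'i) \<Rightarrow> 'i alg \<Rightarrow> 'i alg" where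
  "reflection_map L p a w = (THE r. is_reflection_map L p a w r)"

definition analytic_family :: "(complex ^ 'i::finite \<Rightarrow> 'i alg) \<Rightarrow> bool" where
  "analytic_family h \<longleftrightarrow> (\<forall>m. entire (\<lambda>a. Poly_Mapping.lookup (h a) m))"

text \<open>An indexed family (not just its set of values) being a basis of a subspace.\<close>

definition is_basis_of :: "nat set \<Rightarrow> (nat \<Rightarrow> 'i alg) \<Rightarrow> 'i alg set \<Rightarrow> bool" where
  "is_basis_of I b V \<longleftrightarrow> inj_on b I \<and> alg.independent (b ` I) \<and> alg.span (b ` I) = V"

end

theory Submission
  imports Defs "HOL-Complex_Analysis.Complex_Analysis"
begin

text \<open>
  Without descendants (\<open>h = 1\<close>) the functions \<open>J\<close> are Weyl invariant: grouping the labels into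
  configurations that differ by exchanging \<open>i\<close> and \<open>i + 1\<close> reduces this to the symmetry in \<open>q, r\<close> of
  \<open>\<Sum>\<^bsub>A \<subseteq> F\<^esub> q\<^bsup>|A|\<^esup> r\<^bsup>|F - A|\<^esup> \<Prod>\<^bsub>m \<in> A, n \<notin> A\<^esub> f(u\<^sub>m / u\<^sub>n)\<close>, which holds by
  Liouville's theorem and \<open>f(z) = f(\<omega> / z)\<close>.

  Now split the points into two groups \<open>\<epsilon>x\<close> and \<open>y\<close> and expand in \<open>\<epsilon>\<close>.  If the total power sums of
  the sites of \<open>y\<close> of the orders not divisible by \<open>L\<close> vanish, then the coefficient of \<open>\<epsilon>\<^sup>l\<close> is, up to
  factors independent of the labels, \<open>J\<close> of the group \<open>x\<close> with an element \<open>h\<^sub>a(y) \<in> \<A>\<^sub>l\<close> that is a finite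
  sum of exponentials in \<open>a\<close>.  By the first step, \<open>h\<^sub>a(y)\<close> is an invariant family; so are its products
  with elements whose evaluations do not depend on the labels.

  Let \<open>a\<close> go to infinity in the dominant chamber.  Then only the labels \<open>S\<^sub>n = {1, \<dots>, k\<^sub>n}\<close>
  survive, and their contribution is governed by the power sums of the points with given
  \<open>k\<^sub>n\<close>, which can be prescribed freely.  So these families span \<open>\<A>\<^sub>l\<close> for some, hence for
  generic, \<open>a\<close>; the same limit shows that \<open>h\<close> is determined by its functions \<open>J\<close>, which makes the
  reflection map unique.
\<close>


text \<open>Let P_s be the power sum of order m over the sites of x with label s, and z =
  \<omega>^m. The generators of degree m evaluate to multiples of the twisted differences P_i - z
  P_(i+1). Summation by parts writes the exponent of the factors between the two groups in terms of
  these differences, the sum of all P_s, and a remainder proportional to P_L times the total of the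
  inverse powers of y. If L divides m, then z = 1, and P_L is a combination of the differences and
  the sum of all P_s, so the remainder is absorbed. Otherwise 1 + z + ... + z^(L-1) = 0 makes the
  sum of all P_s itself a combination of the differences; P_L stays out of reach, and the total of y
  has to vanish. This is the origin of the condition on y. It costs one generator in every such
  degree, and the same relation repays it: the combination that evaluates to the sum of all P_s is
  independent of the labels and may be multiplied in.

  The existence of the reflection maps is proved as well: they are defined by sending the bases at a
  to the bases at w a, in all degrees at once.\<close>

lemma omega_pow_add: "omega_pow L (a + b) = omega_pow L a * omega_pow L b"
  by (simp add: omega_pow_def exp_add [symmetric] add_divide_distrib ring_distribs)

lemma omega_pow_0 [simp]: "omega_pow L 0 = 1"
  by (simp add: omega_pow_def)

lemma omega_pow_nonzero [simp]: "omega_pow L a \<noteq> 0"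
  by (simp add: omega_pow_def)

lemma omega_pow_minus: "omega_pow L (- a) = inverse (omega_pow L a)"
  by (simp add: omega_pow_def exp_minus [symmetric])

lemma omega_pow_diff: "omega_pow L (a - b) = omega_pow L a / omega_pow L b"
  using omega_pow_add[of L a "-b"] by (simp add: omega_pow_minus divide_inverse)

lemma omega_pow_power: "omega_pow L a ^ n = omega_pow L (of_nat n * a)"
  by (induction n) (simp_all add: omega_pow_add [symmetric] algebra_simps)

lemma omega_pow_sum: "omega_pow L (sum g A) = (\<Prod>x\<in>A. omega_pow L (g x))"
  by (induction A rule: infinite_finite_induct) (simp_all add: omega_pow_add)

lemma omega_pow_eq_1_iff:
  assumes "L > 0"
  shows "omega_pow L (of_real r) = 1 \<longleftrightarrow> (\<exists>k::int. r = of_int k * of_nat L)"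
proof -
  have *: "2 * complex_of_real pi * \<i> * complex_of_real r / of_nat L = \<i> * complex_of_real (2 * pi * r / L)"
    by simp
  have "omega_pow L (of_real r) = 1 \<longleftrightarrow> (\<exists>k::int. 2 * pi * r / of_nat L = of_int (2 * k) * pi)"
    unfolding omega_pow_def exp_eq_1 * by simp
  also have "\<dots> \<longleftrightarrow> (\<exists>k::int. r = of_int k * of_nat L)"
    using assms by (auto simp: field_simps)
  finally show ?thesis .
qed

lemma omega_pow_of_nat_eq_1_iff:
  assumes "L > 0"
  shows "omega_pow L (of_nat m) = 1 \<longleftrightarrow> L dvd m"
proof -
  have "omega_pow L (of_nat m) = 1 \<longleftrightarrow> (\<exists>k::int. real m = of_int k * of_nat L)"
    using omega_pow_eq_1_iff[OF assms, of "of_nat m"] by simp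
  also have "\<dots> \<longleftrightarrow> (\<exists>k::int. int m = k * int L)"
    by (metis of_int_eq_iff of_int_mult of_int_of_nat_eq)
  also have "\<dots> \<longleftrightarrow> int L dvd int m"
    by (auto simp: dvd_def mult.commute)
  finally show ?thesis by simp
qed

section \<open>The function f: crossing symmetry, behaviour at infinity, residues\<close>

locale toda =
  fixes L :: nat and p :: real
  assumes L2: "L \<ge> 2" and p_irrat: "p \<notin> \<rat>" and p_pos: "0 < p" and p_less: "p < 1"
begin

abbreviation om :: "complex \<Rightarrow> complex" where "om \<equiv> omega_pow L"
abbreviation ff :: "complex \<Rightarrow> complex" where "ff \<equiv> f_fun L p"

lemma om_1_neq_1: "om 1 \<noteq> 1"
  using omega_pow_of_nat_eq_1_iff[of L 1] L2 by auto

lemma om_1_power_L: "om 1 ^ L = 1"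
  using omega_pow_of_nat_eq_1_iff[of L L] L2 by (auto simp: omega_pow_power)

lemma om_p_prod: "om (of_real p) * om (1 - of_real p) = om 1"
  by (simp add: omega_pow_add [symmetric])

text \<open>The involution z \<mapsto> \<omega> / z exchanges the two zeros of f and also its two
  poles, since either pair has product \<omega>.\<close>

lemma ff_crossing:
  assumes "z \<noteq> 0"
  shows "ff (om 1 / z) = ff z"
proof -
  define a b w where "a = om (of_real p)" and "b = om (1 - of_real p)" and "w = om 1"
  have ab: "a * b = w" "a \<noteq> 0" "b \<noteq> 0" "w \<noteq> 0"
    using om_p_prod by (auto simp: a_def b_def w_def)
  have "(w / z - a) * (w / z - b) = w / z ^ 2 * ((z - a) * (z - b))"
    using assms ab(1) by (simp add: field_simps power2_eq_square)
  moreover have "(w / z - 1) * (w / z - w) = w / z ^ 2 * ((z - 1) * (z - w))"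
    using assms by (simp add: field_simps power2_eq_square)
  ultimately show ?thesis
    using assms ab unfolding f_fun_def a_def[symmetric] b_def[symmetric] w_def[symmetric]
    by simp
qed

lemma ff_crossing_div: "u \<noteq> 0 \<Longrightarrow> v \<noteq> 0 \<Longrightarrow> ff (u / v) = ff (om 1 * v / u)"
  using ff_crossing[of "u / v"] by simp

lemma ff_tendsto:
  assumes "z \<notin> {1, om 1}" "(g \<longlongrightarrow> z) F"
  shows "((\<lambda>x. ff (g x)) \<longlongrightarrow> ff z) F"
  unfolding f_fun_def using assms by (intro tendsto_intros) auto

lemma ff_at_infinity:
  assumes "c \<noteq> 0"
  shows "((\<lambda>z. ff (c * z)) \<longlongrightarrow> 1) at_infinity"
proof -
  have inv: "((\<lambda>z. a * inverse z) \<longlongrightarrow> a * 0) at_infinity" for a :: complex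
    by (intro tendsto_intros tendsto_inverse_0)
  have "((\<lambda>z. ((c - om (of_real p) * inverse z) * (c - om (1 - of_real p) * inverse z)) /
      ((c - 1 * inverse z) * (c - om 1 * inverse z))) \<longlongrightarrow>
      ((c - om (of_real p) * 0) * (c - om (1 - of_real p) * 0)) / ((c - 1 * 0) * (c - om 1 * 0))) at_infinity"
    by (intro tendsto_divide tendsto_mult[of "\<lambda>z. c - _ z"] tendsto_diff tendsto_const inv) (use assms in auto)
  moreover have "eventually (\<lambda>z. ((c - om (of_real p) * inverse z) * (c - om (1 - of_real p) * inverse z)) /
      ((c - 1 * inverse z) * (c - om 1 * inverse z)) = ff (c * z)) at_infinity"
    using eventually_not_equal_at_infinity[of 0]
  proof eventually_elim
    case (elim z)
    have *: "c - a * inverse z = (c * z - a) / z" for a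
      using elim by (simp add: field_simps)
    show ?case
      unfolding * f_fun_def using elim by simp
  qed
  ultimately show ?thesis
    using assms by (simp add: filterlim_cong[OF refl refl] tendsto_cong)
qed

text \<open>The residue of f at 1; by crossing the residue at the other pole is
  \<open>- om 1 * kap\<close>.\<close>

definition kap :: complex where
  "kap = (1 - om (of_real p)) * (1 - om (1 - of_real p)) / (1 - om 1)"

text \<open>Poles and regular points are treated alike: the limit is the residue at a pole and 0
  elsewhere. This is the form in which \<open>holomorphic_eq_0_of_removable\<close> tests a
  singularity.\<close>

lemma ff_residue:
  assumes "c \<noteq> 0"
  shows "((\<lambda>z. (z - b) * ff (c * z)) \<longlongrightarrow>
    (if c * b = 1 then kap / c else if c * b = om 1 then - om 1 * kap / c else 0)) (at b)"
proof -
  define a d w where "a = om (of_real p)" and "d = om (1 - of_real p)" and "w = om 1"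
  have ab: "a * d = w" "a \<noteq> 0" "d \<noteq> 0" "w \<noteq> 0" "w \<noteq> 1"
    using om_p_prod om_1_neq_1 by (auto simp: a_def d_def w_def)
  have ff: "ff z = (z - a) * (z - d) / ((z - 1) * (z - w))" for z
    by (simp add: f_fun_def a_def d_def w_def)
  have kap: "kap = (1 - a) * (1 - d) / (1 - w)"
    by (simp add: kap_def a_def d_def w_def)
  consider "c * b = 1" | "c * b = w" | "c * b \<notin> {1, w}" by auto
  then show ?thesis
  proof cases
    case 1
    then have b: "b = 1 / c" using assms by (simp add: field_simps)
    have "((\<lambda>z. (c * z - a) * (c * z - d) / (c * z - w) / c) \<longlongrightarrow>
       (c * b - a) * (c * b - d) / (c * b - w) / c) (at b)"
      using 1 ab assms by (intro tendsto_intros) auto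
    then have "((\<lambda>z. (c * z - a) * (c * z - d) / (c * z - w) / c) \<longlongrightarrow> kap / c) (at b)"
      by (simp add: kap 1)
    moreover have "eventually (\<lambda>z. (c * z - a) * (c * z - d) / (c * z - w) / c = (z - b) * ff (c * z)) (at b)"
      unfolding eventually_at_filter
    proof (rule always_eventually, intro allI impI)
      fix z assume "z \<noteq> b"
      then have "z - b \<noteq> 0" by simp
      moreover have "c * z - 1 = c * (z - b)" using b assms by (simp add: field_simps)
      ultimately show "(c * z - a) * (c * z - d) / (c * z - w) / c = (z - b) * ff (c * z)"
        using assms by (simp add: ff)
    qed
    ultimately have "((\<lambda>z. (z - b) * ff (c * z)) \<longlongrightarrow> kap / c) (at b)"
      using tendsto_cong by fast
    then show ?thesis using 1 by simp
  next
    case 2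
    then have b: "b = w / c" using assms by (simp add: field_simps)
    have "((\<lambda>z. (c * z - a) * (c * z - d) / (c * z - 1) / c) \<longlongrightarrow>
       (c * b - a) * (c * b - d) / (c * b - 1) / c) (at b)"
      using 2 ab assms by (intro tendsto_intros) auto
    moreover have "(w - a) * (w - d) = w * ((1 - a) * (1 - d))"
      by (simp add: ab(1)[symmetric] algebra_simps)
    then have "(c * b - a) * (c * b - d) / (c * b - 1) / c = - w * kap / c"
      using ab(5) assms by (simp add: kap 2 divide_simps) (simp add: algebra_simps)
    moreover have "eventually (\<lambda>z. (c * z - a) * (c * z - d) / (c * z - 1) / c = (z - b) * ff (c * z)) (at b)"
      unfolding eventually_at_filter
    proof (rule always_eventually, intro allI impI)
      fix z assume "z \<noteq> b"
      then have "z - b \<noteq> 0" by simp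
      moreover have "c * z - w = c * (z - b)" using b assms by (simp add: field_simps)
      ultimately show "(c * z - a) * (c * z - d) / (c * z - 1) / c = (z - b) * ff (c * z)"
        using assms by (simp add: ff)
    qed
    ultimately have "((\<lambda>z. (z - b) * ff (c * z)) \<longlongrightarrow> - w * kap / c) (at b)"
      by (simp add: tendsto_cong)
    then show ?thesis using 2 ab(5) by (simp add: w_def)
  next
    case 3
    have "((\<lambda>z. (z - b) * ff (c * z)) \<longlongrightarrow> (b - b) * ff (c * b)) (at b)"
      using 3 by (intro tendsto_intros ff_tendsto) (auto simp: w_def)
    then show ?thesis using 3 by (simp add: w_def)
  qed
qed

end

section \<open>Symmetry of the crossing sum\<close>

lemma sum_Pow_insert:
  fixes h :: "'a set \<Rightarrow> 'b :: comm_monoid_add"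
  assumes "finite F" "e \<notin> F"
  shows "(\<Sum>A\<in>Pow (insert e F). h A) = (\<Sum>A\<in>Pow F. h A + h (insert e A))"
proof -
  have "(\<Sum>A\<in>Pow (insert e F). h A) = (\<Sum>A\<in>Pow F. h A) + (\<Sum>A\<in>insert e ` Pow F. h A)"
    unfolding Pow_insert using assms by (intro sum.union_disjoint) auto
  also have "(\<Sum>A\<in>insert e ` Pow F. h A) = (\<Sum>A\<in>Pow F. h (insert e A))"
    using assms by (intro sum.reindex_cong[OF _ refl refl]) (auto simp: inj_on_def)
  finally show ?thesis by (simp add: sum.distrib)
qed

text \<open>Riemann's theorem removes one singularity at a time; once none is left, Liouville's
  theorem applies because of the limit 0 at infinity.\<close>

lemma holomorphic_eq_0_of_removable:
  fixes g :: "complex \<Rightarrow> complex"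
  assumes "finite B" "g holomorphic_on - B"
    and "\<And>b. b \<in> B \<Longrightarrow> ((\<lambda>z. (z - b) * g z) \<longlongrightarrow> 0) (at b)"
    and "(g \<longlongrightarrow> 0) at_infinity" "z \<notin> B"
  shows "g z = 0"
  using assms
proof (induction B arbitrary: g rule: finite_induct)
  case empty
  then show ?case using Liouville_weak_0[of g] by simp
next
  case (insert b B)
  have op: "open (- B)"
    using insert.hyps by (simp add: finite_imp_closed open_Compl)
  have *: "g holomorphic_on (- B) - {b}"
    using insert.prems(1) by (rule holomorphic_on_subset) auto
  have "b \<in> interior (- B)"
    using op insert.hyps by (simp add: interior_open)
  then obtain h where h: "h holomorphic_on - B" "\<And>z. z \<in> - B - {b} \<Longrightarrow> h z = g z"
    using holomorphic_on_extend_lim[OF *] insert.prems(2)[of b] by auto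
  have "h z = 0"
  proof (rule insert.IH)
    show "h holomorphic_on - B" by fact
  next
    fix c assume c: "c \<in> B"
    have "eventually (\<lambda>z. z \<in> - insert b (B - {c})) (at c)"
      using c insert.hyps by (intro eventually_at_in_open' open_Compl finite_imp_closed) auto
    moreover have "eventually (\<lambda>z. z \<noteq> c) (at c)"
      by (auto simp: eventually_at_filter)
    ultimately have ev: "eventually (\<lambda>z. (z - c) * g z = (z - c) * h z) (at c)"
      by eventually_elim (use h(2) in auto)
    then show "((\<lambda>z. (z - c) * h z) \<longlongrightarrow> 0) (at c)"
      using insert.prems(2)[of c] c tendsto_cong[OF ev] by blast
  next
    have "bounded (insert b B)"
      using insert.hyps by (intro finite_imp_bounded) auto
    then obtain R where R: "\<And>x. x \<in> insert b B \<Longrightarrow> norm x \<le> R"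
      unfolding bounded_iff by blast
    have "eventually (\<lambda>z::complex. norm z \<ge> R + 1) at_infinity"
      by (auto simp: eventually_at_infinity)
    then have "eventually (\<lambda>z. g z = h z) at_infinity"
    proof eventually_elim
      case (elim z)
      then have "z \<notin> insert b B" using R[of z] by auto
      then show ?case using h(2) by auto
    qed
    then show "(h \<longlongrightarrow> 0) at_infinity"
      using insert.prems(3) by (simp add: tendsto_cong)
  qed (use insert.prems in auto)
  then show ?case using h(2)[of z] insert.prems by auto
qed

context toda
begin

definition KK :: "'a set \<Rightarrow> ('a \<Rightarrow> complex) \<Rightarrow> complex \<Rightarrow> complex \<Rightarrow> complex" where
  "KK F u q r = (\<Sum>A\<in>Pow F. q ^ card A * r ^ card (F - A) * (\<Prod>m\<in>A. \<Prod>n\<in>F - A. ff (u m / u n)))"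

lemma KK_insert:
  assumes "finite F" "e \<notin> F"
  shows "KK (insert e F) u q r = (\<Sum>A\<in>Pow F.
      q ^ card A * r ^ card (F - A) * (\<Prod>m\<in>A. \<Prod>n\<in>F - A. ff (u m / u n)) *
      (q * (\<Prod>n\<in>F - A. ff (u e / u n)) + r * (\<Prod>m\<in>A. ff (u m / u e))))"
  unfolding KK_def sum_Pow_insert[OF assms]
proof (rule sum.cong[OF refl])
  fix A assume A: "A \<in> Pow F"
  then have fin: "finite A" "finite (F - A)" and e: "e \<notin> A" "e \<notin> F - A"
    using assms finite_subset by auto
  have 1: "insert e F - A = insert e (F - A)" "insert e F - insert e A = F - A"
    using A e assms by auto
  show "q ^ card A * r ^ card (insert e F - A) * (\<Prod>m\<in>A. \<Prod>n\<in>insert e F - A. ff (u m / u n)) +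
      q ^ card (insert e A) * r ^ card (insert e F - insert e A) *
        (\<Prod>m\<in>insert e A. \<Prod>n\<in>insert e F - insert e A. ff (u m / u n)) =
      q ^ card A * r ^ card (F - A) * (\<Prod>m\<in>A. \<Prod>n\<in>F - A. ff (u m / u n)) *
      (q * (\<Prod>n\<in>F - A. ff (u e / u n)) + r * (\<Prod>m\<in>A. ff (u m / u e)))"
    using fin e unfolding 1 by (simp add: prod.distrib algebra_simps)
qed

text \<open>Both poles of f are L-th roots of unity, so points with different L-th powers have
  ratios away from the poles, also after multiplication by \<open>om 1\<close>.\<close>

lemma root_quotient:
  assumes "z ^ L = v ^ L" "u ^ L \<noteq> v ^ L" "u \<noteq> 0"
  shows "z / u \<notin> {1, om 1}" "om 1 * z / u \<notin> {1, om 1}"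
proof -
  have "(c * z / u) \<notin> {1, om 1}" if "c ^ L = 1" for c
  proof
    assume *: "c * z / u \<in> {1, om 1}"
    then have "(c * z / u) ^ L = 1" using om_1_power_L by auto
    then have "v ^ L = u ^ L" using that assms by (simp add: power_divide power_mult_distrib)
    then show False using assms by simp
  qed
  from this[of 1] this[of "om 1"] show "z / u \<notin> {1, om 1}" "om 1 * z / u \<notin> {1, om 1}"
    using om_1_power_L by auto
qed

text \<open>
  As a function of one variable \<open>z = u e\<close>, the residue at \<open>z = u n\<close> vanishes, while at
  \<open>z = \<omega>\<^sup>\<plusminus>\<^sup>1 u n\<close> the crossing relation turns it into a factor independent of \<open>A\<close> times the sum over
  \<open>F - {e, n}\<close>.  By induction the antisymmetric part in \<open>q, r\<close> is entire and vanishes at infinity.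
\<close>

lemma KK_sym_generic:
  fixes F :: "'a set"
  assumes "finite F" "\<And>n. n \<in> F \<Longrightarrow> u n \<noteq> 0" "inj_on (\<lambda>n. u n ^ L) F"
  shows "KK F u q r = KK F u r q"
  using assms
proof (induction F rule: finite_psubset_induct)
  case (psubset F)
  show ?case
  proof (cases "F = {}")
    case True
    then show ?thesis by (simp add: KK_def)
  next
    case False
    then obtain e where e: "e \<in> F" by auto
    define F' where "F' = F - {e}"
    have F: "F = insert e F'" "e \<notin> F'" "finite F'" "F' \<subset> F"
      using e psubset.hyps by (auto simp: F'_def)
    have IH: "KK G u q r = KK G u r q" if "G \<subseteq> F'" for G
      using that F psubset.prems by (intro psubset.IH) (auto intro: inj_on_subset)
    have nz: "u n \<noteq> 0" if "n \<in> F" for n using that psubset.prems by auto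
    have ne: "u n ^ L \<noteq> u m ^ L" if "n \<in> F" "m \<in> F" "n \<noteq> m" for n m
      using that psubset.prems(2) by (auto simp: inj_on_def)
    define t where "t q r A = q ^ card A * r ^ card (F' - A) * (\<Prod>m\<in>A. \<Prod>n\<in>F' - A. ff (u m / u n))" for q r A
    \<comment> \<open>Crossing has turned \<open>u m / z\<close> into \<open>om 1 * z / u m\<close>,
      so that z enters each factor as \<open>ff (c * z)\<close>, the form needed for residues and
      the limit at infinity.\<close>
    define G where "G q r z = (\<Sum>A\<in>Pow F'. t q r A *
      (q * (\<Prod>n\<in>F' - A. ff (inverse (u n) * z)) + r * (\<Prod>m\<in>A. ff (om 1 / u m * z))))" for q r z
    have G_e: "KK F u q r = G q r (u e)" for q r
    proof -
      have "(\<Prod>n\<in>F' - A. ff (u e / u n)) = (\<Prod>n\<in>F' - A. ff (inverse (u n) * u e))" for A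
        by (simp add: divide_inverse mult.commute)
      moreover have "(\<Prod>m\<in>A. ff (u m / u e)) = (\<Prod>m\<in>A. ff (om 1 / u m * u e))" if "A \<in> Pow F'" for A
      proof (rule prod.cong[OF refl])
        fix m assume "m \<in> A"
        then have "u m \<noteq> 0" "u e \<noteq> 0" using that nz F by auto
        from ff_crossing_div[OF this] show "ff (u m / u e) = ff (om 1 / u m * u e)" by simp
      qed
      ultimately show ?thesis
        unfolding F(1) KK_insert[OF F(3,2)] G_def t_def by (intro sum.cong refl) simp
    qed
    \<comment> \<open>A finite superset of the poles; at a point of B that is not a pole, both
      residues \<open>l1\<close> and \<open>l2\<close> below are 0.\<close>
    define B where "B = {z. z ^ L \<in> (\<lambda>n. u n ^ L) ` F'}"
    have finB: "finite B"
    proof -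
      have "B = (\<Union>n\<in>F'. {z. z ^ L = u n ^ L})" by (auto simp: B_def)
      moreover have "finite {z::complex. z ^ L = u n ^ L}" for n
        using L2 by (intro finite_nth_roots) auto
      ultimately show ?thesis using F(3) by auto
    qed
    define g where "g z = G q r z - G r q z" for z
    have nonpole: "inverse (u n) * z \<notin> {1, om 1}" "om 1 / u n * z \<notin> {1, om 1}" if "n \<in> F'" "z \<notin> B" for n z
    proof -
      have "z ^ L \<noteq> u n ^ L" using that by (auto simp: B_def)
      then have "u n ^ L \<noteq> z ^ L" by simp
      from root_quotient[OF refl this] nz[of n] that(1) F show
        "inverse (u n) * z \<notin> {1, om 1}" "om 1 / u n * z \<notin> {1, om 1}"
        by (simp_all add: divide_inverse mult_ac)
    qed
    have hol_ff: "(\<lambda>z. ff (c * z)) holomorphic_on S" if "\<And>z. z \<in> S \<Longrightarrow> c * z \<notin> {1, om 1}" for c S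
      unfolding f_fun_def using that by (intro holomorphic_intros) auto
    have holG: "G q r holomorphic_on - B" for q r
      unfolding G_def by (intro holomorphic_on_sum holomorphic_on_mult holomorphic_on_add holomorphic_on_prod
          holomorphic_on_const hol_ff; rule nonpole; auto)
    have hol: "g holomorphic_on - B"
      unfolding g_def by (intro holomorphic_on_diff holG)
    \<comment> \<open>Every factor containing z tends to 1, so e contributes only q + r, and what
      remains is symmetric by the induction hypothesis.\<close>
    have limG: "(G q r \<longlongrightarrow> (q + r) * KK F' u q r) at_infinity" for q r
    proof -
      have "((\<lambda>z. G q r z) \<longlongrightarrow> (\<Sum>A\<in>Pow F'. t q r A * (q * (\<Prod>n\<in>F' - A. 1) + r * (\<Prod>m\<in>A. 1)))) at_infinity"
        unfolding G_def using nz F by (intro tendsto_intros ff_at_infinity) auto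
      also have "(\<Sum>A\<in>Pow F'. t q r A * (q * (\<Prod>n\<in>F' - A. 1) + r * (\<Prod>m\<in>A. 1))) = (q + r) * KK F' u q r"
        by (simp add: KK_def t_def sum_distrib_left mult_ac)
      finally show ?thesis by simp
    qed
    have lim: "(g \<longlongrightarrow> 0) at_infinity"
      unfolding g_def using tendsto_diff[OF limG[of q r] limG[of r q]] IH[of F']
      by (simp add: algebra_simps)
    have res: "((\<lambda>z. (z - b) * g z) \<longlongrightarrow> 0) (at b)" if b: "b \<in> B" for b
    proof -
      obtain n where n: "n \<in> F'" "b ^ L = u n ^ L" using b by (auto simp: B_def)
      define F2 where "F2 = F' - {n}"
      have F2: "F' = insert n F2" "n \<notin> F2" "finite F2" "F2 \<subseteq> F'"
        using n F(3) by (auto simp: F2_def)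
      have un: "u n \<noteq> 0" using n nz F by auto
      have nzk: "u k \<noteq> 0" if "k \<in> F2" for k using that nz F2 F by auto
      have nek: "u k ^ L \<noteq> u n ^ L" if "k \<in> F2" for k using that ne[of k n] F2 F n by auto
      define l1 where "l1 = (if inverse (u n) * b = 1 then kap / inverse (u n)
          else if inverse (u n) * b = om 1 then - om 1 * kap / inverse (u n) else 0)"
      define l2 where "l2 = (if om 1 / u n * b = 1 then kap / (om 1 / u n)
          else if om 1 / u n * b = om 1 then - om 1 * kap / (om 1 / u n) else 0)"
      have l1: "((\<lambda>z. (z - b) * ff (inverse (u n) * z)) \<longlongrightarrow> l1) (at b)"
        unfolding l1_def using un by (intro ff_residue) auto
      have l2: "((\<lambda>z. (z - b) * ff (om 1 / u n * z)) \<longlongrightarrow> l2) (at b)"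
        unfolding l2_def using un by (intro ff_residue) auto
      define Y1 where "Y1 A = (\<Prod>m\<in>A. ff (u m / u n))" for A
      define Y2 where "Y2 A = (\<Prod>k\<in>F2 - A. ff (u n / u k))" for A
      define R1 where "R1 A z = (\<Prod>k\<in>F2 - A. ff (inverse (u k) * z))" for A z
      define R2 where "R2 A z = (\<Prod>m\<in>A. ff (om 1 / u m * z))" for A z
      have regular: "((\<lambda>z. ff (inverse (u k) * z)) \<longlongrightarrow> ff (inverse (u k) * b)) (at b)"
        "((\<lambda>z. ff (om 1 / u k * z)) \<longlongrightarrow> ff (om 1 / u k * b)) (at b)" if "k \<in> F2" for k
      proof -
        from root_quotient[OF n(2) nek[OF that] nzk[OF that]]
        have *: "inverse (u k) * b \<notin> {1, om 1}" "om 1 / u k * b \<notin> {1, om 1}"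
          by (simp_all add: divide_inverse mult_ac)
        show "((\<lambda>z. ff (inverse (u k) * z)) \<longlongrightarrow> ff (inverse (u k) * b)) (at b)"
          "((\<lambda>z. ff (om 1 / u k * z)) \<longlongrightarrow> ff (om 1 / u k * b)) (at b)"
          by (rule ff_tendsto[OF *(1)] ff_tendsto[OF *(2)]; intro tendsto_intros)+
      qed
      \<comment> \<open>\<open>Y1\<close>, \<open>Y2\<close> are the factors between n and the other
        indices, \<open>R1\<close>, \<open>R2\<close> those between e and the other indices. At b =
        u n both products agree and the residues are opposite. At the other poles, crossing makes Y
        and R complement each other to a product over all of \<open>F2\<close>.\<close>
      have "\<exists>D. \<forall>A\<in>Pow F2. l1 * (Y1 A * R1 A b) + l2 * (Y2 A * R2 A b) = D"
      proof (cases "b = u n")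
        case True
        have "l1 = u n * kap" "l2 = - u n * kap"
          using True un om_1_neq_1 by (auto simp: l1_def l2_def) (simp only: divide_inverse inverse_inverse_eq mult.commute)
        moreover have "R1 A b = Y2 A" "R2 A b = Y1 A" if "A \<in> Pow F2" for A
        proof -
          show "R1 A b = Y2 A"
            unfolding R1_def Y2_def True by (simp add: divide_inverse mult.commute)
          show "R2 A b = Y1 A"
            unfolding R2_def Y1_def True
          proof (rule prod.cong[OF refl])
            fix m assume "m \<in> A"
            then have "u m \<noteq> 0" using that nzk by auto
            from ff_crossing_div[OF this un] show "ff (om 1 / u m * u n) = ff (u m / u n)" by simp
          qed
        qed
        ultimately have "\<forall>A\<in>Pow F2. l1 * (Y1 A * R1 A b) + l2 * (Y2 A * R2 A b) = 0"
          by auto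
        then show ?thesis by blast
      next
        case False
        have e1: "l1 * (Y1 A * R1 A b) = l1 * (\<Prod>m\<in>F2. ff (u m / u n))" if A: "A \<in> Pow F2" for A
        proof (cases "l1 = 0")
          case l1nz: False
          then have b: "b = om 1 * u n" using False un by (auto simp: l1_def field_simps split: if_splits)
          have "R1 A b = (\<Prod>m\<in>F2 - A. ff (u m / u n))"
            unfolding R1_def b
          proof (rule prod.cong[OF refl])
            fix m assume "m \<in> F2 - A"
            then have "u m \<noteq> 0" using nzk by auto
            from ff_crossing_div[OF this un] show "ff (inverse (u m) * (om 1 * u n)) = ff (u m / u n)"
              by (simp add: divide_inverse mult_ac)
          qed
          then show ?thesis
            using A F2(3) by (simp add: Y1_def prod.subset_diff[of A F2] mult.commute)
        qed auto
        have e2: "l2 * (Y2 A * R2 A b) = l2 * (\<Prod>m\<in>F2. ff (u n / u m))" if A: "A \<in> Pow F2" for A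
        proof (cases "l2 = 0")
          case l1nz: False
          then have b: "u n = om 1 * b" using False un by (auto simp: l2_def field_simps split: if_splits)
          have "R2 A b = (\<Prod>m\<in>A. ff (u n / u m))"
            unfolding R2_def using b nzk un
            by (intro prod.cong refl) (auto simp: field_simps)
          then show ?thesis
            using A F2(3) by (simp add: Y2_def prod.subset_diff[of A F2] mult.commute)
        qed auto
        show ?thesis
          by (intro exI[of _ "l1 * (\<Prod>m\<in>F2. ff (u m / u n)) + l2 * (\<Prod>m\<in>F2. ff (u n / u m))"]
              ballI arg_cong2[where f = "(+)"] e1 e2)
      qed
      then obtain D where D: "\<And>A. A \<in> Pow F2 \<Longrightarrow> l1 * (Y1 A * R1 A b) + l2 * (Y2 A * R2 A b) = D" by blast
      \<comment> \<open>A factor is singular at b only if e and n lie on opposite sides of the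
        partition into A and its complement. This is why the limit carries the symmetric weight q *
        r.\<close>
      have limb: "((\<lambda>z. (z - b) * G q r z) \<longlongrightarrow> q * r * D * KK F2 u q r) (at b)" for q r
      proof -
        define s where "s A = q ^ card A * r ^ card (F2 - A) * (\<Prod>m\<in>A. \<Prod>n\<in>F2 - A. ff (u m / u n))" for A
        have t1: "t q r A = r * s A * Y1 A" and t2: "t q r (insert n A) = q * s A * Y2 A"
          and F1: "F' - A = insert n (F2 - A)" "F' - insert n A = F2 - A" if A: "A \<in> Pow F2" for A
        proof -
          have fin: "finite A" "finite (F2 - A)" and n': "n \<notin> A" "n \<notin> F2 - A"
            using A F2 finite_subset by auto
          show 1: "F' - A = insert n (F2 - A)" "F' - insert n A = F2 - A"
            using A F2 by auto
          show "t q r A = r * s A * Y1 A" "t q r (insert n A) = q * s A * Y2 A"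
            unfolding t_def s_def 1 Y1_def Y2_def using fin n' by (simp_all add: prod.distrib algebra_simps)
        qed
        have R: "((\<lambda>z. R1 A z) \<longlongrightarrow> R1 A b) (at b)" "((\<lambda>z. R2 A z) \<longlongrightarrow> R2 A b) (at b)" if "A \<in> Pow F2" for A
          unfolding R1_def R2_def using that by (intro tendsto_prod regular; auto)+
        have split: "G q r z = (\<Sum>A\<in>Pow F2. r * s A * Y1 A * (q * (ff (inverse (u n) * z) * R1 A z) + r * R2 A z) +
            q * s A * Y2 A * (q * R1 A z + r * (ff (om 1 / u n * z) * R2 A z)))" for z
          unfolding G_def F2(1) sum_Pow_insert[OF F2(3,2)]
        proof (rule sum.cong[OF refl])
          fix A assume A: "A \<in> Pow F2"
          have fin: "finite A" "finite (F2 - A)" and n': "n \<notin> A" "n \<notin> F2 - A"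
            using A F2 finite_subset by auto
          show "t q r A * (q * (\<Prod>n\<in>insert n F2 - A. ff (inverse (u n) * z)) + r * (\<Prod>m\<in>A. ff (om 1 / u m * z))) +
            t q r (insert n A) * (q * (\<Prod>n\<in>insert n F2 - insert n A. ff (inverse (u n) * z)) +
              r * (\<Prod>m\<in>insert n A. ff (om 1 / u m * z))) =
            r * s A * Y1 A * (q * (ff (inverse (u n) * z) * R1 A z) + r * R2 A z) +
            q * s A * Y2 A * (q * R1 A z + r * (ff (om 1 / u n * z) * R2 A z))"
            unfolding F1[OF A, unfolded F2(1)] t1[OF A] t2[OF A] R1_def R2_def using fin n' by simp
        qed
        have "(\<lambda>z. (z - b) * G q r z) = (\<lambda>z. \<Sum>A\<in>Pow F2.
            r * s A * Y1 A * (q * (((z - b) * ff (inverse (u n) * z)) * R1 A z) + r * ((z - b) * R2 A z)) +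
            q * s A * Y2 A * (q * ((z - b) * R1 A z) + r * (((z - b) * ff (om 1 / u n * z)) * R2 A z)))"
          unfolding split sum_distrib_left by (intro ext sum.cong refl) (simp add: algebra_simps)
        moreover have "(\<dots> \<longlongrightarrow> (\<Sum>A\<in>Pow F2.
            r * s A * Y1 A * (q * (l1 * R1 A b) + r * ((b - b) * R2 A b)) +
            q * s A * Y2 A * (q * ((b - b) * R1 A b) + r * (l2 * R2 A b)))) (at b)"
          by (intro tendsto_sum tendsto_add tendsto_mult tendsto_const l1 l2 R tendsto_diff tendsto_ident_at)
        ultimately have "((\<lambda>z. (z - b) * G q r z) \<longlongrightarrow> (\<Sum>A\<in>Pow F2.
            r * s A * Y1 A * (q * (l1 * R1 A b) + r * ((b - b) * R2 A b)) +
            q * s A * Y2 A * (q * ((b - b) * R1 A b) + r * (l2 * R2 A b)))) (at b)"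
          by simp
        also have "(\<Sum>A\<in>Pow F2. r * s A * Y1 A * (q * (l1 * R1 A b) + r * ((b - b) * R2 A b)) +
              q * s A * Y2 A * (q * ((b - b) * R1 A b) + r * (l2 * R2 A b))) =
            (\<Sum>A\<in>Pow F2. q * r * s A * (l1 * (Y1 A * R1 A b) + l2 * (Y2 A * R2 A b)))"
          by (intro sum.cong refl) (simp add: algebra_simps)
        also have "\<dots> = q * r * D * KK F2 u q r"
          using D by (simp add: KK_def s_def sum_distrib_left mult_ac)
        finally show ?thesis .
      qed
      have "((\<lambda>z. (z - b) * G q r z - (z - b) * G r q z) \<longlongrightarrow>
          q * r * D * KK F2 u q r - r * q * D * KK F2 u r q) (at b)"
        by (intro tendsto_diff limb)
      then show ?thesis
        using IH[OF F2(4)] by (simp add: g_def algebra_simps)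
    qed
    have "u e \<notin> B"
      using ne[of e] e F by (auto simp: B_def)
    then have "g (u e) = 0"
      using holomorphic_eq_0_of_removable[OF finB hol res lim] by blast
    then show ?thesis by (simp add: G_e g_def)
  qed
qed

text \<open>Continuity extends the generic case to all points off the poles. The perturbation scales
  the points by real factors growing at distinct rates: equal L-th powers get different moduli as
  soon as \<eta> > 0, and different ones stay different for small \<eta>.\<close>

lemma KK_sym:
  fixes F :: "'a set"
  assumes F: "finite F" and nz: "\<And>n. n \<in> F \<Longrightarrow> u n \<noteq> 0"
    and np: "\<And>m n. m \<in> F \<Longrightarrow> n \<in> F \<Longrightarrow> m \<noteq> n \<Longrightarrow> u m / u n \<notin> {1, om 1}"
  shows "KK F u q r = KK F u r q"
proof -
  obtain idx :: "'a \<Rightarrow> nat" where idx: "inj_on idx F"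
    using finite_imp_inj_to_nat_seg[OF F] by blast
  define v where "v \<eta> n = u n * exp (complex_of_real (\<eta> * idx n))" for \<eta> :: real and n
  have v: "((\<lambda>\<eta>. v \<eta> n) \<longlongrightarrow> u n) (at_right 0)" for n
  proof -
    have "((\<lambda>\<eta>. v \<eta> n) \<longlongrightarrow> u n * exp (complex_of_real (0 * real (idx n)))) (at_right 0)"
      unfolding v_def by (intro tendsto_intros)
    then show ?thesis by simp
  qed
  have lim: "((\<lambda>\<eta>. KK F (v \<eta>) q r) \<longlongrightarrow> KK F u q r) (at_right 0)" for q r
    unfolding KK_def
  proof (intro tendsto_sum tendsto_mult tendsto_const tendsto_prod ff_tendsto tendsto_divide v)
    fix A m n assume "A \<in> Pow F" "m \<in> A" "n \<in> F - A"
    then have *: "m \<in> F" "n \<in> F" "m \<noteq> n" by auto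
    show "u m / u n \<notin> {1, om 1}" using np * by auto
    show "u n \<noteq> 0" using nz * by auto
  qed
  have ne: "eventually (\<lambda>\<eta>. v \<eta> m ^ L \<noteq> v \<eta> n ^ L) (at_right 0)" if "m \<in> F" "n \<in> F" "m \<noteq> n" for m n
  proof -
    define c where "c = real L * (real (idx n) - real (idx m))"
    have c: "c \<noteq> 0" using idx that L2 by (auto simp: c_def inj_on_def)
    have eq: "u m ^ L / u n ^ L = exp (complex_of_real (\<eta> * c))" if "v \<eta> m ^ L = v \<eta> n ^ L" for \<eta>
    proof -
      have aux: "a / b = y / x" if "a * x = b * y" "b \<noteq> 0" "x \<noteq> 0" for a b x y :: complex
        using that by (simp add: frac_eq_eq mult.commute)
      have "u m ^ L * exp (complex_of_real (L * \<eta> * idx m)) = u n ^ L * exp (complex_of_real (L * \<eta> * idx n))"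
        using that by (simp add: v_def power_mult_distrib exp_of_nat_mult [symmetric] mult_ac)
      moreover have "exp (complex_of_real (\<eta> * c)) =
          exp (complex_of_real (L * \<eta> * idx n)) / exp (complex_of_real (L * \<eta> * idx m))"
        by (simp add: exp_diff [symmetric] c_def algebra_simps)
      ultimately show ?thesis
        using nz[OF \<open>n \<in> F\<close>] aux by (metis exp_not_eq_zero power_not_zero)
    qed
    show ?thesis
    proof (cases "u m ^ L / u n ^ L = 1")
      case True
      have "eventually (\<lambda>\<eta>::real. \<eta> > 0) (at_right 0)"
        by (simp add: eventually_at_right_less)
      then show ?thesis
      proof eventually_elim
        case (elim \<eta>)
        show ?case
        proof
          assume "v \<eta> m ^ L = v \<eta> n ^ L"
          then have "exp (complex_of_real (\<eta> * c)) = 1"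
            using eq[of \<eta>] True by metis
          then have "complex_of_real (exp (\<eta> * c)) = of_real 1"
            by (metis exp_of_real of_real_1)
          then have "exp (\<eta> * c) = 1" using of_real_eq_iff by blast
          then show False using elim c by simp
        qed
      qed
    next
      case False
      have "((\<lambda>\<eta>. exp (complex_of_real (\<eta> * c))) \<longlongrightarrow> exp (complex_of_real (0 * c))) (at_right 0)"
        by (intro tendsto_intros)
      then have "eventually (\<lambda>\<eta>. exp (complex_of_real (\<eta> * c)) \<noteq> u m ^ L / u n ^ L) (at_right 0)"
        using False by (intro tendsto_imp_eventually_ne) auto
      then show ?thesis
        by eventually_elim (use eq in metis)
    qed
  qed
  have "eventually (\<lambda>\<eta>. \<forall>m\<in>F. \<forall>n\<in>F. m \<noteq> n \<longrightarrow> v \<eta> m ^ L \<noteq> v \<eta> n ^ L) (at_right 0)"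
    using F ne by (intro eventually_ball_finite ballI) (auto intro: eventually_mono)
  then have "eventually (\<lambda>\<eta>. KK F (v \<eta>) q r = KK F (v \<eta>) r q) (at_right 0)"
  proof eventually_elim
    case (elim \<eta>)
    show ?case
      by (rule KK_sym_generic) (use elim F nz in \<open>auto simp: inj_on_def v_def\<close>)
  qed
  then have "((\<lambda>\<eta>. KK F (v \<eta>) q r) \<longlongrightarrow> KK F u r q) (at_right 0)"
    using lim[of r q] by (simp add: tendsto_cong)
  then show ?thesis
    using lim[of q r] by (intro tendsto_unique[of "at_right (0::real)"]) auto
qed

end

section \<open>Reflection invariance without descendants\<close>

lemma form_linear:
  "form (a + b) c = form a c + form b c" "form (x *s a) c = x * form a c"
  "form a (b + c) = form a b + form a c" "form a (x *s b) = x * form a b"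
  "form (a - b) c = form a c - form b c" "form a (b - c) = form a b - form a c"
  by (simp_all add: form_def algebra_simps sum.distrib sum_distrib_left sum_subtractf)

lemma form_0: "form a 0 = 0"
  by (simp add: form_def)

lemma form_sum: "form a (sum g A) = (\<Sum>x\<in>A. form a (g x))"
  by (induction A rule: infinite_finite_induct) (simp_all add: form_linear form_0)

lemma node_inj: "node (i :: 'i::finite) = node j \<longleftrightarrow> i = j"
  using bij_betw_node[where 'i = 'i] by (auto simp: bij_betw_def inj_on_def)

lemma node_range: "node (i :: 'i::finite) \<in> {1..CARD('i)}"
  using bij_betw_node[where 'i = 'i] by (auto simp: bij_betw_def)

lemma alpha_eq_weight_diff: "alpha (i :: 'i::finite) = weight L (node i) - weight L (node i + 1)"
  by (simp add: vec_eq_iff alpha_def axis_def weight_def) (metis node_inj less_antisym)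

text \<open>Since \<alpha>_i = H_i - H_(i+1), the reflection w_i acts on the weights as the
  transposition of i and i + 1.\<close>

lemma form_reflection_weight:
  assumes "L \<ge> 2" "CARD('i::finite) = L - 1" "s \<in> {1..L}"
  shows "form (simple_reflection (i :: 'i) a) (weight L s) =
    form a (weight L (Transposition.transpose (node i) (node i + 1) s))"
proof -
  have "form a (alpha i) = form a (weight L (node i)) - form a (weight L (node i + 1))"
    unfolding alpha_eq_weight_diff[of i L] by (simp add: form_linear)
  then show ?thesis
    unfolding simple_reflection_def form_linear form_alpha_weight[OF assms]
    by (auto simp: Transposition.transpose_def)
qed

text \<open>A and B are disjoint, so every element of A \<times> B occurs exactly once as an
  unordered pair; the conditional orients the pair from A to B whatever the order of its
  indices.\<close>

lemma prod_unordered_pairs: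
  fixes g :: "nat \<Rightarrow> nat \<Rightarrow> 'b::comm_monoid_mult"
  assumes "A \<subseteq> {1..N}" "B \<subseteq> {1..N}" "A \<inter> B = {}"
  shows "(\<Prod>n\<in>{1..N}. \<Prod>m\<in>{1..<n}. if m \<in> A \<and> n \<in> B then g m n else if n \<in> A \<and> m \<in> B then g n m else 1) =
    (\<Prod>m\<in>A. \<Prod>n\<in>B. g m n)"
proof -
  have fin: "finite A" "finite B" by (rule finite_subset[OF assms(1)] finite_subset[OF assms(2)], simp)+
  let ?S = "Sigma {1..N} (\<lambda>n. {1..<n})"
  have "(\<Prod>n\<in>{1..N}. \<Prod>m\<in>{1..<n}. if m \<in> A \<and> n \<in> B then g m n else if n \<in> A \<and> m \<in> B then g n m else 1) =
    (\<Prod>(n,m)\<in>?S. (if m \<in> A \<and> n \<in> B then g m n else 1) * (if n \<in> A \<and> m \<in> B then g n m else 1))"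
    by (subst prod.Sigma) (use assms(3) in \<open>auto intro!: prod.cong\<close>)
  also have "\<dots> = (\<Prod>(n,m)\<in>?S. if m \<in> A \<and> n \<in> B then g m n else 1) *
      (\<Prod>(n,m)\<in>?S. if n \<in> A \<and> m \<in> B then g n m else 1)"
    by (simp add: prod.distrib case_prod_unfold)
  also have "(\<Prod>(n,m)\<in>?S. if m \<in> A \<and> n \<in> B then g m n else 1) =
      (\<Prod>(m,n)\<in>{(m,n). m \<in> A \<and> n \<in> B \<and> m < n}. g m n)"
  proof -
    have "(\<Prod>(n,m)\<in>?S. if m \<in> A \<and> n \<in> B then g m n else 1) =
      (\<Prod>(n,m)\<in>{(n,m). m \<in> A \<and> n \<in> B \<and> m < n}. if m \<in> A \<and> n \<in> B then g m n else 1)"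
      by (rule prod.mono_neutral_right) (use assms in auto)
    also have "\<dots> = (\<Prod>(m,n)\<in>{(m,n). m \<in> A \<and> n \<in> B \<and> m < n}. g m n)"
      by (rule prod.reindex_bij_witness[of _ prod.swap prod.swap]) auto
    finally show ?thesis .
  qed
  also have "(\<Prod>(n,m)\<in>?S. if n \<in> A \<and> m \<in> B then g n m else 1) =
      (\<Prod>(m,n)\<in>{(m,n). m \<in> A \<and> n \<in> B \<and> \<not> m < n}. g m n)"
  proof -
    have "(\<Prod>(n,m)\<in>?S. if n \<in> A \<and> m \<in> B then g n m else 1) =
      (\<Prod>(n,m)\<in>{(n,m). n \<in> A \<and> m \<in> B \<and> \<not> n < m}. if n \<in> A \<and> m \<in> B then g n m else 1)"
    proof (rule prod.mono_neutral_right)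
      show "{(n,m). n \<in> A \<and> m \<in> B \<and> \<not> n < m} \<subseteq> ?S"
      proof safe
        fix n m assume "n \<in> A" "m \<in> B" "\<not> n < m"
        then have "n \<noteq> m" using assms(3) by auto
        then show "n \<in> {1..N}" "m \<in> {1..<n}" using assms \<open>n \<in> A\<close> \<open>m \<in> B\<close> \<open>\<not> n < m\<close> by auto
      qed
    qed (auto split: if_splits)
    also have "\<dots> = (\<Prod>(m,n)\<in>{(m,n). m \<in> A \<and> n \<in> B \<and> \<not> m < n}. g m n)"
      by (rule prod.cong) auto
    finally show ?thesis .
  qed
  also have "(\<Prod>(m,n)\<in>{(m,n). m \<in> A \<and> n \<in> B \<and> m < n}. g m n) *
      (\<Prod>(m,n)\<in>{(m,n). m \<in> A \<and> n \<in> B \<and> \<not> m < n}. g m n) = (\<Prod>(m,n)\<in>A \<times> B. g m n)"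
  proof -
    have fs: "finite {(m,n). m \<in> A \<and> n \<in> B \<and> m < n}" "finite {(m,n). m \<in> A \<and> n \<in> B \<and> \<not> m < n}"
      by (rule finite_subset[of _ "A \<times> B"]; use fin in auto)+
    show ?thesis
      by (subst prod.union_disjoint[symmetric]) (use fs in \<open>auto intro!: prod.cong\<close>)
  qed
  also have "\<dots> = (\<Prod>m\<in>A. \<Prod>n\<in>B. g m n)"
    by (simp add: prod.cartesian_product)
  finally show ?thesis .
qed

text \<open>No label lies strictly between j and j + 1, so replacing the one by the other changes no
  position, hence no site variable.\<close>

lemma position_swap:
  assumes "j \<notin> T" "Suc j \<notin> T" "finite T" "b \<in> {j, Suc j}"
  shows "s \<in> T \<Longrightarrow> position (insert b T) s = card {t \<in> T. t \<le> s} + (if j < s then 1 else 0)"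
    and "position (insert b T) b = card {t \<in> T. t \<le> j} + 1"
proof -
  have bT: "b \<notin> T" using assms by auto
  have *: "{t \<in> insert b T. t \<le> s} = (if b \<le> s then insert b {t \<in> T. t \<le> s} else {t \<in> T. t \<le> s})" for s
    by auto
  show "position (insert b T) s = card {t \<in> T. t \<le> s} + (if j < s then 1 else 0)" if "s \<in> T"
  proof -
    have "s \<noteq> j" "s \<noteq> Suc j" using that assms by auto
    then have "b \<le> s \<longleftrightarrow> j < s" using assms(4) by auto
    then show ?thesis unfolding position_def * using bT assms(3) by simp
  qed
  have "{t \<in> T. t \<le> b} = {t \<in> T. t \<le> j}"
    using assms le_Suc_eq by auto
  then show "position (insert b T) b = card {t \<in> T. t \<le> j} + 1"
    unfolding position_def * using bT assms(3) by simp
qed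

section \<open>Sums over label configurations and the exchange of two neighbouring labels\<close>

definition configs :: "nat \<Rightarrow> nat \<Rightarrow> (nat \<Rightarrow> nat) \<Rightarrow> (nat \<Rightarrow> nat set) set" where
  "configs L N k = (\<Pi>\<^sub>E n\<in>{1..N}. {T. T \<subseteq> {1..L} \<and> card T = k n})"

lemma finite_configs: "finite (configs L N k)"
  unfolding configs_def by (intro finite_PiE) (auto intro: finite_subset[of _ "Pow {1..L}"])

lemma configsD:
  assumes "S \<in> configs L N k" "n \<in> {1..N}"
  shows "S n \<subseteq> {1..L}" "card (S n) = k n" "finite (S n)"
proof -
  show "S n \<subseteq> {1..L}" "card (S n) = k n" using assms by (auto simp: configs_def PiE_iff)
  then show "finite (S n)" using finite_subset by blast
qed

context toda
begin

definition pf :: "nat \<Rightarrow> nat \<Rightarrow> complex \<Rightarrow> complex \<Rightarrow> complex" where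
  "pf s t v w = (if s < t then ff (v / w) else if s > t then ff (w / v) else 1)"

definition Psi :: "nat set \<Rightarrow> complex \<Rightarrow> nat set \<Rightarrow> complex \<Rightarrow> complex" where
  "Psi T v T' v' = (\<Prod>s\<in>T. \<Prod>t\<in>T'. pf s t (y_at L T v s) (y_at L T' v' t))"

lemma Phi_eq: "Phi L p N S x = (\<Prod>n\<in>{1..N}. \<Prod>m\<in>{1..<n}. Psi (S m) (x m) (S n) (x n))"
  by (simp add: Phi_def Psi_def pf_def)

lemma Psi_commute: "Psi T v T' v' = Psi T' v' T v"
  unfolding Psi_def by (subst prod.swap) (auto simp: pf_def intro!: prod.cong)

lemma y_at_nonzero: "v \<noteq> 0 \<Longrightarrow> y_at L T v s \<noteq> 0"
  by (simp add: y_at_def y_var_def)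

context
  fixes j :: nat and T :: "nat set"
  assumes T: "j \<notin> T" "Suc j \<notin> T" "finite T"
begin

lemma y_at_swap:
  assumes "b \<in> {j, Suc j}"
  shows "s \<in> T \<Longrightarrow> y_at L (insert b T) v s = y_at L (insert j T) v s"
    and "y_at L (insert b T) v b = y_at L (insert j T) v j"
  using position_swap[OF T assms] position_swap[OF T, of j] T assms by (auto simp: y_at_def)

text \<open>If T' has neither label, j and j + 1 compare alike with all its elements. If it has
  both, they are neighbours in position, so \<open>y j = om 1 * y (Suc j)\<close>, and crossing
  identifies the factor \<open>ff (y j / u)\<close> of the choice j + 1 with the factor
  \<open>ff (u / y (Suc j))\<close> of the choice j.\<close>

lemma Psi_swap_inert:
  assumes v: "v \<noteq> 0" "v' \<noteq> 0" and T': "finite T'" "j \<in> T' \<longleftrightarrow> Suc j \<in> T'" and b: "b \<in> {j, Suc j}"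
  shows "Psi (insert b T) v T' v' = Psi (insert j T) v T' v'"
proof -
  define u where "u = y_at L (insert j T) v j"
  define y where "y = y_at L T' v'"
  have nz: "u \<noteq> 0" "\<And>t. y t \<noteq> 0" using v by (auto simp: u_def y_def y_at_nonzero)
  have "(\<Prod>t\<in>T'. pf (Suc j) t u (y t)) = (\<Prod>t\<in>T'. pf j t u (y t))"
  proof (cases "j \<in> T'")
    case False
    then show ?thesis using T' by (intro prod.cong) (auto simp: pf_def; metis Suc_lessI less_antisym)+
  next
    case True
    have "{t \<in> T'. t \<le> Suc j} = insert (Suc j) {t \<in> T'. t \<le> j}"
      using T' True by (auto simp: le_Suc_eq)
    then have "position T' (Suc j) = Suc (position T' j)"
      using T' by (simp add: position_def)
    then have "y j = om 1 * y (Suc j)"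
      by (simp add: y_def y_at_def y_var_def omega_pow_add[symmetric] add_divide_distrib diff_divide_distrib algebra_simps)
    then have "ff (y j / u) = ff (u / y (Suc j))"
      using ff_crossing_div[of u "y (Suc j)"] nz by simp
    then have e: "pf (Suc j) j u (y j) * pf (Suc j) (Suc j) u (y (Suc j)) =
        pf j j u (y j) * pf j (Suc j) u (y (Suc j))"
      by (simp add: pf_def)
    have eq: "T' = insert j (insert (Suc j) (T' - {j, Suc j}))" using True T' by auto
    have split: "(\<Prod>t\<in>T'. h t) = h j * h (Suc j) * (\<Prod>t\<in>T' - {j, Suc j}. h t)" for h :: "nat \<Rightarrow> complex"
      by (subst eq) (use T' in \<open>simp add: mult.assoc\<close>)
    have "(\<Prod>t\<in>T' - {j, Suc j}. pf (Suc j) t u (y t)) = (\<Prod>t\<in>T' - {j, Suc j}. pf j t u (y t))"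
      by (intro prod.cong) (auto simp: pf_def)
    then show ?thesis unfolding split e by simp
  qed
  then have "(\<Prod>t\<in>T'. pf b t u (y t)) = (\<Prod>t\<in>T'. pf j t u (y t))" using b by auto
  moreover have "b \<notin> T" using b T by auto
  ultimately show ?thesis
    using T unfolding Psi_def by (simp add: y_at_swap[OF b] u_def y_def)
qed

text \<open>Only the factor between the two exchanged labels depends on b and b'; it is 1 in the
  reference term, where both labels are j.\<close>

lemma Psi_swap_both:
  assumes T': "j \<notin> T'" "Suc j \<notin> T'" "finite T'"
    and b: "b \<in> {j, Suc j}" "b' \<in> {j, Suc j}"
  shows "Psi (insert b T) v (insert b' T') v' = Psi (insert j T) v (insert j T') v' *
     pf b b' (y_at L (insert j T) v j) (y_at L (insert j T') v' j)"
proof -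
  have nb: "b \<notin> T" "b' \<notin> T'" using b T T' by auto
  have pf1: "pf b t w w' = pf j t w w'" if "t \<in> T'" for t w w'
  proof -
    have "t \<noteq> j" "t \<noteq> Suc j" using that T' by auto
    then have "b < t \<longleftrightarrow> j < t" "b > t \<longleftrightarrow> j > t" using b by auto
    then show ?thesis by (simp add: pf_def)
  qed
  have pf2: "pf t b' w w' = pf t j w w'" if "t \<in> T" for t w w'
  proof -
    have "t \<noteq> j" "t \<noteq> Suc j" using that T by auto
    then have "b' < t \<longleftrightarrow> j < t" "b' > t \<longleftrightarrow> j > t" using b by auto
    then show ?thesis by (simp add: pf_def)
  qed
  have pf3: "pf j j w w' = 1" for w w' by (simp add: pf_def)
  show ?thesis
    using T T' nb unfolding Psi_def
    by (simp add: y_at_swap[OF b(1)] prod.distrib pf3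
      y_at_swap(1)[OF b(1)] pf1 pf2 toda.y_at_swap[OF toda_axioms T' b(2)] mult_ac)
qed

end

lemma position_bij:
  assumes "finite T"
  shows "bij_betw (position T) T {1..card T}"
proof -
  have inj: "inj_on (position T) T"
  proof (rule linorder_inj_onI)
    fix s t assume "s < t" "s \<in> T" "t \<in> T"
    then have "{r \<in> T. r \<le> s} \<subseteq> {r \<in> T. r \<le> t}" "t \<in> {r \<in> T. r \<le> t}" "t \<notin> {r \<in> T. r \<le> s}"
      by auto
    then have "{r \<in> T. r \<le> s} \<subset> {r \<in> T. r \<le> t}" by blast
    then have "position T s < position T t"
      unfolding position_def using assms by (intro psubset_card_mono) auto
    then show "position T s \<noteq> position T t" by simp
  qed auto
  moreover have "position T ` T \<subseteq> {1..card T}"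
  proof safe
    fix s assume "s \<in> T"
    then have "{s} \<subseteq> {r \<in> T. r \<le> s}" by auto
    then have "card {s} \<le> position T s"
      unfolding position_def using assms by (intro card_mono) auto
    moreover have "position T s \<le> card T"
      unfolding position_def using assms by (intro card_mono) auto
    ultimately show "position T s \<in> {1..card T}" by simp
  qed
  ultimately show ?thesis
    using card_image[OF inj] by (simp add: bij_betw_def card_subset_eq)
qed

lemma position_in:
  assumes "finite T" "s \<in> T"
  shows "position T s \<in> {1..card T}"
  using bij_betw_apply[OF position_bij] assms by blast

text \<open>J for h = 1 with arbitrary label weights \<zeta> in place of the exponentials of a. A
  simple reflection then becomes a transposition of two values of \<zeta>.\<close>

definition JZ :: "nat \<Rightarrow> (nat \<Rightarrow> nat) \<Rightarrow> (nat \<Rightarrow> complex) \<Rightarrow> (nat \<Rightarrow> complex) \<Rightarrow> complex" where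
  "JZ N k \<zeta> x = (\<Sum>S\<in>configs L N k. (\<Prod>n\<in>{1..N}. \<Prod>s\<in>S n. \<zeta> s) * Phi L p N S x)"

lemma prod_if_const:
  assumes "A \<subseteq> I" "finite I"
  shows "(\<Prod>n\<in>I. if n \<in> A then a else 1) = (a :: complex) ^ card A"
  using assms by (simp add: prod.If_cases Int_absorb1)

text \<open>The representatives in \<open>D\<close> never contain j + 1 without j. The class of R
  consists of the configurations \<open>sw R A\<close>, where A is the set of those free indices in
  \<open>F R\<close> that keep j while the others switch to j + 1. By the two exchange lemmas only
  the factors between free indices vary within a class, so its sum is a multiple of KK in the sites
  of label j, with q and r the weights of j and j + 1.\<close>

lemma JZ_swap:
  assumes np: "no_poles L N k x" and j: "1 \<le> j" "Suc j \<le> L"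
  shows "JZ N k (\<zeta> \<circ> Transposition.transpose j (Suc j)) x = JZ N k \<zeta> x"
proof -
  define D where "D = {R \<in> configs L N k. \<forall>n\<in>{1..N}. Suc j \<in> R n \<longrightarrow> j \<in> R n}"
  define F where "F R = {n \<in> {1..N}. j \<in> R n \<and> Suc j \<notin> R n}" for R :: "nat \<Rightarrow> nat set"
  define sw where "sw R A = (\<lambda>n. if n \<in> F R - A then insert (Suc j) (R n - {j}) else R n)" for R A
  define can where "can S = (\<lambda>n. if n \<in> {1..N} \<and> Suc j \<in> S n \<and> j \<notin> S n then insert j (S n - {Suc j}) else S n)"
    for S :: "nat \<Rightarrow> nat set"
  have card_sw: "card (insert b (T - {c})) = card T" if "finite T" "c \<in> T" "b \<notin> T" for T and b c :: nat
  proof -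
    have "card T > 0" using that card_gt_0_iff by blast
    then show ?thesis using that by (simp add: card_Diff_singleton)
  qed
  have sw_in: "sw R A \<in> configs L N k" if R: "R \<in> configs L N k" and A: "A \<subseteq> F R" for R A
  proof -
    have "sw R A n \<subseteq> {1..L} \<and> card (sw R A n) = k n" if n: "n \<in> {1..N}" for n
    proof (cases "n \<in> F R - A")
      case True
      then have "j \<in> R n" "Suc j \<notin> R n" by (auto simp: F_def)
      then show ?thesis
        using configsD[OF R n] j True card_sw[of "R n" j "Suc j"] by (auto simp: sw_def)
    qed (use configsD[OF R n] in \<open>auto simp: sw_def\<close>)
    moreover have "sw R A n = undefined" if "n \<notin> {1..N}" for n
      using that R by (auto simp: sw_def F_def configs_def PiE_iff extensional_def)
    ultimately show ?thesis by (auto simp: configs_def PiE_iff extensional_def)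
  qed
  have can_in: "can S \<in> D" if S: "S \<in> configs L N k" for S
  proof -
    have "can S n \<subseteq> {1..L} \<and> card (can S n) = k n \<and> (Suc j \<in> can S n \<longrightarrow> j \<in> can S n)" if n: "n \<in> {1..N}" for n
    proof (cases "Suc j \<in> S n \<and> j \<notin> S n")
      case True
      then show ?thesis
        using configsD[OF S n] j n card_sw[of "S n" "Suc j" j] by (auto simp: can_def)
    qed (use configsD[OF S n] in \<open>auto simp: can_def\<close>)
    moreover have "can S n = undefined" if "n \<notin> {1..N}" for n
      using that S by (auto simp: can_def configs_def PiE_iff extensional_def)
    ultimately show ?thesis by (auto simp: D_def configs_def PiE_iff extensional_def)
  qed
  have reidx: "(\<Sum>S\<in>configs L N k. g S) = (\<Sum>R\<in>D. \<Sum>A\<in>Pow (F R). g (sw R A))" for g :: "(nat \<Rightarrow> nat set) \<Rightarrow> complex"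
  proof -
    have "(\<Sum>S\<in>configs L N k. g S) = (\<Sum>(R,A)\<in>Sigma D (\<lambda>R. Pow (F R)). g (sw R A))"
    \<comment> \<open>Applied to an arbitrary configuration S, \<open>F S\<close> collects the
      indices that contain j without j + 1. These are the free indices of \<open>can S\<close> that
      keep j, so the pair recovers S.\<close>
    proof (rule sum.reindex_bij_witness[of _ "\<lambda>(R,A). sw R A" "\<lambda>S. (can S, F S)"])
      fix S assume S: "S \<in> configs L N k"
      have "F S \<subseteq> F (can S)" by (auto simp: F_def can_def)
      with can_in[OF S] show "(can S, F S) \<in> Sigma D (\<lambda>R. Pow (F R))" by auto
      have "sw (can S) (F S) n = S n" for n
        by (auto simp: sw_def can_def F_def)
      then have eq: "sw (can S) (F S) = S" by auto
      then show "(case (can S, F S) of (R, A) \<Rightarrow> sw R A) = S" by simp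
      show "(case (can S, F S) of (R, A) \<Rightarrow> g (sw R A)) = g S" using eq by simp
    next
      fix b assume b: "b \<in> Sigma D (\<lambda>R. Pow (F R))"
      obtain R A where RA: "b = (R, A)" "R \<in> D" "A \<subseteq> F R" using b by auto
      have "F (sw R A) = A"
        using RA by (auto simp: F_def sw_def D_def)
      moreover have "can (sw R A) n = R n" for n
        using RA by (auto simp: F_def sw_def D_def can_def)
      ultimately show "(can (case b of (R, A) \<Rightarrow> sw R A), F (case b of (R, A) \<Rightarrow> sw R A)) = b"
        using RA by auto
      show "(case b of (R, A) \<Rightarrow> sw R A) \<in> configs L N k"
        using sw_in RA by (auto simp: D_def)
    qed
    also have "\<dots> = (\<Sum>R\<in>D. \<Sum>A\<in>Pow (F R). g (sw R A))"
      by (rule sum.Sigma[symmetric]) (auto simp: D_def F_def finite_configs)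
    finally show ?thesis .
  qed
  define u where "u R n = y_at L (R n) (x n) j" for R :: "nat \<Rightarrow> nat set" and n
  define c where "c R \<zeta> = (\<Prod>n\<in>{1..N}. if n \<in> F R then \<Prod>s\<in>R n - {j}. \<zeta> s else \<Prod>s\<in>R n. \<zeta> s)"
    for R and \<zeta> :: "nat \<Rightarrow> complex"
  have inner: "(\<Sum>A\<in>Pow (F R). (\<Prod>n\<in>{1..N}. \<Prod>s\<in>sw R A n. \<zeta> s) * Phi L p N (sw R A) x) =
      c R \<zeta> * Phi L p N R x * KK (F R) (u R) (\<zeta> j) (\<zeta> (Suc j))" if R: "R \<in> D" for R \<zeta>
  proof -
    have RC: "R \<in> configs L N k" using R by (simp add: D_def)
    have RF: "j \<notin> R n - {j}" "Suc j \<notin> R n - {j}" "finite (R n - {j})" "R n = insert j (R n - {j})" if "n \<in> F R" for n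
      using that configsD[OF RC, of n] by (auto simp: F_def)
    have RN: "j \<in> R n \<longleftrightarrow> Suc j \<in> R n" if "n \<in> {1..N}" "n \<notin> F R" for n
      using that R by (auto simp: F_def D_def)
    have xnz: "x n \<noteq> 0" if "n \<in> {1..N}" for n using np that by (auto simp: no_poles_def)
    have key: "(\<Prod>n\<in>{1..N}. \<Prod>s\<in>sw R A n. \<zeta> s) * Phi L p N (sw R A) x = c R \<zeta> * Phi L p N R x *
       (\<zeta> j ^ card A * \<zeta> (Suc j) ^ card (F R - A) * (\<Prod>m\<in>A. \<Prod>n\<in>F R - A. ff (u R m / u R n)))"
      if A: "A \<in> Pow (F R)" for A
    proof -
      have sub: "A \<subseteq> {1..N}" "F R - A \<subseteq> {1..N}" using A by (auto simp: F_def)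
      define b where "b n = (if n \<in> A then j else Suc j)" for n
      have b: "b n \<in> {j, Suc j}" for n by (simp add: b_def)
      have swF: "sw R A n = insert (b n) (R n - {j})" if "n \<in> F R" for n
        using that RF[OF that] A by (auto simp: sw_def b_def)
      have swN: "sw R A n = R n" if "n \<notin> F R" for n using that by (auto simp: sw_def)
      have "(\<Prod>n\<in>{1..N}. \<Prod>s\<in>sw R A n. \<zeta> s) = (\<Prod>n\<in>{1..N}.
         (if n \<in> F R then \<Prod>s\<in>R n - {j}. \<zeta> s else \<Prod>s\<in>R n. \<zeta> s) *
         ((if n \<in> A then \<zeta> j else 1) * (if n \<in> F R - A then \<zeta> (Suc j) else 1)))"
      proof (rule prod.cong[OF refl])
        fix n assume "n \<in> {1..N}"
        show "(\<Prod>s\<in>sw R A n. \<zeta> s) = (if n \<in> F R then \<Prod>s\<in>R n - {j}. \<zeta> s else \<Prod>s\<in>R n. \<zeta> s) *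
         ((if n \<in> A then \<zeta> j else 1) * (if n \<in> F R - A then \<zeta> (Suc j) else 1))"
        proof (cases "n \<in> F R")
          case True
          then show ?thesis
            unfolding swF[OF True] using RF(1-3)[OF True] by (simp add: b_def)
        next
          case False
          then show ?thesis unfolding swN[OF False] using A by auto
        qed
      qed
      also have "\<dots> = c R \<zeta> * (\<zeta> j ^ card A * \<zeta> (Suc j) ^ card (F R - A))"
        unfolding prod.distrib c_def using sub by (simp only: prod_if_const finite_atLeastAtMost)
      finally have 1: "(\<Prod>n\<in>{1..N}. \<Prod>s\<in>sw R A n. \<zeta> s) = c R \<zeta> * (\<zeta> j ^ card A * \<zeta> (Suc j) ^ card (F R - A))" .
      have pair: "Psi (sw R A m) (x m) (sw R A n) (x n) = Psi (R m) (x m) (R n) (x n) *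
          (if m \<in> A \<and> n \<in> F R - A then ff (u R m / u R n)
           else if n \<in> A \<and> m \<in> F R - A then ff (u R n / u R m) else 1)"
        if m: "m \<in> {1..N}" and n: "n \<in> {1..N}" for m n
      proof -
        consider "m \<in> F R" "n \<in> F R" | "m \<in> F R" "n \<notin> F R" | "m \<notin> F R" "n \<in> F R" | "m \<notin> F R" "n \<notin> F R"
          by auto
        then show ?thesis
        proof cases
          case 1
          have u: "u R m = y_at L (insert j (R m - {j})) (x m) j" "u R n = y_at L (insert j (R n - {j})) (x n) j"
            using RF(4)[OF 1(1)] RF(4)[OF 1(2)] by (simp_all add: u_def)
          have "Psi (sw R A m) (x m) (sw R A n) (x n) = Psi (R m) (x m) (R n) (x n) * pf (b m) (b n) (u R m) (u R n)"
            using Psi_swap_both[OF RF(1-3)[OF 1(1)] RF(1-3)[OF 1(2)] b b, where v = "x m" and v' = "x n"] RF(4)[OF 1(1)] RF(4)[OF 1(2)]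
            unfolding swF[OF 1(1)] swF[OF 1(2)] u by simp
          then show ?thesis using 1 by (auto simp: b_def pf_def)
        next
          case 2
          have "Psi (sw R A m) (x m) (sw R A n) (x n) = Psi (R m) (x m) (R n) (x n)"
            using Psi_swap_inert[OF RF(1-3)[OF 2(1)] xnz[OF m] xnz[OF n] _ RN[OF n 2(2)] b] configsD(3)[OF RC n] RF(4)[OF 2(1)]
            unfolding swF[OF 2(1)] swN[OF 2(2)] by simp
          then show ?thesis using 2 A by auto
        next
          case 3
          have "Psi (sw R A n) (x n) (sw R A m) (x m) = Psi (R n) (x n) (R m) (x m)"
            using Psi_swap_inert[OF RF(1-3)[OF 3(2)] xnz[OF n] xnz[OF m] _ RN[OF m 3(1)] b] configsD(3)[OF RC m] RF(4)[OF 3(2)]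
            unfolding swF[OF 3(2)] swN[OF 3(1)] by simp
          then show ?thesis using 3 A by (auto simp: Psi_commute)
        next
          case 4
          then show ?thesis using A by (auto simp: swN)
        qed
      qed
      have "Phi L p N (sw R A) x = (\<Prod>n\<in>{1..N}. \<Prod>m\<in>{1..<n}. Psi (R m) (x m) (R n) (x n) *
          (if m \<in> A \<and> n \<in> F R - A then ff (u R m / u R n)
           else if n \<in> A \<and> m \<in> F R - A then ff (u R n / u R m) else 1))"
        unfolding Phi_eq by (intro prod.cong refl pair) auto
      also have "\<dots> = Phi L p N R x * (\<Prod>m\<in>A. \<Prod>n\<in>F R - A. ff (u R m / u R n))"
        unfolding prod.distrib Phi_eq[symmetric] using sub by (subst prod_unordered_pairs) auto
      finally show ?thesis unfolding 1 by (simp add: mult_ac)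
    qed
    show ?thesis unfolding KK_def sum_distrib_left by (rule sum.cong[OF refl key])
  qed
  have csym: "c R (\<zeta> \<circ> Transposition.transpose j (Suc j)) = c R \<zeta>" if R: "R \<in> D" for R
    unfolding c_def
  proof (rule prod.cong[OF refl])
    fix n assume n: "n \<in> {1..N}"
    show "(if n \<in> F R then \<Prod>s\<in>R n - {j}. (\<zeta> \<circ> Transposition.transpose j (Suc j)) s
        else \<Prod>s\<in>R n. (\<zeta> \<circ> Transposition.transpose j (Suc j)) s) =
      (if n \<in> F R then \<Prod>s\<in>R n - {j}. \<zeta> s else \<Prod>s\<in>R n. \<zeta> s)"
    proof (cases "n \<in> F R")
      case True
      then have "Suc j \<notin> R n" by (auto simp: F_def)
      then have "(\<Prod>s\<in>R n - {j}. (\<zeta> \<circ> Transposition.transpose j (Suc j)) s) = (\<Prod>s\<in>R n - {j}. \<zeta> s)"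
        by (intro prod.cong) (auto simp: Transposition.transpose_def)
      then show ?thesis using True by simp
    next
      case False
      then have RN: "j \<in> R n \<longleftrightarrow> Suc j \<in> R n"
        using n R by (auto simp: F_def D_def)
      have "(\<Prod>s\<in>R n. (\<zeta> \<circ> Transposition.transpose j (Suc j)) s) = (\<Prod>s\<in>R n. \<zeta> s)"
        by (rule prod.reindex_bij_witness[of _ "Transposition.transpose j (Suc j)" "Transposition.transpose j (Suc j)"])
          (use RN in \<open>auto simp: Transposition.transpose_def\<close>)
      then show ?thesis using False by simp
    qed
  qed
  have KKs: "KK (F R) (u R) q r = KK (F R) (u R) r q" if R: "R \<in> D" for R q r
  proof (rule KK_sym)
    have RC: "R \<in> configs L N k" using R by (simp add: D_def)
    show "finite (F R)" by (simp add: F_def)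
    show "u R n \<noteq> 0" if "n \<in> F R" for n
      using np that by (auto simp: no_poles_def F_def u_def intro!: y_at_nonzero)
    fix m n assume mn: "m \<in> F R" "n \<in> F R" "m \<noteq> n"
    then have mn': "m \<in> {1..N}" "n \<in> {1..N}" "j \<in> R m" "j \<in> R n" by (auto simp: F_def)
    note Rm = configsD[OF RC mn'(1)] and Rn = configsD[OF RC mn'(2)]
    have pos: "position (R m) j \<in> {1..k m}" "position (R n) j \<in> {1..k n}"
      using position_in[OF Rm(3) mn'(3)] position_in[OF Rn(3) mn'(4)] Rm(2) Rn(2) by auto
    then show "u R m / u R n \<notin> {1, om 1}"
    proof -
      have "\<forall>i\<in>{1..k m}. \<forall>i'\<in>{1..k n}. y_var L (k m) (x m) i / y_var L (k n) (x n) i' \<notin> {1, om 1}"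
        using np mn(3) mn'(1,2) unfolding no_poles_def by blast
      from bspec[OF bspec[OF this pos(1)] pos(2)] show ?thesis
        unfolding u_def y_at_def Rm(2) Rn(2) .
    qed
  qed
  show ?thesis
    unfolding JZ_def reidx
  proof (rule sum.cong[OF refl])
    fix R assume R: "R \<in> D"
    show "(\<Sum>A\<in>Pow (F R). (\<Prod>n\<in>{1..N}. \<Prod>s\<in>sw R A n. (\<zeta> \<circ> Transposition.transpose j (Suc j)) s) * Phi L p N (sw R A) x) =
      (\<Sum>A\<in>Pow (F R). (\<Prod>n\<in>{1..N}. \<Prod>s\<in>sw R A n. \<zeta> s) * Phi L p N (sw R A) x)"
      unfolding inner[OF R] csym[OF R] using KKs[OF R, of "\<zeta> j" "\<zeta> (Suc j)"] by simp
  qed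
qed

end

section \<open>The polynomial algebra\<close>

abbreviation "keys \<equiv> Poly_Mapping.keys"
abbreviation "lookup \<equiv> Poly_Mapping.lookup"
abbreviation "single \<equiv> Poly_Mapping.single"

definition mono_eval :: "('g \<Rightarrow> complex) \<Rightarrow> ('g \<Rightarrow>\<^sub>0 nat) \<Rightarrow> complex" where
  "mono_eval v m = (\<Prod>g\<in>keys m. v g ^ lookup m g)"

lemma mono_eval_superset:
  assumes "finite K" "keys m \<subseteq> K"
  shows "mono_eval v m = (\<Prod>g\<in>K. v g ^ lookup m g)"
  unfolding mono_eval_def using assms by (intro prod.mono_neutral_left) (auto simp: in_keys_iff)

lemma mono_eval_0 [simp]: "mono_eval v 0 = 1"
  by (simp add: mono_eval_def)

lemma mono_eval_single: "mono_eval v (single g n) = v g ^ n"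
  by (simp add: mono_eval_superset[of "{g}"])

lemma mono_eval_add: "mono_eval v (m + m') = mono_eval v m * mono_eval v m'"
proof -
  let ?K = "keys m \<union> keys m'"
  have "keys (m + m') \<subseteq> ?K" by (rule keys_add)
  then show ?thesis
    by (simp add: mono_eval_superset[of ?K] lookup_add power_add prod.distrib)
qed

lemma alg_eval_superset:
  assumes "finite M" "keys h \<subseteq> M"
  shows "alg_eval v h = (\<Sum>m\<in>M. lookup h m * mono_eval v m)"
  unfolding alg_eval_def mono_eval_def[symmetric] using assms
  by (intro sum.mono_neutral_left) (auto simp: in_keys_iff)

lemma alg_eval_0 [simp]: "alg_eval v 0 = 0"
  by (simp add: alg_eval_def)

lemma alg_eval_single: "alg_eval v (single m c) = c * mono_eval v m"
  by (simp add: alg_eval_superset[of "{m}"])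

lemma alg_eval_1 [simp]: "alg_eval v 1 = 1"
  using alg_eval_single[of v 0 1] by simp

lemma alg_eval_add: "alg_eval v (h + h') = alg_eval v h + alg_eval v h'"
proof -
  let ?M = "keys h \<union> keys h'"
  have "keys (h + h') \<subseteq> ?M" by (rule keys_add)
  then show ?thesis
    by (simp add: alg_eval_superset[of ?M] lookup_add algebra_simps sum.distrib)
qed

lemma alg_eval_sum: "alg_eval v (sum h A) = (\<Sum>x\<in>A. alg_eval v (h x))"
  by (induction A rule: infinite_finite_induct) (simp_all add: alg_eval_add)

lemma alg_expand:
  assumes "finite M" "keys h \<subseteq> M"
  shows "h = (\<Sum>m\<in>M. single m (lookup h m))"
proof (rule poly_mapping_eqI)
  fix k
  have "lookup (\<Sum>m\<in>M. single m (lookup h m)) k = (\<Sum>m\<in>M. if m = k then lookup h k else 0)"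
    by (simp add: lookup_sum lookup_single when_def cong: if_cong)
  also have "\<dots> = lookup h k"
    using assms by (auto simp: in_keys_iff)
  finally show "lookup h k = lookup (\<Sum>m\<in>M. single m (lookup h m)) k" by simp
qed

lemma alg_eval_mult: "alg_eval v (h * h') = alg_eval v h * alg_eval v h'"
proof -
  have "h * h' = (\<Sum>m\<in>keys h. \<Sum>m'\<in>keys h'. single (m + m') (lookup h m * lookup h' m'))"
    by (subst (1) alg_expand[of "keys h" h], simp, simp, subst (1) alg_expand[of "keys h'" h'], simp, simp)
      (simp add: sum_product mult_single)
  then have "alg_eval v (h * h') = (\<Sum>m\<in>keys h. \<Sum>m'\<in>keys h'. (lookup h m * mono_eval v m) * (lookup h' m' * mono_eval v m'))"
    by (simp add: alg_eval_sum alg_eval_single mono_eval_add mult_ac)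
  also have "\<dots> = alg_eval v h * alg_eval v h'"
    by (simp add: alg_eval_superset[of "keys h"] alg_eval_superset[of "keys h'"] sum_product)
  finally show ?thesis .
qed

lemma lookup_alg_scale [simp]: "lookup (alg_scale c h) m = c * lookup h m"
proof -
  have "alg_scale c h = (\<Sum>k\<in>keys h. single k (c * lookup h k))"
    unfolding alg_scale_def
    by (subst (1) alg_expand[of "keys h" h], simp, simp) (simp add: sum_distrib_left mult_single)
  also have "lookup \<dots> m = (\<Sum>k\<in>keys h. if k = m then c * lookup h m else 0)"
    by (simp add: lookup_sum lookup_single when_def cong: if_cong)
  also have "\<dots> = c * lookup h m" by (auto simp: in_keys_iff)
  finally show ?thesis .
qed

lemma alg_eval_scale: "alg_eval v (alg_scale c h) = c * alg_eval v h"
  by (simp add: alg_scale_def alg_eval_mult alg_eval_single)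

lemma alg_scale_single: "alg_scale c (single m b) = single m (c * b)"
  by (simp add: alg_scale_def mult_single)

lemma alg_scale_mult: "alg_scale c (h * h') = alg_scale c h * h'" "alg_scale c (h * h') = h * alg_scale c h'"
  by (simp_all add: alg_scale_def mult_ac)

lemma mdegree_superset:
  assumes "finite K" "keys m \<subseteq> K"
  shows "mdegree m = (\<Sum>g\<in>K. lookup m g * (snd g + 1))"
  unfolding mdegree_def using assms by (intro sum.mono_neutral_left) (auto simp: in_keys_iff)

lemma mdegree_add: "mdegree (m + m') = mdegree m + mdegree m'"
proof -
  let ?K = "keys m \<union> keys m'"
  have "keys (m + m') \<subseteq> ?K" by (rule keys_add)
  then show ?thesis
    by (simp add: mdegree_superset[of ?K] lookup_add algebra_simps sum.distrib)
qed

lemma mdegree_0 [simp]: "mdegree 0 = 0"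
  by (simp add: mdegree_def)

lemma mdegree_single: "mdegree (single g n) = n * (snd g + 1)"
  by (simp add: mdegree_superset[of "{g}"])

lemma mdegree_bound:
  assumes "g \<in> keys m"
  shows "lookup m g * (snd g + 1) \<le> mdegree m"
  unfolding mdegree_def using assms by (intro member_le_sum) auto

lemma keys_mdegree: "g \<in> keys m \<Longrightarrow> snd g < mdegree m"
  using mdegree_bound[of g m] by (cases "lookup m g") (auto simp: in_keys_iff)

definition monoms :: "nat \<Rightarrow> 'i monomial set" where
  "monoms l = {m. mdegree m = l}"

lemma finite_monoms: "finite (monoms l :: 'i::finite monomial set)"
proof -
  let ?A = "(UNIV :: 'i set) \<times> {..<l}"
  let ?S = "{f :: 'i \<times> nat \<Rightarrow> nat. \<forall>g. (g \<in> ?A \<longrightarrow> f g \<in> {..l}) \<and> (g \<notin> ?A \<longrightarrow> f g = 0)}"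
  have fin: "finite ?S" by (intro finite_set_of_finite_funs) auto
  have "lookup ` (monoms l :: 'i monomial set) \<subseteq> ?S"
  proof (intro image_subsetI CollectI allI conjI impI)
    fix m :: "'i monomial" and g assume "m \<in> monoms l"
    then have m: "mdegree m = l" by (simp add: monoms_def)
    show "lookup m g \<in> {..l}"
    proof (cases "g \<in> keys m")
      case True
      have "lookup m g * 1 \<le> lookup m g * (snd g + 1)" by (intro mult_left_mono) auto
      then show ?thesis using mdegree_bound[OF True] m by simp
    qed (simp add: in_keys_iff)
    assume "g \<notin> ?A"
    then show "lookup m g = 0"
      using keys_mdegree[of g m] m by (cases g) (auto simp: in_keys_iff)
  qed
  then have "finite (lookup ` (monoms l :: 'i monomial set))"
    using fin finite_subset by blast
  then show ?thesis by (rule finite_imageD) (simp add: inj_on_def)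
qed

lemma alg_grade_eq: "alg_grade l = {h. keys h \<subseteq> monoms l}"
  by (auto simp: alg_grade_def monoms_def)

lemma alg_grade_mult:
  assumes "h \<in> alg_grade k" "h' \<in> alg_grade l"
  shows "h * h' \<in> alg_grade (k + l)"
proof -
  have "keys (h * h') \<subseteq> {a + b |a b. a \<in> keys h \<and> b \<in> keys h'}" by (rule keys_mult)
  then show ?thesis using assms by (force simp: alg_grade_def mdegree_add)
qed

lemma alg_grade_sum: "(\<And>x. x \<in> A \<Longrightarrow> h x \<in> alg_grade l) \<Longrightarrow> sum h A \<in> alg_grade l"
proof (induction A rule: infinite_finite_induct)
  case (insert x F)
  then show ?case using keys_add[of "h x" "sum h F"] by (auto simp: alg_grade_eq)
qed (auto simp: alg_grade_eq)

lemma keys_alg_scale: "keys (alg_scale c h) \<subseteq> keys h"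
  by (auto simp: in_keys_iff)

lemma alg_grade_scale: "h \<in> alg_grade l \<Longrightarrow> alg_scale c h \<in> alg_grade l"
  using keys_alg_scale[of c h] by (auto simp: alg_grade_eq)

lemma single_in_alg_grade: "mdegree m = l \<Longrightarrow> single m c \<in> alg_grade l"
  by (auto simp: alg_grade_def)

lemma alg_support_span:
  assumes "finite M"
  shows "alg.span ((\<lambda>m. single m 1) ` M) = {h. keys h \<subseteq> M}"
proof (rule alg.span_unique)
  show "alg.subspace {h. keys h \<subseteq> M}"
  proof (rule alg.subspaceI)
    fix x y :: "'a alg" assume "x \<in> {h. keys h \<subseteq> M}" "y \<in> {h. keys h \<subseteq> M}"
    then show "x + y \<in> {h. keys h \<subseteq> M}" using keys_add[of x y] by auto
  next
    fix c and x :: "'a alg" assume "x \<in> {h. keys h \<subseteq> M}"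
    then show "alg_scale c x \<in> {h. keys h \<subseteq> M}" using keys_alg_scale[of c x] by auto
  qed auto
  fix S' assume S': "(\<lambda>m. single m 1) ` M \<subseteq> S'" "alg.subspace S'"
  show "{h. keys h \<subseteq> M} \<subseteq> S'"
  proof safe
    fix h :: "'a alg" assume "keys h \<subseteq> M"
    then have "h = (\<Sum>m\<in>M. alg_scale (lookup h m) (single m 1))"
      using alg_expand[OF assms, of h] by (simp add: alg_scale_single)
    also have "\<dots> \<in> S'"
      using S' by (intro alg.subspace_sum alg.subspace_scale) auto
    finally show "h \<in> S'" .
  qed
qed auto

lemma inj_single_1: "inj_on (\<lambda>m. single m (1::complex)) M"
proof
  fix x y :: 'a assume "single x (1::complex) = single y 1"
  then have "keys (single x (1::complex)) = keys (single y (1::complex))" by simp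
  then show "x = y" by simp
qed

lemma alg_support_independent:
  assumes "finite M"
  shows "alg.independent ((\<lambda>m. single m 1) ` M)"
proof (rule alg.independent_if_scalars_zero)
  fix f and x :: "'a alg"
  assume *: "(\<Sum>x\<in>(\<lambda>m. single m 1) ` M. alg_scale (f x) x) = 0" and x: "x \<in> (\<lambda>m. single m 1) ` M"
  obtain m where m: "m \<in> M" "x = single m 1" using x by auto
  have "(\<Sum>x\<in>(\<lambda>m. single m 1) ` M. alg_scale (f x) x) = (\<Sum>m\<in>M. single m (f (single m 1)))"
    by (subst sum.reindex[OF inj_single_1]) (simp add: alg_scale_single)
  then have "0 = lookup (\<Sum>m\<in>M. single m (f (single m 1))) m"
    using * by simp
  also have "\<dots> = (\<Sum>k\<in>M. if k = m then f (single m 1) else 0)"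
    by (simp add: lookup_sum lookup_single when_def cong: if_cong)
  also have "\<dots> = f x" using m assms by simp
  finally show "f x = 0" by simp
qed (use assms in auto)

lemma alg_support_dim:
  assumes "finite M"
  shows "alg.dim {h. keys h \<subseteq> M} = card M"
  using alg.dim_span_eq_card_independent[OF alg_support_independent[OF assms]]
  by (simp add: alg_support_span[OF assms] card_image[OF inj_single_1])

section \<open>Linear independence of monomials as functions\<close>

lemma polyfun_coeff_0:
  fixes c :: "nat \<Rightarrow> complex"
  assumes "\<And>x. (\<Sum>k\<le>n. c k * x ^ k) = 0" "k \<le> n"
  shows "c k = 0"
  using assms polyfun_eq_0[of c n] by auto

text \<open>With all variables but one frozen, the sum is a polynomial in the remaining one. Each of
  its coefficients vanishes and collects the monomials with a fixed exponent there, which are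
  distinguished by the other variables.\<close>

lemma monomials_independent_on:
  fixes c :: "'m \<Rightarrow> complex" and e :: "'m \<Rightarrow> 'g \<Rightarrow> nat"
  assumes "finite G" "finite M"
    and "\<And>m m'. m \<in> M \<Longrightarrow> m' \<in> M \<Longrightarrow> (\<And>g. g \<in> G \<Longrightarrow> e m g = e m' g) \<Longrightarrow> m = m'"
    and "\<And>v. (\<Sum>m\<in>M. c m * (\<Prod>g\<in>G. v g ^ e m g)) = 0"
  shows "\<forall>m\<in>M. c m = 0"
  using assms
proof (induction G arbitrary: M rule: finite_induct)
  case empty
  show ?case
  proof
    fix m assume "m \<in> M"
    then have "M = {m}" using empty.prems(2) by blast
    then show "c m = 0" using empty.prems(3) by simp
  qed
next
  case (insert g G)
  show ?case
  proof
    fix m assume m: "m \<in> M"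
    obtain n where n: "\<And>m. m \<in> M \<Longrightarrow> e m g \<le> n"
    proof -
      have "finite ((\<lambda>m. e m g) ` M)" using insert.prems(1) by simp
      then show ?thesis using that[of "Max ((\<lambda>m. e m g) ` M)"] by simp
    qed
    define Mk where "Mk k = {m \<in> M. e m g = k}" for k
    have "\<forall>m\<in>Mk (e m g). c m = 0"
    proof (rule insert.IH)
      show "finite (Mk (e m g))" using insert.prems(1) by (simp add: Mk_def)
      show "m1 = m2" if "m1 \<in> Mk (e m g)" "m2 \<in> Mk (e m g)" "\<And>h. h \<in> G \<Longrightarrow> e m1 h = e m2 h" for m1 m2
        using that by (intro insert.prems(2)) (auto simp: Mk_def)
      fix v
      define d where "d k = (\<Sum>m\<in>Mk k. c m * (\<Prod>h\<in>G. v h ^ e m h))" for k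
      have "(\<Sum>k\<le>n. d k * x ^ k) = 0" for x
      proof -
        have "(\<Sum>k\<le>n. d k * x ^ k) = (\<Sum>k\<le>n. \<Sum>m\<in>Mk k. c m * (\<Prod>h\<in>insert g G. (v(g := x)) h ^ e m h))"
        proof (rule sum.cong[OF refl])
          fix k
          have "(\<Prod>h\<in>insert g G. (v(g := x)) h ^ e m h) = x ^ k * (\<Prod>h\<in>G. v h ^ e m h)" if "m \<in> Mk k" for m
          proof -
            have "(\<Prod>h\<in>G. (v(g := x)) h ^ e m h) = (\<Prod>h\<in>G. v h ^ e m h)"
              using insert.hyps by (intro prod.cong) auto
            then show ?thesis using insert.hyps that by (simp add: Mk_def)
          qed
          then show "d k * x ^ k = (\<Sum>m\<in>Mk k. c m * (\<Prod>h\<in>insert g G. (v(g := x)) h ^ e m h))"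
            by (simp add: d_def sum_distrib_left sum_distrib_right mult_ac cong: sum.cong)
        qed
        also have "\<dots> = (\<Sum>m\<in>M. c m * (\<Prod>h\<in>insert g G. (v(g := x)) h ^ e m h))"
          unfolding Mk_def using insert.prems(1) n by (intro sum.group) auto
        also have "\<dots> = 0" by (rule insert.prems(3))
        finally show ?thesis .
      qed
      then show "(\<Sum>m\<in>Mk (e m g). c m * (\<Prod>h\<in>G. v h ^ e m h)) = 0"
        using polyfun_coeff_0[of d n "e m g"] n[OF m] by (simp add: d_def)
    qed
    then show "c m = 0" using m by (simp add: Mk_def)
  qed
qed

lemma monomials_independent:
  fixes b :: "('g \<Rightarrow>\<^sub>0 nat) \<Rightarrow> complex"
  assumes "finite M" "\<And>v. (\<Sum>m\<in>M. b m * mono_eval v m) = 0" "m \<in> M"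
  shows "b m = 0"
proof -
  define G where "G = (\<Union>m\<in>M. keys m)"
  have G: "finite G" using assms by (simp add: G_def)
  have me: "mono_eval v m = (\<Prod>g\<in>G. v g ^ lookup m g)" if "m \<in> M" for v m
    using that G by (intro mono_eval_superset) (auto simp: G_def)
  have "\<forall>m\<in>M. b m = 0"
  proof (rule monomials_independent_on[OF G assms(1), of lookup])
    fix m m' assume mm: "m \<in> M" "m' \<in> M" "\<And>g. g \<in> G \<Longrightarrow> lookup m g = lookup m' g"
    show "m = m'"
    proof (rule poly_mapping_eqI)
      fix g
      show "lookup m g = lookup m' g"
      proof (cases "g \<in> G")
        case False
        then have "g \<notin> keys m" "g \<notin> keys m'" using mm by (auto simp: G_def)
        then show ?thesis by (simp add: in_keys_iff)
      qed (use mm in auto)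
    qed
  next
    show "(\<Sum>m\<in>M. b m * (\<Prod>g\<in>G. v g ^ lookup m g)) = 0" for v
      using assms(2)[of v] me by simp
  qed
  then show ?thesis using assms(3) by blast
qed

section \<open>Analytic families and generic points\<close>

lemma entireI:
  assumes "\<And>a. (F has_derivative D a) (at a)" "\<And>a c v. D a (c *s v) = c * D a v"
  shows "entire F"
  using assms unfolding entire_def by blast

lemma entire_const: "entire (\<lambda>a. c)"
  by (rule entireI[of _ "\<lambda>a v. 0"]) auto

lemma entire_add:
  assumes "entire F" "entire G"
  shows "entire (\<lambda>a. F a + G a)"
proof -
  obtain D where D: "\<And>a. (F has_derivative D a) (at a)" "\<And>a c v. D a (c *s v) = c * D a v"
    using assms(1) unfolding entire_def by metis
  obtain D' where D': "\<And>a. (G has_derivative D' a) (at a)" "\<And>a c v. D' a (c *s v) = c * D' a v"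
    using assms(2) unfolding entire_def by metis
  show ?thesis
    by (rule entireI[of _ "\<lambda>a v. D a v + D' a v"], rule has_derivative_add[OF D(1) D'(1)])
      (simp add: D(2) D'(2) algebra_simps)
qed

lemma entire_mult:
  assumes "entire F" "entire G"
  shows "entire (\<lambda>a. F a * G a)"
proof -
  obtain D where D: "\<And>a. (F has_derivative D a) (at a)" "\<And>a c v. D a (c *s v) = c * D a v"
    using assms(1) unfolding entire_def by metis
  obtain D' where D': "\<And>a. (G has_derivative D' a) (at a)" "\<And>a c v. D' a (c *s v) = c * D' a v"
    using assms(2) unfolding entire_def by metis
  show ?thesis
    by (rule entireI[of _ "\<lambda>a v. F a * D' a v + D a v * G a"], rule has_derivative_mult[OF D(1) D'(1)])
      (simp add: D(2) D'(2) algebra_simps)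
qed

lemma entire_sum: "(\<And>x. x \<in> A \<Longrightarrow> entire (F x)) \<Longrightarrow> entire (\<lambda>a. \<Sum>x\<in>A. F x a)"
  by (induction A rule: infinite_finite_induct) (auto intro: entire_add entire_const)

lemma entire_diff: "entire F \<Longrightarrow> entire G \<Longrightarrow> entire (\<lambda>a. F a - G a)"
  using entire_add[of F "\<lambda>a. (-1) * G a"] entire_mult[OF entire_const[of "-1"], of G] by simp

lemma bounded_linear_form: "bounded_linear (\<lambda>a. form a b)"
  unfolding form_def
  by (intro bounded_linear_sum bounded_linear_mult_const bounded_linear_compose[OF _ bounded_linear_vec_nth]
      bounded_linear_vec_nth)

lemma entire_omega_pow: "entire (\<lambda>a. omega_pow L (form a b))"
proof -
  define c where "c = 2 * of_real pi * \<i> / of_nat L"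
  have om: "omega_pow L z = exp (c * z)" for z
    by (simp add: omega_pow_def c_def)
  have lin: "((\<lambda>a. c * form a b) has_derivative (\<lambda>v. c * form v b)) (at a)" for a
    by (rule bounded_linear_imp_has_derivative[OF bounded_linear_const_mult[OF bounded_linear_form]])
  show ?thesis
  proof (rule entireI)
    show "((\<lambda>a. omega_pow L (form a b)) has_derivative (\<lambda>v. exp (c * form a b) * (c * form v b))) (at a)" for a
      unfolding om by (rule has_derivative_compose[OF lin DERIV_exp[unfolded has_field_derivative_def]])
    show "exp (c * form a b) * (c * form (x *s v) b) = x * (exp (c * form a b) * (c * form v b))" for a x v
      by (simp add: form_linear)
  qed
qed

lemma generic_mono:
  assumes "generic P" "\<And>a. P a \<Longrightarrow> Q a"
  shows "generic Q"
proof -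
  define Q where "Q F \<longleftrightarrow> (\<forall>n. entire (F n) \<and> (\<exists>a. F n a \<noteq> 0)) \<and> (\<forall>a. (\<forall>n. F n a \<noteq> 0) \<longrightarrow> P a)"
    for F :: "nat \<Rightarrow> complex ^ 'a \<Rightarrow> complex"
  have "\<exists>F. Q F" using assms(1) unfolding generic_def Q_def .
  then obtain F where "Q F" by blast
  then show ?thesis
    unfolding generic_def Q_def using assms(2) by (intro exI[of _ F]) simp
qed

lemma generic_countable:
  fixes P :: "'n \<Rightarrow> complex ^ 'i::finite \<Rightarrow> bool"
  assumes I: "countable I" and P: "\<And>i. i \<in> I \<Longrightarrow> generic (P i)"
  shows "generic (\<lambda>a. \<forall>i\<in>I. P i a)"
proof (cases "I = {}")
  case True
  then show ?thesis
    unfolding generic_def using entire_const[of 1] by (intro exI[of _ "\<lambda>n a. 1"]) auto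
next
  case False
  define Q where "Q i F \<longleftrightarrow> (\<forall>n. entire (F n) \<and> (\<exists>a. F n a \<noteq> 0)) \<and> (\<forall>a. (\<forall>n. F n a \<noteq> 0) \<longrightarrow> P i a)"
    for i and F :: "nat \<Rightarrow> complex ^ 'i \<Rightarrow> complex"
  have "\<forall>i\<in>I. \<exists>F. Q i F" using P unfolding generic_def Q_def by (intro ballI)
  then obtain F where F0: "\<And>i. i \<in> I \<Longrightarrow> Q i (F i)" by metis
  have F: "entire (F i n) \<and> (\<exists>a. F i n a \<noteq> 0)" "(\<forall>n. F i n a \<noteq> 0) \<Longrightarrow> P i a" if "i \<in> I" for i n a
    using F0[OF that] unfolding Q_def by simp_all
  define e where "e = from_nat_into I"
  have e: "range e = I" unfolding e_def using range_from_nat_into[OF False I] .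
  show ?thesis
    unfolding generic_def
  proof (intro exI[of _ "\<lambda>n. F (e (fst (prod_decode n))) (snd (prod_decode n))"] conjI allI impI)
    fix n
    have "e (fst (prod_decode n)) \<in> I" using e by auto
    then show "entire (F (e (fst (prod_decode n))) (snd (prod_decode n)))"
      "\<exists>a. F (e (fst (prod_decode n))) (snd (prod_decode n)) a \<noteq> 0" using F(1) by auto
  next
    fix a assume *: "\<forall>n. F (e (fst (prod_decode n))) (snd (prod_decode n)) a \<noteq> 0"
    show "\<forall>i\<in>I. P i a"
    proof
      fix i assume i: "i \<in> I"
      then obtain k where k: "e k = i" using e by blast
      have "F i n a \<noteq> 0" for n
        using *[rule_format, of "prod_encode (k, n)"] k by simp
      then show "P i a" using F(2)[OF i] by blast
    qed
  qed
qed

text \<open>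
  Gaussian elimination on the coordinates in \<open>M\<close>; the pivots stay nonzero near the end of the path
  \<open>q\<close> because they have nonzero rescaled limits.
\<close>

lemma analytic_families_nondegenerate:
  fixes C :: "'f \<Rightarrow> complex ^ 'i::finite \<Rightarrow> 'm \<Rightarrow> complex" and q :: "real \<Rightarrow> complex ^ 'i"
  assumes "finite M"
    and "\<And>i m. i \<in> I \<Longrightarrow> m \<in> M \<Longrightarrow> entire (\<lambda>a. C i a m)"
    and "\<And>b. (\<And>i s v. i \<in> I \<Longrightarrow> (\<forall>m\<in>M. ((\<lambda>\<tau>. s \<tau> * C i (q \<tau>) m) \<longlongrightarrow> v m) at_top) \<Longrightarrow>
         (\<Sum>m\<in>M. b m * v m) = 0) \<Longrightarrow> \<forall>m\<in>M. b m = 0"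
  shows "\<exists>is D. set is \<subseteq> I \<and> length is = card M \<and> entire D \<and> (\<exists>a. D a \<noteq> 0) \<and>
     (\<forall>a. D a \<noteq> 0 \<longrightarrow> (\<forall>b. (\<forall>i\<in>set is. (\<Sum>m\<in>M. b m * C i a m) = 0) \<longrightarrow> (\<forall>m\<in>M. b m = 0)))"
proof -
  \<comment> \<open>The induction carries a nonzero rescaled limit of D along q. That D is not
    identically zero is read off from it only at the end.\<close>
  have "\<exists>is D s z. set is \<subseteq> I \<and> length is = card M \<and> entire D \<and> z \<noteq> 0 \<and>
     ((\<lambda>\<tau>. s \<tau> * D (q \<tau>)) \<longlongrightarrow> z) at_top \<and>
     (\<forall>a. D a \<noteq> 0 \<longrightarrow> (\<forall>b. (\<forall>i\<in>set is. (\<Sum>m\<in>M. b m * C i a m) = 0) \<longrightarrow> (\<forall>m\<in>M. b m = 0)))"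
    using assms
  proof (induction M arbitrary: C rule: finite_induct)
    case empty
    show ?case
      by (rule exI[of _ "[]"], rule exI[of _ "\<lambda>a. 1"], rule exI[of _ "\<lambda>\<tau>. 1"], rule exI[of _ 1])
        (auto intro: entire_const)
  next
    case (insert \<mu> M)
    have "\<exists>i1\<in>I. \<exists>s v. (\<forall>m\<in>insert \<mu> M. ((\<lambda>\<tau>. s \<tau> * C i1 (q \<tau>) m) \<longlongrightarrow> v m) at_top) \<and> v \<mu> \<noteq> 0"
    proof (rule ccontr)
      assume "\<not> ?thesis"
      then have *: "v \<mu> = 0" if "i \<in> I" "\<forall>m\<in>insert \<mu> M. ((\<lambda>\<tau>. s \<tau> * C i (q \<tau>) m) \<longlongrightarrow> v m) at_top" for i s v
        using that by blast
      have "\<forall>m\<in>insert \<mu> M. (if m = \<mu> then 1 else 0 :: complex) = 0"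
      proof (rule insert.prems(2))
        fix i s v assume "i \<in> I" "\<forall>m\<in>insert \<mu> M. ((\<lambda>\<tau>. s \<tau> * C i (q \<tau>) m) \<longlongrightarrow> v m) at_top"
        then have "v \<mu> = 0" by (rule *)
        then show "(\<Sum>m\<in>insert \<mu> M. (if m = \<mu> then 1 else 0) * v m) = 0"
          by (intro sum.neutral) auto
      qed
      then show False by simp
    qed
    then obtain i1 s1 v1 where i1: "i1 \<in> I" and v1: "v1 \<mu> \<noteq> 0"
      and l1: "\<And>m. m \<in> insert \<mu> M \<Longrightarrow> ((\<lambda>\<tau>. s1 \<tau> * C i1 (q \<tau>) m) \<longlongrightarrow> v1 m) at_top" by blast
    \<comment> \<open>Elimination by 2 by 2 minors instead of quotients, so that all entries stay
      entire.\<close>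
    define C' where "C' i a m = C i a m * C i1 a \<mu> - C i a \<mu> * C i1 a m" for i a m
    have "\<exists>is D s z. set is \<subseteq> I \<and> length is = card M \<and> entire D \<and> z \<noteq> 0 \<and>
       ((\<lambda>\<tau>. s \<tau> * D (q \<tau>)) \<longlongrightarrow> z) at_top \<and>
       (\<forall>a. D a \<noteq> 0 \<longrightarrow> (\<forall>b. (\<forall>i\<in>set is. (\<Sum>m\<in>M. b m * C' i a m) = 0) \<longrightarrow> (\<forall>m\<in>M. b m = 0)))"
    proof (rule insert.IH)
      show "entire (\<lambda>a. C' i a m)" if "i \<in> I" "m \<in> M" for i m
        unfolding C'_def using that i1 by (intro entire_diff entire_mult insert.prems(1)) auto
    next
      fix b' assume b': "\<And>i s v. i \<in> I \<Longrightarrow> (\<forall>m\<in>M. ((\<lambda>\<tau>. s \<tau> * C' i (q \<tau>) m) \<longlongrightarrow> v m) at_top) \<Longrightarrow>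
         (\<Sum>m\<in>M. b' m * v m) = 0"
      \<comment> \<open>The functional b' on the minors is lifted to all coordinates so that it
        annihilates the limit \<open>v1\<close> of the pivot row and, on any other limit row, agrees
        with b' on the minors.\<close>
      define b where "b m = (if m = \<mu> then - (\<Sum>m\<in>M. b' m * v1 m) else b' m * v1 \<mu>)" for m
      have "\<forall>m\<in>insert \<mu> M. b m = 0"
      proof (rule insert.prems(2))
        fix i s v assume i: "i \<in> I" and l: "\<forall>m\<in>insert \<mu> M. ((\<lambda>\<tau>. s \<tau> * C i (q \<tau>) m) \<longlongrightarrow> v m) at_top"
        have "(\<Sum>m\<in>M. b' m * (v m * v1 \<mu> - v \<mu> * v1 m)) = 0"
        proof (rule b'[OF i], intro ballI)
          fix m assume m: "m \<in> M"
          have "((\<lambda>\<tau>. (s \<tau> * C i (q \<tau>) m) * (s1 \<tau> * C i1 (q \<tau>) \<mu>) -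
              (s \<tau> * C i (q \<tau>) \<mu>) * (s1 \<tau> * C i1 (q \<tau>) m)) \<longlongrightarrow> v m * v1 \<mu> - v \<mu> * v1 m) at_top"
            using l l1 m by (intro tendsto_intros) auto
          then show "((\<lambda>\<tau>. (s \<tau> * s1 \<tau>) * C' i (q \<tau>) m) \<longlongrightarrow> v m * v1 \<mu> - v \<mu> * v1 m) at_top"
            by (simp add: C'_def algebra_simps)
        qed
        moreover have "(\<Sum>m\<in>M. b m * v m) = (\<Sum>m\<in>M. b' m * v1 \<mu> * v m)"
          using insert.hyps by (intro sum.cong) (auto simp: b_def)
        ultimately show "(\<Sum>m\<in>insert \<mu> M. b m * v m) = 0"
          using insert.hyps
          by (simp add: b_def sum_subtractf sum_distrib_left sum_distrib_right algebra_simps)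
      qed
      then show "\<forall>m\<in>M. b' m = 0"
        using v1 insert.hyps by (auto simp: b_def split: if_splits)
    qed
    then obtain "is" D s z where IH: "set is \<subseteq> I" "length is = card M" "entire D" "z \<noteq> 0"
      "((\<lambda>\<tau>. s \<tau> * D (q \<tau>)) \<longlongrightarrow> z) at_top"
      "\<And>a b. D a \<noteq> 0 \<Longrightarrow> (\<forall>i\<in>set is. (\<Sum>m\<in>M. b m * C' i a m) = 0) \<Longrightarrow> (\<forall>m\<in>M. b m = 0)"
      by blast
    show ?case
    proof (rule exI[of _ "i1 # is"], rule exI[of _ "\<lambda>a. D a * C i1 a \<mu>"],
        rule exI[of _ "\<lambda>\<tau>. s \<tau> * s1 \<tau>"], rule exI[of _ "z * v1 \<mu>"], intro conjI allI impI)
      show "set (i1 # is) \<subseteq> I" using IH i1 by auto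
      show "length (i1 # is) = card (insert \<mu> M)" using IH insert.hyps by simp
      show "entire (\<lambda>a. D a * C i1 a \<mu>)" using i1 by (intro entire_mult IH insert.prems(1)) auto
      show "z * v1 \<mu> \<noteq> 0" using IH v1 by simp
      show "((\<lambda>\<tau>. s \<tau> * s1 \<tau> * (D (q \<tau>) * C i1 (q \<tau>) \<mu>)) \<longlongrightarrow> z * v1 \<mu>) at_top"
        using tendsto_mult[OF IH(5) l1[of \<mu>]] by (simp add: mult_ac)
      fix a b assume D: "D a * C i1 a \<mu> \<noteq> 0" and b: "\<forall>i\<in>set (i1 # is). (\<Sum>m\<in>insert \<mu> M. b m * C i a m) = 0"
      have b0: "(\<Sum>m\<in>M. b m * C i a m) = - b \<mu> * C i a \<mu>" if "i \<in> set (i1 # is)" for i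
      proof -
        have "(\<Sum>m\<in>insert \<mu> M. b m * C i a m) = 0" using b that by blast
        then show ?thesis using insert.hyps by (simp add: eq_neg_iff_add_eq_0 add.commute)
      qed
      have "(\<Sum>m\<in>M. b m * C' i a m) = 0" if "i \<in> set is" for i
      proof -
        have "(\<Sum>m\<in>M. b m * C' i a m) = (\<Sum>m\<in>M. b m * C i a m) * C i1 a \<mu> - C i a \<mu> * (\<Sum>m\<in>M. b m * C i1 a m)"
          by (simp add: C'_def algebra_simps sum_subtractf sum_distrib_left sum_distrib_right)
        also have "\<dots> = 0" using b0[of i] b0[of i1] that by simp
        finally show ?thesis .
      qed
      then have M0: "\<forall>m\<in>M. b m = 0" using IH(6)[of a b] D by auto
      then have "b \<mu> * C i1 a \<mu> = 0" using b0[of i1] by simp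
      then show "\<forall>m\<in>insert \<mu> M. b m = 0" using M0 D by auto
    qed
  qed
  then obtain "is" D s z where *: "set is \<subseteq> I" "length is = card M" "entire D" "z \<noteq> 0"
      "((\<lambda>\<tau>. s \<tau> * D (q \<tau>)) \<longlongrightarrow> z) at_top"
      "\<And>a b. D a \<noteq> 0 \<Longrightarrow> (\<forall>i\<in>set is. (\<Sum>m\<in>M. b m * C i a m) = 0) \<Longrightarrow> (\<forall>m\<in>M. b m = 0)"
    by blast
  have "\<exists>a. D a \<noteq> 0"
  proof (rule ccontr)
    assume "\<nexists>a. D a \<noteq> 0"
    then have "((\<lambda>\<tau>::real. 0 :: complex) \<longlongrightarrow> z) at_top" using *(5) by simp
    then show False using *(4) by (simp add: tendsto_const_iff)
  qed
  then show ?thesis using * by blast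
qed

text \<open>If the span were proper, some linear functional would vanish on it but not on some
  monomial of M. So the d elements span a space of dimension d, and counting makes them distinct and
  independent.\<close>

lemma basis_of_trivial_annihilator:
  fixes hs :: "nat \<Rightarrow> 'a alg"
  assumes M: "finite M" "card M = d"
    and hs: "\<And>i. i \<in> {1..d} \<Longrightarrow> keys (hs i) \<subseteq> M"
    and ann: "\<And>b. (\<forall>i\<in>{1..d}. (\<Sum>m\<in>M. b m * lookup (hs i) m) = 0) \<Longrightarrow> \<forall>m\<in>M. b m = 0"
  shows "is_basis_of {1..d} hs {h. keys h \<subseteq> M}"
proof -
  define V where "V = {h :: 'a alg. keys h \<subseteq> M}"
  define S where "S = hs ` {1..d}"
  have V: "alg.span ((\<lambda>m. single m 1) ` M) = V" by (simp add: V_def alg_support_span M)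
  have dimV: "alg.dim V = d" by (simp add: V_def alg_support_dim M)
  have SV: "S \<subseteq> V" unfolding S_def V_def by (intro image_subsetI CollectI hs)
  have finS: "finite S" by (simp add: S_def)
  interpret vp: vector_space_pair "alg_scale :: complex \<Rightarrow> 'a alg \<Rightarrow> 'a alg" "(*) :: complex \<Rightarrow> complex \<Rightarrow> complex"
    by unfold_locales (auto simp: algebra_simps)
  have "single m 1 \<in> alg.span S" if m: "m \<in> M" for m
  proof (rule ccontr)
    assume nm: "single m 1 \<notin> alg.span S"
    obtain B where B: "B \<subseteq> S" "alg.independent B" "S \<subseteq> alg.span B"
      using alg.maximal_independent_subset by blast
    have sp: "alg.span B = alg.span S"
      using B by (metis alg.span_minimal alg.span_mono alg.subspace_span subset_antisym)
    have ind: "alg.independent (insert (single m 1) B)"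
      using B nm sp by (simp add: alg.independent_insertI)
    obtain g where g: "Vector_Spaces.linear alg_scale (*) g"
      "\<And>x. x \<in> insert (single m 1) B \<Longrightarrow> g x = (if x = single m (1::complex) then 1 else 0 :: complex)"
      using vp.linear_independent_extend[OF ind, of "\<lambda>x. if x = single m 1 then 1 else 0"] by blast
    interpret g: Vector_Spaces.linear alg_scale "(*)" g by fact
    have gB: "g x = 0" if "x \<in> B" for x
      using g(2)[of x] that nm sp alg.span_base[of x B] by auto
    have gS: "g x = 0" if "x \<in> alg.span B" for x
      using that by (induction rule: alg.span_induct_alt) (auto simp: g.add g.scale gB g.zero)
    define b where "b m = g (single m 1)" for m
    have "(\<Sum>m\<in>M. b m * lookup (hs i) m) = 0" if i: "i \<in> {1..d}" for i
    proof -
      have "hs i = (\<Sum>m\<in>M. alg_scale (lookup (hs i) m) (single m 1))"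
        using alg_expand[OF M(1) hs[OF i]] by (simp add: alg_scale_single)
      then have "g (hs i) = (\<Sum>m\<in>M. lookup (hs i) m * g (single m 1))"
        by (metis (no_types, lifting) g.scale g.sum sum.cong)
      moreover have "hs i \<in> S" using i by (simp add: S_def)
      then have "g (hs i) = 0" using gS B(3) by blast
      ultimately show ?thesis by (simp add: b_def mult.commute)
    qed
    then have "b m = 0" using ann m by blast
    moreover have "b m = 1" using g(2)[of "single m 1"] by (simp add: b_def)
    ultimately show False by simp
  qed
  then have "V \<subseteq> alg.span S"
    unfolding V[symmetric] by (intro alg.span_minimal) auto
  moreover have "alg.span S \<subseteq> V"
    using SV unfolding V[symmetric] by (intro alg.span_minimal) auto
  ultimately have sp: "alg.span S = V" by blast
  have "card S \<le> d" unfolding S_def using card_image_le[of "{1..d}" hs] by simp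
  moreover have "d \<le> card S"
    using alg.dim_le_card[of V S] sp finS dimV by simp
  ultimately have card: "card S = d" by simp
  obtain B where B: "B \<subseteq> S" "alg.independent B" "S \<subseteq> alg.span B"
    using alg.maximal_independent_subset by blast
  have "alg.span B = V"
    using B sp by (metis alg.span_minimal alg.span_mono alg.subspace_span subset_antisym)
  then have "card B = d"
    using alg.dim_span_eq_card_independent[OF B(2)] dimV by simp
  then have "B = S" using B(1) card finS by (simp add: card_subset_eq)
  have "inj_on hs {1..d}"
    using card by (intro eq_card_imp_inj_on) (auto simp: S_def)
  moreover have "alg.independent S"
    using B \<open>B = S\<close> by simp
  ultimately show ?thesis using sp by (simp add: is_basis_of_def S_def V_def)
qed

section \<open>Homogeneous parts of the exponential of a linear form\<close>

definition mexp :: "('g \<Rightarrow> complex) \<Rightarrow> ('g \<Rightarrow>\<^sub>0 nat) \<Rightarrow> complex" where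
  "mexp w m = (\<Prod>g\<in>keys m. w g ^ lookup m g / fact (lookup m g))"

definition hx :: "nat \<Rightarrow> ('i::finite \<times> nat \<Rightarrow> complex) \<Rightarrow> complex" where
  "hx l w = (\<Sum>m\<in>monoms l. mexp w m)"

text \<open>The part of degree l of the formal exponential of \<Sum>_g w(g) g, where g runs over the
  generators; \<open>mexp w m\<close> is the coefficient of the monomial m in it, and
  \<open>hx l w\<close> is the number obtained by replacing all generators by 1.\<close>

definition hexp :: "nat \<Rightarrow> ('i::finite \<times> nat \<Rightarrow> complex) \<Rightarrow> 'i alg" where
  "hexp l w = (\<Sum>m\<in>monoms l. single m (mexp w m))"

lemma mexp_superset:
  assumes "finite K" "keys m \<subseteq> K"
  shows "mexp w m = (\<Prod>g\<in>K. w g ^ lookup m g / fact (lookup m g))"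
  unfolding mexp_def using assms by (intro prod.mono_neutral_left) (auto simp: in_keys_iff)

lemma mexp_mult: "mexp (\<lambda>g. z g * w g) m = mexp z m * mono_eval w m"
  by (simp add: mexp_def mono_eval_def power_mult_distrib prod.distrib[symmetric])

lemma alg_eval_hexp: "alg_eval v (hexp l z) = hx l (\<lambda>g. z g * v g)"
  by (simp add: hexp_def hx_def alg_eval_sum alg_eval_single mexp_mult)

lemma hexp_in_grade: "hexp l z \<in> alg_grade l"
  unfolding hexp_def by (intro alg_grade_sum single_in_alg_grade) (simp add: monoms_def)

lemma mexp_add_single:
  "of_nat (lookup (m + single g 1) g) * mexp w (m + single g 1) = w g * mexp w m"
proof -
  let ?K = "insert g (keys m)"
  have k: "keys (m + single g 1) \<subseteq> ?K" using keys_add[of m "single g 1"] by auto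
  have e1: "mexp w (m + single g 1) = w g ^ Suc (lookup m g) / fact (Suc (lookup m g)) *
      (\<Prod>h\<in>keys m - {g}. w h ^ lookup m h / fact (lookup m h))"
    by (subst mexp_superset[OF _ k]) (auto simp: prod.insert_remove lookup_add lookup_single intro!: prod.cong)
  have e2: "mexp w m = w g ^ lookup m g / fact (lookup m g) *
      (\<Prod>h\<in>keys m - {g}. w h ^ lookup m h / fact (lookup m h))"
    by (subst mexp_superset[of ?K]) (auto simp: prod.insert_remove intro!: prod.cong)
  have e3: "of_nat (lookup (m + single g 1) g) = (1 + of_nat (lookup m g) :: complex)"
    by (simp add: lookup_add)
  have nz: "(1 + of_nat n :: complex) \<noteq> 0" for n
    using of_nat_neq_0[of n, where 'a = complex] by (simp add: add.commute)
  show ?thesis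
    unfolding e1 e2 e3 using nz[of "lookup m g"] by (simp add: divide_simps mult_ac)
qed

text \<open>Euler's identity for the exponential: the degree of a monomial is counted by removing
  one of its generators in all possible ways, and removing g takes \<open>mexp\<close> to w(g) times
  the coefficient of the smaller monomial. The argument k - 1 occurs because the generator (i, q)
  has degree q + 1.\<close>

lemma hx_recursion:
  fixes w :: "'i::finite \<times> nat \<Rightarrow> complex"
  shows "of_nat l * hx l w = (\<Sum>k\<in>{1..l}. of_nat k * (\<Sum>i\<in>UNIV. w (i, k - 1)) * hx (l - k) w)"
proof -
  have "of_nat l * hx l w = (\<Sum>m\<in>monoms l. \<Sum>g\<in>keys m. of_nat (snd g + 1) * (of_nat (lookup m g) * mexp w m))"
  proof -
    have "of_nat l * mexp w m = (\<Sum>g\<in>keys m. of_nat (snd g + 1) * (of_nat (lookup m g) * mexp w m))"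
      if "m \<in> monoms l" for m
    proof -
      have "l = (\<Sum>g\<in>keys m. lookup m g * (snd g + 1))" using that by (simp add: monoms_def mdegree_def)
      then have "of_nat l = (\<Sum>g\<in>keys m. of_nat (lookup m g * (snd g + 1)) :: complex)"
        using of_nat_sum by metis
      then have "of_nat l * mexp w m = (\<Sum>g\<in>keys m. of_nat (lookup m g * (snd g + 1)) * mexp w m)"
        by (simp only: sum_distrib_right)
      then show ?thesis by (simp only: of_nat_mult mult_ac)
    qed
    then show ?thesis by (simp add: hx_def sum_distrib_left)
  qed
  also have "\<dots> = (\<Sum>(m,g)\<in>Sigma (monoms l) keys. of_nat (snd g + 1) * (of_nat (lookup m g) * mexp w m))"
    by (rule sum.Sigma) (auto simp: finite_monoms)
  also have "\<dots> = (\<Sum>((k,i),m)\<in>Sigma ({1..l} \<times> UNIV) (\<lambda>(k,i). monoms (l - k)). of_nat k * (w (i, k - 1) * mexp w m))"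
  proof (rule sum.reindex_bij_witness[of _ "\<lambda>((k,i),m). (m + single (i, k - 1) 1, (i, k - 1))"
      "\<lambda>(m,g). ((snd g + 1, fst g), m - single g 1)"])
    fix x assume x: "x \<in> Sigma (monoms l :: 'i monomial set) keys"
    then obtain m i n where x_eq: "x = (m, (i, n))" "mdegree m = l" "(i, n) \<in> keys m"
      by (cases x) (auto simp: monoms_def)
    have *: "m - single (i, n) 1 + single (i, n) 1 = m"
      using x_eq(3) by (intro poly_mapping_eqI) (auto simp: lookup_add lookup_minus lookup_single when_def in_keys_iff)
    then have deg: "mdegree (m - single (i, n) 1) + (n + 1) = l"
      using mdegree_add[of "m - single (i, n) 1" "single (i, n) 1"] x_eq(2) by (simp add: mdegree_single)
    show "(\<lambda>((k, i), m). (m + single (i, k - 1) 1, (i, k - 1))) ((\<lambda>(m, g). ((snd g + 1, fst g), m - single g 1)) x) = x"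
      using * x_eq by simp
    show "(case x of (m, g) \<Rightarrow> ((snd g + 1, fst g), m - single g 1)) \<in> Sigma ({1..l} \<times> UNIV) (\<lambda>(k,i). monoms (l - k))"
      using deg x_eq by (auto simp: monoms_def)
    show "(\<lambda>((k, i), m). of_nat k * (w (i, k - 1) * mexp w m)) ((\<lambda>(m, g). ((snd g + 1, fst g), m - single g 1)) x) =
      (\<lambda>(m, g). of_nat (snd g + 1) * (of_nat (lookup m g) * mexp w m)) x"
      using mexp_add_single[of "m - single (i, n) 1" "(i, n)" w] x_eq * by simp
  next
    fix y assume y: "y \<in> Sigma ({1..l} \<times> (UNIV :: 'i set)) (\<lambda>(k,i). monoms (l - k) :: 'i monomial set)"
    then obtain k i m where y_eq: "y = ((k, i), m)" "1 \<le> k" "k \<le> l" "mdegree m = l - k"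
      by (cases y) (auto simp: monoms_def)
    have "m + single (i, k - 1) 1 - single (i, k - 1) 1 = m"
      by (intro poly_mapping_eqI) (auto simp: lookup_add lookup_minus)
    then show "(\<lambda>(m, g). ((snd g + 1, fst g), m - single g 1)) ((\<lambda>((k, i), m). (m + single (i, k - 1) 1, (i, k - 1))) y) = y"
      using y_eq by simp
    have "(i, k - 1) \<in> keys (m + single (i, k - 1) 1)"
      by (simp add: in_keys_iff lookup_add)
    then show "(\<lambda>((k, i), m). (m + single (i, k - 1) 1, (i, k - 1))) y \<in> Sigma (monoms l) keys"
      using y_eq by (auto simp: monoms_def mdegree_add mdegree_single)
  qed
  also have "\<dots> = (\<Sum>(k,i)\<in>{1..l} \<times> UNIV. \<Sum>m\<in>monoms (l - k). of_nat k * (w (i, k - 1) * mexp w m))"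
    using sum.Sigma[of "{1..l} \<times> (UNIV :: 'i set)" "\<lambda>(k,i). monoms (l - k) :: 'i monomial set"
        "\<lambda>(k,i) m. of_nat k * (w (i, k - 1) * mexp w m)"]
    by (simp add: finite_monoms case_prod_unfold)
  also have "\<dots> = (\<Sum>k\<in>{1..l}. \<Sum>i\<in>UNIV. of_nat k * w (i, k - 1) * hx (l - k) w)"
    by (simp add: sum.cartesian_product[symmetric] hx_def sum_distrib_left sum_distrib_right mult_ac)
  also have "\<dots> = (\<Sum>k\<in>{1..l}. of_nat k * (\<Sum>i\<in>UNIV. w (i, k - 1)) * hx (l - k) w)"
    by (simp add: sum_distrib_left sum_distrib_right)
  finally show ?thesis .
qed

section \<open>Points with prescribed power sums\<close>

lemma sum_list_power_roots:
  assumes "q > 0"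
  shows "(\<Sum>j\<leftarrow>[0..<q]. (r * omega_pow q (of_nat j)) ^ m) = (if q dvd m then of_nat q * r ^ m else 0)"
proof -
  define z where "z = omega_pow q (of_nat m)"
  have "(\<Sum>j\<leftarrow>[0..<q]. (r * omega_pow q (of_nat j)) ^ m) = (\<Sum>j<q. r ^ m * z ^ j)"
    by (simp add: sum_list_distinct_conv_sum_set atLeast0LessThan power_mult_distrib omega_pow_power z_def mult.commute)
  also have "\<dots> = r ^ m * (\<Sum>j<q. z ^ j)"
    by (simp add: sum_distrib_left)
  also have "(\<Sum>j<q. z ^ j) = (if q dvd m then of_nat q else 0)"
  proof (cases "q dvd m")
    case True
    then have "z = 1" unfolding z_def using omega_pow_of_nat_eq_1_iff[OF assms] by simp
    then show ?thesis using True by simp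
  next
    case False
    then have "z \<noteq> 1" unfolding z_def using omega_pow_of_nat_eq_1_iff[OF assms] by simp
    moreover have "z ^ q = 1"
      unfolding z_def omega_pow_power using omega_pow_of_nat_eq_1_iff[OF assms, of "q * m"] by simp
    ultimately show ?thesis using False by (simp add: geometric_sum)
  qed
  finally show ?thesis by (simp add: mult.commute)
qed

lemma sum_list_map_concat: "sum_list (map f (concat xss)) = (\<Sum>xs\<leftarrow>xss. sum_list (map f xs))"
  by (induction xss) simp_all

text \<open>The orders are corrected one after another: the vertices of a regular (l+1)-gon around 0
  have vanishing power sums of orders 1 to l, and the radius and the angle adjust the one of order l
  + 1.\<close>

lemma exists_list_power_sums:
  fixes \<pi> :: "nat \<Rightarrow> complex"
  shows "\<exists>ys. 0 \<notin> set ys \<and> (\<forall>m\<in>{1..l}. (\<Sum>y\<leftarrow>ys. y ^ m) = \<pi> m)"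
proof (induction l)
  case 0
  show ?case by (intro exI[of _ "[]"]) simp
next
  case (Suc l)
  then obtain ys where ys: "0 \<notin> set ys" "\<And>m. m \<in> {1..l} \<Longrightarrow> (\<Sum>y\<leftarrow>ys. y ^ m) = \<pi> m" by blast
  define e where "e = \<pi> (Suc l) - (\<Sum>y\<leftarrow>ys. y ^ Suc l)"
  show ?case
  proof (cases "e = 0")
    case True
    have "(\<Sum>y\<leftarrow>ys. y ^ m) = \<pi> m" if "m \<in> {1..Suc l}" for m
      using that ys(2)[of m] True by (cases "m = Suc l") (auto simp: e_def)
    then show ?thesis using ys(1) by blast
  next
    case False
    define n where "n = Suc l"
    define r where "r = exp (Ln (e / of_nat n) / of_nat n)"
    have n: "n > 0" and "e / of_nat n \<noteq> 0" using False by (simp_all add: n_def del: of_nat_Suc)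
    then have "r ^ n = e / of_nat n"
      unfolding r_def exp_of_nat_mult[symmetric] by simp
    then have r: "r ^ Suc l = e / of_nat (Suc l)" "r \<noteq> 0"
      by (simp_all only: n_def r_def exp_not_eq_zero not_False_eq_True)
    define zs where "zs = map (\<lambda>j. r * omega_pow (Suc l) (of_nat j)) [0..<Suc l]"
    have zs: "(\<Sum>y\<leftarrow>zs. y ^ m) = (if Suc l dvd m then of_nat (Suc l) * r ^ m else 0)" for m
      using sum_list_power_roots[of "Suc l" r m] by (simp add: zs_def o_def del: upt_Suc of_nat_Suc)
    have "(\<Sum>y\<leftarrow>ys @ zs. y ^ m) = \<pi> m" if m: "m \<in> {1..Suc l}" for m
    proof (cases "m = Suc l")
      case True
      then show ?thesis using zs[of m] r(1) by (simp add: e_def del: power_Suc of_nat_Suc)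
    next
      case False
      then have "\<not> Suc l dvd m" using m by (auto dest: dvd_imp_le)
      then show ?thesis using zs[of m] ys(2)[of m] m False by simp
    qed
    moreover have "0 \<notin> set (ys @ zs)" using ys(1) r(2) by (auto simp: zs_def)
    ultimately show ?thesis by blast
  qed
qed

text \<open>A nontrivial q-th root of unity with q prime has order exactly q, so every element of C
  is hit by at most one prime.\<close>

lemma finite_primes_hitting:
  assumes "finite C"
  shows "finite {q::nat. prime q \<and> (\<exists>n::nat. \<not> q dvd n \<and> omega_pow q (of_nat n) \<in> C)}"
proof -
  have "finite {q::nat. prime q \<and> (\<exists>n::nat. \<not> q dvd n \<and> omega_pow q (of_nat n) = c)}" (is "finite (?P c)") for c
  proof -
    have "q = q'" if qq: "q \<in> ?P c" "q' \<in> ?P c" for q q'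
    proof (rule ccontr)
      assume "q \<noteq> q'"
      obtain n n' where n: "prime q" "prime q'" "\<not> q dvd n" "omega_pow q (of_nat n) = c" "omega_pow q' (of_nat n') = c"
        using qq by auto
      have "c ^ q' = 1"
        unfolding n(5)[symmetric] omega_pow_power
        using omega_pow_of_nat_eq_1_iff[of q' "q' * n'"] n(2) prime_gt_0_nat[of q'] by simp
      then have "omega_pow q (of_nat (q' * n)) = 1"
        unfolding n(4)[symmetric] omega_pow_power by simp
      then have "q dvd q' * n"
        using omega_pow_of_nat_eq_1_iff[of q] n(1) prime_gt_0_nat by blast
      then show False
        using n \<open>q \<noteq> q'\<close> by (metis prime_dvd_mult_iff primes_dvd_imp_eq)
    qed
    then have "?P c \<subseteq> {SOME q. q \<in> ?P c}"
      by (metis (no_types, lifting) someI singletonI subsetI)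
    then show ?thesis using finite_subset by blast
  qed
  then have "finite (\<Union>c\<in>C. ?P c)" using assms by blast
  then show ?thesis by (rule finite_subset[rotated]) auto
qed

text \<open>
  A regular \<open>q\<close>-gon without its vertex \<open>y\<close> has power sums \<open>- y ^ m\<close> for \<open>m < q\<close>; all but finitely
  many primes \<open>q\<close> avoid the finitely many forbidden ratios.
\<close>

lemma exists_generic_negative:
  fixes y :: complex
  assumes "finite Z" "0 \<notin> Z" "finite B" "y \<noteq> 0" "K > 0"
  shows "\<exists>ds. 0 \<notin> set ds \<and> sorted_wrt (\<lambda>d d'. d ^ K / d' ^ K \<notin> B) ds \<and>
    (\<forall>d\<in>set ds. \<forall>z\<in>Z. d ^ K / z \<notin> B) \<and> (\<forall>m\<in>{1..l}. (\<Sum>d\<leftarrow>ds. d ^ m) = - (y ^ m))"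
proof -
  \<comment> \<open>Values that the roots of unity must avoid: the first set for the ratios between
    two vertices of the polygon, the second for the ratios of vertices to elements of Z.\<close>
  define C where "C = inverse ` B \<union> (\<lambda>(b,z). b * z / y ^ K) ` (B \<times> Z)"
  have "finite C" using assms by (simp add: C_def)
  then have "finite ({q::nat. prime q \<and> (\<exists>n::nat. \<not> q dvd n \<and> omega_pow q (of_nat n) \<in> C)} \<union> {..K + l})"
    using finite_primes_hitting by blast
  then have "\<not> {q::nat. prime q} \<subseteq> {q::nat. prime q \<and> (\<exists>n::nat. \<not> q dvd n \<and> omega_pow q (of_nat n) \<in> C)} \<union> {..K + l}"
    using primes_infinite finite_subset by blast
  then obtain q :: nat where q': "prime q"
    "q \<notin> {q::nat. prime q \<and> (\<exists>n::nat. \<not> q dvd n \<and> omega_pow q (of_nat n) \<in> C)} \<union> {..K + l}"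
    by blast
  \<comment> \<open>The bound q > K keeps the K-th powers of the roots nontrivial; q > l makes the
    power sums of the full polygon vanish up to order l.\<close>
  then have q: "prime q" "q > K + l" "\<And>n. \<not> q dvd n \<Longrightarrow> omega_pow q (of_nat n) \<notin> C"
    by auto
  have q0: "q > 0" using q by simp
  define ds where "ds = map (\<lambda>j. y * omega_pow q (of_nat j)) [1..<q]"
  have nd: "\<not> q dvd j * K" if "j \<in> {1..<q}" for j
  proof
    assume "q dvd j * K"
    then have "q dvd j \<or> q dvd K" using q(1) prime_dvd_mult_iff by blast
    then show False using that q(2) assms(5) by (auto dest!: dvd_imp_le)
  qed
  have pw: "(y * omega_pow q (of_nat j)) ^ K = y ^ K * omega_pow q (of_nat (j * K))" for j
    by (simp add: power_mult_distrib omega_pow_power mult.commute)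
  have "0 \<notin> set ds" using assms by (auto simp: ds_def)
  moreover have "sorted_wrt (\<lambda>d d'. d ^ K / d' ^ K \<notin> B) ds"
    unfolding sorted_wrt_iff_nth_less
  proof (intro allI impI)
    fix i j assume ij: "i < j" "j < length ds"
    have nth: "ds ! i = y * omega_pow q (of_nat (Suc i))" "ds ! j = y * omega_pow q (of_nat (Suc j))"
      using ij unfolding ds_def by (simp_all del: of_nat_Suc)
    have "Suc j * K = Suc i * K + (j - i) * K" using ij by (simp add: algebra_simps flip: distrib_right)
    then have "omega_pow q (of_nat (Suc j * K)) = omega_pow q (of_nat (Suc i * K)) * omega_pow q (of_nat ((j - i) * K))"
      by (simp only: of_nat_add omega_pow_add)
    then have "(ds ! i) ^ K / (ds ! j) ^ K = inverse (omega_pow q (of_nat ((j - i) * K)))"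
      unfolding nth pw using assms(4) by (simp add: field_simps del: of_nat_mult of_nat_Suc)
    moreover have "j - i \<in> {1..<q}" using ij by (auto simp: ds_def)
    from q(3)[OF nd[OF this]] have "omega_pow q (of_nat ((j - i) * K)) \<notin> C" .
    ultimately show "(ds ! i) ^ K / (ds ! j) ^ K \<notin> B"
      unfolding C_def using image_eqI[of _ inverse _ B] by (metis UnI1 inverse_inverse_eq)
  qed
  moreover have "d ^ K / z \<notin> B" if dz: "d \<in> set ds" "z \<in> Z" for d z
  proof
    assume b: "d ^ K / z \<in> B"
    obtain j where j: "j \<in> {1..<q}" "d = y * omega_pow q (of_nat j)" using dz by (auto simp: ds_def)
    have "z \<noteq> 0" using that assms(2) by auto
      have "omega_pow q (of_nat (j * K)) = (d ^ K / z) * z / y ^ K"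
        unfolding j(2) pw using \<open>z \<noteq> 0\<close> assms by simp
      moreover have "(d ^ K / z, z) \<in> B \<times> Z" using b that by simp
      ultimately have "omega_pow q (of_nat (j * K)) \<in> C"
        unfolding C_def by (intro UnI2 image_eqI[of _ _ "(d ^ K / z, z)"]) simp_all
      then show False using q(3) nd[OF j(1)] by blast
  qed
  moreover have "(\<Sum>d\<leftarrow>ds. d ^ m) = - (y ^ m)" if m: "m \<in> {1..l}" for m
  proof -
    have "[0..<q] = 0 # [1..<q]" using q0 by (simp add: upt_conv_Cons)
    then have "(\<Sum>j\<leftarrow>[0..<q]. (y * omega_pow q (of_nat j)) ^ m) = y ^ m + (\<Sum>d\<leftarrow>ds. d ^ m)"
      by (simp add: ds_def o_def)
    moreover have "\<not> q dvd m" using m q(2) by (auto dest: dvd_imp_le)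
    ultimately show ?thesis using sum_list_power_roots[OF q0, of y m] by (simp add: eq_neg_iff_add_eq_0 add.commute)
  qed
  ultimately show ?thesis by blast
qed


text \<open>Points with power sums - \<pi> are found first, without regard to ratios. Each of them
  is then traded for points with the opposite power sums, chosen generic against those already
  placed. Closure of B under inversion reduces the condition on pairs to one order of the pair. A
  list entry is a pair of the value of k and the point.\<close>

lemma exists_generic_power_sums:
  fixes \<pi> :: "nat \<Rightarrow> nat \<Rightarrow> complex"
  assumes B: "finite B" "\<And>b. b \<in> B \<Longrightarrow> inverse b \<in> B" and K: "K > 0"
  shows "\<exists>(N::nat) (k :: nat \<Rightarrow> nat) x. (\<forall>n\<in>{1..N}. k n \<in> {1..R} \<and> x n \<noteq> 0) \<and>
    (\<forall>m\<in>{1..N}. \<forall>n\<in>{1..N}. m \<noteq> n \<longrightarrow> x m ^ K / x n ^ K \<notin> B) \<and>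
    (\<forall>i\<in>{1..R}. \<forall>m\<in>{1..l}. (\<Sum>n\<in>{n \<in> {1..N}. k n = i}. x n ^ m) = \<pi> i m)"
proof -
  have "\<exists>ps :: (nat \<times> complex) list. fst ` set ps \<subseteq> fst ` set vs \<and> 0 \<notin> snd ` set ps \<and>
      sorted_wrt (\<lambda>a b. snd a ^ K / snd b ^ K \<notin> B) ps \<and>
      (\<forall>i. \<forall>m\<in>{1..l}. (\<Sum>a\<leftarrow>ps. if fst a = i then snd a ^ m else 0) = - (\<Sum>a\<leftarrow>vs. if fst a = i then snd a ^ m else 0))"
    if "0 \<notin> snd ` set vs" for vs :: "(nat \<times> complex) list"
    using that
  proof (induction vs)
    case Nil
    show ?case by (intro exI[of _ "[]"]) simp
  next
    case (Cons v vs)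
    then obtain ps :: "(nat \<times> complex) list" where ps: "fst ` set ps \<subseteq> fst ` set vs" "0 \<notin> snd ` set ps"
      "sorted_wrt (\<lambda>a b. snd a ^ K / snd b ^ K \<notin> B) ps"
      "\<And>i m. m \<in> {1..l} \<Longrightarrow> (\<Sum>a\<leftarrow>ps. if fst a = i then snd a ^ m else 0) =
          - (\<Sum>a\<leftarrow>vs. if fst a = i then snd a ^ m else 0)"
      by auto
    define Z where "Z = (\<lambda>a. snd a ^ K) ` set ps"
    have Z: "finite Z" "0 \<notin> Z" using ps(2) K by (auto simp: Z_def image_iff)
    have v: "snd v \<noteq> 0" using Cons.prems by auto
    obtain ds where ds: "0 \<notin> set ds" "sorted_wrt (\<lambda>d d'. d ^ K / d' ^ K \<notin> B) ds"
      "\<And>d z. d \<in> set ds \<Longrightarrow> z \<in> Z \<Longrightarrow> d ^ K / z \<notin> B"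
      "\<And>m. m \<in> {1..l} \<Longrightarrow> (\<Sum>d\<leftarrow>ds. d ^ m) = - (snd v ^ m)"
      using exists_generic_negative[OF Z B(1) v K, of l] by blast
    define qs where "qs = map (Pair (fst v)) ds"
    have "fst ` set (qs @ ps) \<subseteq> fst ` set (v # vs)" using ps(1) by (auto simp: qs_def)
    moreover have "0 \<notin> snd ` set (qs @ ps)" using ps(2) ds(1) by (auto simp: qs_def)
    moreover have "sorted_wrt (\<lambda>a b. snd a ^ K / snd b ^ K \<notin> B) (qs @ ps)"
      using ps(3) ds(2,3) by (auto simp: sorted_wrt_append qs_def sorted_wrt_map Z_def)
    moreover have "(\<Sum>a\<leftarrow>qs @ ps. if fst a = i then snd a ^ m else 0) =
        - (\<Sum>a\<leftarrow>v # vs. if fst a = i then snd a ^ m else 0)" if "m \<in> {1..l}" for i m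
    proof -
      have "(\<Sum>a\<leftarrow>qs. if fst a = i then snd a ^ m else 0) = (if fst v = i then \<Sum>d\<leftarrow>ds. d ^ m else 0)"
        by (simp add: qs_def o_def)
      then show ?thesis using ps(4)[OF that, of i] ds(4)[OF that] by simp
    qed
    ultimately show ?case by blast
  qed
  note main = this
  have "\<forall>i. \<exists>ys. 0 \<notin> set ys \<and> (\<forall>m\<in>{1..l}. (\<Sum>y\<leftarrow>ys. y ^ m) = - \<pi> i m)"
  proof
    fix i show "\<exists>ys. 0 \<notin> set ys \<and> (\<forall>m\<in>{1..l}. (\<Sum>y\<leftarrow>ys. y ^ m) = - \<pi> i m)"
      using exists_list_power_sums[of l "\<lambda>m. - \<pi> i m"] .
  qed
  then obtain ys where ys: "\<And>i. 0 \<notin> set (ys i)" "\<And>i m. m \<in> {1..l} \<Longrightarrow> (\<Sum>y\<leftarrow>ys i. y ^ m) = - \<pi> i m"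
    by metis
  define vs where "vs = concat (map (\<lambda>i. map (Pair i) (ys i)) [1..<Suc R])"
  have vs0: "0 \<notin> snd ` set vs" and vsR: "fst ` set vs \<subseteq> {1..R}"
    using ys(1) by (auto simp: vs_def)
  have vs: "(\<Sum>a\<leftarrow>vs. if fst a = i then snd a ^ m else 0) = - \<pi> i m" if i: "i \<in> {1..R}" and m: "m \<in> {1..l}" for i m
  proof -
    have "(\<Sum>a\<leftarrow>vs. if fst a = i then snd a ^ m else 0) =
        (\<Sum>j\<leftarrow>[1..<Suc R]. \<Sum>a\<leftarrow>map (Pair j) (ys j). if fst a = i then snd a ^ m else 0)"
      unfolding vs_def sum_list_map_concat by (simp add: o_def)
    also have "\<dots> = (\<Sum>j\<leftarrow>[1..<Suc R]. if j = i then - \<pi> i m else 0)"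
      using ys(2)[OF m] by (intro arg_cong[of _ _ sum_list] map_cong) (auto simp: o_def)
    also have "\<dots> = - \<pi> i m"
      using i by (simp add: sum_list_distinct_conv_sum_set del: upt_Suc)
    finally show ?thesis .
  qed
  obtain ps :: "(nat \<times> complex) list" where ps: "fst ` set ps \<subseteq> fst ` set vs" "0 \<notin> snd ` set ps"
      "sorted_wrt (\<lambda>a b. snd a ^ K / snd b ^ K \<notin> B) ps"
      "\<And>i m. m \<in> {1..l} \<Longrightarrow> (\<Sum>a\<leftarrow>ps. if fst a = i then snd a ^ m else 0) =
          - (\<Sum>a\<leftarrow>vs. if fst a = i then snd a ^ m else 0)"
    using main[OF vs0] by blast
  define N where "N = length ps"
  define k where "k n = fst (ps ! (n - 1))" for n
  define x where "x n = snd (ps ! (n - 1))" for n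
  have mem: "ps ! (n - 1) \<in> set ps" if "n \<in> {1..N}" for n
    using that by (intro nth_mem) (auto simp: N_def)
  show ?thesis
  proof (rule exI[of _ N], rule exI[of _ k], rule exI[of _ x], intro conjI ballI impI)
    fix n assume n: "n \<in> {1..N}"
    show "k n \<in> {1..R}" using mem[OF n] ps(1) vsR unfolding k_def by blast
    show "x n \<noteq> 0" using mem[OF n] ps(2) unfolding x_def by force
  next
    have less: "x m ^ K / x n ^ K \<notin> B" if "m \<in> {1..N}" "n \<in> {1..N}" "m < n" for m n
      using ps(3) that unfolding sorted_wrt_iff_nth_less x_def N_def by auto
    fix m n assume mn: "m \<in> {1..N}" "n \<in> {1..N}" "m \<noteq> n"
    show "x m ^ K / x n ^ K \<notin> B"
    proof (cases "m < n")
      case False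
      then have "x n ^ K / x m ^ K \<notin> B" using less[of n m] mn by auto
      then show ?thesis using B(2)[of "x m ^ K / x n ^ K"] by auto
    qed (use less mn in auto)
  next
    fix i m assume im: "i \<in> {1..R}" "m \<in> {1..l}"
    have "(\<Sum>n\<in>{n \<in> {1..N}. k n = i}. x n ^ m) = (\<Sum>n\<in>{1..N}. if k n = i then x n ^ m else 0)"
      by (rule sum.inter_filter) simp
    also have "\<dots> = (\<Sum>n<N. if k (Suc n) = i then x (Suc n) ^ m else 0)"
      by (rule sum.reindex_bij_witness[of _ Suc "\<lambda>n. n - 1"]) auto
    also have "\<dots> = (\<Sum>a\<leftarrow>ps. if fst a = i then snd a ^ m else 0)"
      unfolding N_def k_def x_def diff_Suc_1 by (simp add: sum_list_sum_nth atLeast0LessThan)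
    also have "\<dots> = \<pi> i m" using ps(4)[OF im(2), of i] vs[OF im] by simp
    finally show "(\<Sum>n\<in>{n \<in> {1..N}. k n = i}. x n ^ m) = \<pi> i m" .
  qed
qed

section \<open>Logarithmic derivatives of power series\<close>

text \<open>The equation t F'(t) / F(t) = \<Sum> \<kappa>(m) t^m, summed over m \<ge> 1, with F(0) =
  1. Products of series become sums of the functions \<kappa>.\<close>

definition has_dlog :: "complex fps \<Rightarrow> (nat \<Rightarrow> complex) \<Rightarrow> bool" where
  "has_dlog F \<kappa> \<longleftrightarrow> fps_nth F 0 = 1 \<and> fps_deriv F = F * Abs_fps (\<lambda>n. \<kappa> (Suc n))"

lemma has_dlog_nth:
  assumes "has_dlog F \<kappa>"
  shows "of_nat n * fps_nth F n = (\<Sum>k\<in>{1..n}. \<kappa> k * fps_nth F (n - k))"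
proof (cases n)
  case (Suc m)
  have "of_nat n * fps_nth F n = fps_nth (fps_deriv F) m"
    using Suc by simp
  also have "\<dots> = (\<Sum>i=0..m. \<kappa> (Suc i) * fps_nth F (m - i))"
    using assms by (simp add: has_dlog_def fps_mult_nth mult.commute[of F])
  also have "\<dots> = (\<Sum>k\<in>{1..n}. \<kappa> k * fps_nth F (n - k))"
    by (rule sum.reindex_bij_witness[of _ "\<lambda>k. k - 1" Suc]) (auto simp: Suc)
  finally show ?thesis .
qed simp

lemma has_dlogI:
  assumes "fps_nth F 0 = 1" "\<And>n. of_nat n * fps_nth F n = (\<Sum>k\<in>{1..n}. \<kappa> k * fps_nth F (n - k))"
  shows "has_dlog F \<kappa>"
  unfolding has_dlog_def
proof (intro conjI fps_ext)
  fix m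
  have "fps_nth (fps_deriv F) m = (\<Sum>k\<in>{1..Suc m}. \<kappa> k * fps_nth F (Suc m - k))"
    using assms(2)[of "Suc m"] by simp
  also have "\<dots> = (\<Sum>i=0..m. \<kappa> (Suc i) * fps_nth F (m - i))"
    by (rule sum.reindex_bij_witness[of _ Suc "\<lambda>k. k - 1"]) auto
  finally show "fps_nth (fps_deriv F) m = fps_nth (F * Abs_fps (\<lambda>n. \<kappa> (Suc n))) m"
    by (simp add: fps_mult_nth mult.commute[of F])
qed (fact assms)

text \<open>The recursion for the coefficient of order n involves \<kappa> only up to n. The
  comparison stops at l because the power sums of the points y are controlled only up to l.\<close>

lemma has_dlog_unique_upto:
  assumes F: "has_dlog F \<kappa>" and G: "has_dlog G \<mu>" and eq: "\<And>m. m \<in> {1..l} \<Longrightarrow> \<kappa> m = \<mu> m"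
  shows "n \<le> l \<Longrightarrow> fps_nth F n = fps_nth G n"
proof (induction n rule: less_induct)
  case (less n)
  show ?case
  proof (cases "n = 0")
    case True
    then show ?thesis using F G by (simp add: has_dlog_def)
  next
    case False
    have "of_nat n * fps_nth F n = of_nat n * fps_nth G n"
      unfolding has_dlog_nth[OF F] has_dlog_nth[OF G] using less eq by (intro sum.cong) auto
    then show ?thesis using False by simp
  qed
qed

lemma has_dlog_1: "has_dlog 1 (\<lambda>n. 0)"
  by (simp add: has_dlog_def fps_eq_iff fps_mult_nth)

lemma has_dlog_mult:
  assumes "has_dlog F \<kappa>" "has_dlog G \<mu>"
  shows "has_dlog (F * G) (\<lambda>n. \<kappa> n + \<mu> n)"
proof -
  have "Abs_fps (\<lambda>n. \<kappa> (Suc n) + \<mu> (Suc n)) = Abs_fps (\<lambda>n. \<kappa> (Suc n)) + Abs_fps (\<lambda>n. \<mu> (Suc n))"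
    by (simp add: fps_eq_iff)
  then show ?thesis using assms by (simp add: has_dlog_def algebra_simps)
qed

lemma has_dlog_prod:
  "(\<And>x. x \<in> A \<Longrightarrow> has_dlog (F x) (\<kappa> x)) \<Longrightarrow> has_dlog (\<Prod>x\<in>A. F x) (\<lambda>n. \<Sum>x\<in>A. \<kappa> x n)"
proof (induction A rule: infinite_finite_induct)
  case (insert x A)
  then show ?case using has_dlog_mult[of "F x" "\<kappa> x"] by auto
qed (auto simp: has_dlog_1)

lemma has_dlog_inverse:
  assumes "has_dlog F \<kappa>"
  shows "has_dlog (inverse F) (\<lambda>n. - \<kappa> n)"
proof -
  have F: "fps_nth F 0 = 1" "fps_deriv F = F * Abs_fps (\<lambda>n. \<kappa> (Suc n))"
    using assms by (auto simp: has_dlog_def)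
  have "Abs_fps (\<lambda>n. - \<kappa> (Suc n)) = - Abs_fps (\<lambda>n. \<kappa> (Suc n))" by (simp add: fps_eq_iff)
  moreover have "inverse F * F = 1" using F by (intro inverse_mult_eq_1) auto
  moreover have "fps_deriv (inverse F) = - (F * Abs_fps (\<lambda>n. \<kappa> (Suc n))) * (inverse F)\<^sup>2"
    using fps_inverse_deriv[of F] F by simp
  ultimately show ?thesis
    using F(1) by (simp add: has_dlog_def power2_eq_square mult_ac)
qed

lemma has_dlog_linear: "has_dlog (1 - fps_const r * fps_X) (\<lambda>n. - (r ^ n))"
  unfolding has_dlog_def
proof (intro conjI fps_ext)
  fix n
  show "fps_nth (fps_deriv (1 - fps_const r * fps_X)) n =
      fps_nth ((1 - fps_const r * fps_X) * Abs_fps (\<lambda>n. - (r ^ Suc n))) n"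
    by (cases n) (simp_all add: algebra_simps)
qed simp

lemma has_dlog_exists: "\<exists>F. has_dlog F \<kappa>"
proof
  let ?I = "fps_integral0 (Abs_fps (\<lambda>n. \<kappa> (Suc n)))"
  show "has_dlog (fps_exp 1 oo ?I) \<kappa>"
    by (simp add: has_dlog_def fps_compose_deriv fps_deriv_fps_integral)
qed

lemma has_dlog_hx: "has_dlog (Abs_fps (\<lambda>n. hx n w)) (\<lambda>m. of_nat m * (\<Sum>i\<in>UNIV. w (i, m - 1)))"
proof (rule has_dlogI)
  have "(monoms 0 :: 'a monomial set) = {0}"
  proof (intro set_eqI iffI)
    fix m :: "'a monomial" assume m: "m \<in> monoms 0"
    have "g \<notin> keys m" for g using keys_mdegree[of g m] m by (auto simp: monoms_def)
    then have "m = 0" by (intro poly_mapping_eqI) (simp add: in_keys_iff)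
    then show "m \<in> {0}" by simp
  qed (simp add: monoms_def)
  then show "fps_nth (Abs_fps (\<lambda>n. hx n w)) 0 = 1" by (simp add: hx_def mexp_def)
  show "of_nat n * fps_nth (Abs_fps (\<lambda>n. hx n w)) n =
      (\<Sum>k\<in>{1..n}. of_nat k * (\<Sum>i\<in>UNIV. w (i, k - 1)) * fps_nth (Abs_fps (\<lambda>n. hx n w)) (n - k))" for n
    using hx_recursion[of n w] by simp
qed

text \<open>Summation by parts in t. The left side is the interaction of two groups of sites of
  order m with z = \<omega>^m. On the right the differences P(i) - z P(i+1) are, by
  \<open>ev_eq\<close>, multiples of evaluations of generators, and the sum of P is independent of
  the labels; QQ(L) P(L) is the remainder to be disposed of.\<close>

lemma pairing_identity:
  fixes P Q :: "nat \<Rightarrow> complex"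
  assumes L: "L \<ge> 1" and QQ: "\<And>i. QQ i = (\<Sum>t\<in>{1..i}. Q t)"
  shows "(\<Sum>s\<in>{1..L}. \<Sum>t\<in>{1..L}. if s = t then 0 else (if s < t then 1 else z) * (P s * Q t)) =
    QQ L * (\<Sum>s\<in>{1..L}. P s) - QQ L * P L - (\<Sum>i\<in>{1..L - 1}. QQ i * (P i - z * P (Suc i)))"
proof -
  have "(\<Sum>t\<in>{1..L}. if s = t then 0 else (if s < t then 1 else z) * (P s * Q t)) =
      P s * (QQ L - QQ s + z * QQ (s - 1))" if s: "s \<in> {1..L}" for s
  proof -
    have eq: "{1..L} = {1..s - 1} \<union> insert s {s<..L}" using s by auto
    have "(\<Sum>t\<in>{1..L}. h t) = (\<Sum>t\<in>{1..s-1}. h t) + h s + (\<Sum>t\<in>{s<..L}. h t)" for h :: "nat \<Rightarrow> complex"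
      unfolding eq by (subst sum.union_disjoint) (use s in \<open>auto simp: add.assoc\<close>)
    note split = this
    have QL: "QQ L = QQ (s - 1) + Q s + (\<Sum>t\<in>{s<..L}. Q t)" using split[of Q] by (simp add: QQ)
    have Qs: "QQ s = QQ (s - 1) + Q s"
      using s by (cases s) (simp_all add: QQ)
    have "(\<Sum>t\<in>{1..L}. if s = t then 0 else (if s < t then 1 else z) * (P s * Q t)) =
        z * P s * QQ (s - 1) + P s * (\<Sum>t\<in>{s<..L}. Q t)"
      unfolding split using s by (simp add: QQ sum_distrib_left mult.assoc cong: sum.cong)
        (intro arg_cong2[where f = "(+)"] sum.cong, auto)
    then show ?thesis unfolding QL Qs by (simp add: algebra_simps)
  qed
  then have "(\<Sum>s\<in>{1..L}. \<Sum>t\<in>{1..L}. if s = t then 0 else (if s < t then 1 else z) * (P s * Q t)) =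
      (\<Sum>s\<in>{1..L}. P s * (QQ L - QQ s + z * QQ (s - 1)))" by (rule sum.cong[OF refl])
  also have "\<dots> = QQ L * (\<Sum>s\<in>{1..L}. P s) - (\<Sum>s\<in>{1..L}. P s * QQ s) + z * (\<Sum>s\<in>{1..L}. P s * QQ (s - 1))"
    by (simp add: sum.distrib sum_subtractf sum_distrib_left algebra_simps)
  also have "(\<Sum>s\<in>{1..L}. P s * QQ s) = QQ L * P L + (\<Sum>i\<in>{1..L - 1}. QQ i * P i)"
    using L by (cases L) (simp_all add: mult.commute)
  also have "(\<Sum>s\<in>{1..L}. P s * QQ (s - 1)) = (\<Sum>i\<in>{1..L - 1}. QQ i * P (Suc i))"
  proof -
    have "(\<Sum>s\<in>{1..L}. P s * QQ (s - 1)) = (\<Sum>s\<in>{2..L}. P s * QQ (s - 1))"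
      by (rule sum.mono_neutral_right) (auto simp: QQ le_Suc_eq not_le)
    also have "\<dots> = (\<Sum>i\<in>{1..L - 1}. QQ i * P (Suc i))"
      by (rule sum.reindex_bij_witness[of _ Suc "\<lambda>s. s - 1"]) auto
    finally show ?thesis .
  qed
  finally show ?thesis by (simp add: algebra_simps sum_subtractf sum_distrib_left)
qed

text \<open>For z = 1 this expresses P(L) by the sum of P and the differences, so that the remainder
  in \<open>pairing_identity\<close> can be absorbed.\<close>

lemma telescope_weighted:
  fixes P :: "nat \<Rightarrow> complex"
  assumes "L \<ge> 1"
  shows "(\<Sum>i\<in>{1..L - 1}. of_nat i * (P i - P (Suc i))) = (\<Sum>s\<in>{1..L}. P s) - of_nat L * P L"
  using assms
proof (induction L rule: nat_induct_at_least)
  case (Suc n)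
  have "(\<Sum>i\<in>{1..Suc n - 1}. of_nat i * (P i - P (Suc i))) =
      (\<Sum>i\<in>{1..n - 1}. of_nat i * (P i - P (Suc i))) + of_nat n * (P n - P (Suc n))"
    using Suc.hyps by (cases n) simp_all
  then show ?case using Suc.IH by (simp add: algebra_simps)
qed simp

section \<open>The expansion of f at 0 and its logarithmic derivative\<close>

context toda
begin

text \<open>\<open>z f'(z) / f(z) = \<Sum>\<^sub>m cm m z\<^sup>m\<close>; irrationality of \<open>p\<close> makes all \<open>cm m\<close> nonzero.\<close>

definition cm :: "nat \<Rightarrow> complex" where
  "cm m = 1 + om (- of_nat m) - om (- of_nat m * of_real p) - om (- of_nat m * (1 - of_real p))"

lemma cm_eq: "cm m = (1 - om (- of_nat m * of_real p)) * (1 - om (- of_nat m * (1 - of_real p)))"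
  by (simp add: cm_def algebra_simps omega_pow_add[symmetric])

lemma om_irrational:
  assumes "m > 0"
  shows "om (of_nat m * of_real p) \<noteq> 1"
proof
  assume "om (of_nat m * of_real p) = 1"
  then have *: "om (of_real (of_nat m * p)) = 1" by simp
  have "L > 0" using L2 by simp
  from *[unfolded omega_pow_eq_1_iff[OF this]] obtain k :: int where "of_nat m * p = of_int k * of_nat L"
    by blast
  then have "p = of_int k * of_nat L / of_nat m" using assms by (simp add: field_simps)
  also have "\<dots> \<in> \<rat>" by (intro Rats_divide Rats_mult) auto
  finally show False using p_irrat by simp
qed

lemma cm_nonzero:
  assumes "m > 0"
  shows "cm m \<noteq> 0"
proof -
  have "om (- of_nat m * of_real p) \<noteq> 1"
    using om_irrational[OF assms] omega_pow_minus[of L "of_nat m * of_real p"] by simp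
  moreover have "om (- of_nat m * (1 - of_real p)) \<noteq> 1"
  proof
    assume "om (- of_nat m * (1 - of_real p)) = 1"
    then have "om (of_nat m * of_real p) = om (of_nat m)"
      by (simp add: algebra_simps omega_pow_diff)
    \<comment> \<open>The L-th power removes the root of unity and leads back to
      \<open>om_irrational\<close> with L * m in place of m.\<close>
    then have "om (of_nat m * of_real p) ^ L = om (of_nat m) ^ L" by simp
    also have "\<dots> = 1"
      unfolding omega_pow_power using omega_pow_of_nat_eq_1_iff[of L "L * m"] L2 by simp
    finally have "om (of_nat (L * m) * of_real p) = 1"
      by (simp add: omega_pow_power mult.assoc)
    then show False using om_irrational[of "L * m"] assms L2 by simp
  qed
  ultimately show ?thesis by (simp add: cm_eq)
qed

text \<open>The Taylor series of f(c z) at z = 0. Every linear factor is normalized to constant term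
  1; the normalizing constants cancel because the zeros and the poles of f have the same product
  \<omega>.\<close>

definition FF :: "complex \<Rightarrow> complex fps" where
  "FF c = (1 - fps_const (c * om (- of_real p)) * fps_X) * (1 - fps_const (c * om (- (1 - of_real p))) * fps_X) *
     (inverse (1 - fps_const c * fps_X) * inverse (1 - fps_const (c * om (-1)) * fps_X))"

lemma FF_dlog: "has_dlog (FF c) (\<lambda>m. cm m * c ^ m)"
proof -
  have "has_dlog (FF c) (\<lambda>m. (- ((c * om (- of_real p)) ^ m) + - ((c * om (- (1 - of_real p))) ^ m)) +
      (- (- (c ^ m)) + - (- ((c * om (-1)) ^ m))))"
    unfolding FF_def by (intro has_dlog_mult has_dlog_inverse has_dlog_linear)
  also have "(\<lambda>m. (- ((c * om (- of_real p)) ^ m) + - ((c * om (- (1 - of_real p))) ^ m)) +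
      (- (- (c ^ m)) + - (- ((c * om (-1)) ^ m)))) = (\<lambda>m. cm m * c ^ m)"
    by (rule ext) (simp add: cm_def power_mult_distrib omega_pow_power algebra_simps)
  finally show ?thesis .
qed

lemma FF_expansion: "(\<lambda>z. ff (z * c)) has_fps_expansion FF c"
proof -
  have lin: "(\<lambda>z. 1 - r * z) has_fps_expansion (1 - fps_const r * fps_X)" for r :: complex
    by (intro fps_expansion_intros)
  have "(\<lambda>z. (1 - (c * om (- of_real p)) * z) * (1 - (c * om (- (1 - of_real p))) * z) *
     (inverse (1 - c * z) * inverse (1 - (c * om (-1)) * z))) has_fps_expansion FF c"
    unfolding FF_def
    by (intro has_fps_expansion_mult has_fps_expansion_inverse lin) simp_all
  also have "(\<lambda>z. (1 - (c * om (- of_real p)) * z) * (1 - (c * om (- (1 - of_real p))) * z) *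
     (inverse (1 - c * z) * inverse (1 - (c * om (-1)) * z))) = (\<lambda>z. ff (z * c))"
  proof
    fix z
    define a b w where "a = om (of_real p)" and "b = om (1 - of_real p)" and "w = om 1"
    have ab: "a * b = w" "a \<noteq> 0" "b \<noteq> 0" "w \<noteq> 0"
      using om_p_prod by (auto simp: a_def b_def w_def)
    have "1 - (c * inverse r) * z = (z * c - r) * (- inverse r)" if "r \<noteq> 0" for r
      using that by (simp add: field_simps)
    note * = this[OF ab(2)] this[OF ab(3)] this[OF ab(4)]
    have "inverse a * inverse b = inverse w" unfolding ab(1)[symmetric] by simp
    then have "(1 - (c * inverse a) * z) * (1 - (c * inverse b) * z) *
      (inverse (1 - c * z) * inverse (1 - (c * inverse w) * z)) =
      inverse w * ((z * c - a) * (z * c - b)) * (inverse (1 - z * c) * inverse ((z * c - w) * (- inverse w)))"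
      unfolding * by (simp add: mult_ac)
    also have "inverse (1 - z * c) = - inverse (z * c - 1)"
      by (metis inverse_minus_eq minus_diff_eq)
    also have "inverse w * ((z * c - a) * (z * c - b)) * (- inverse (z * c - 1) * inverse ((z * c - w) * (- inverse w))) =
        (z * c - a) * (z * c - b) / ((z * c - 1) * (z * c - w))"
      using ab by (simp add: divide_inverse mult_ac)
    finally show "(1 - (c * om (- of_real p)) * z) * (1 - (c * om (- (1 - of_real p))) * z) *
      (inverse (1 - c * z) * inverse (1 - (c * om (-1)) * z)) = ff (z * c)"
      by (simp only: omega_pow_minus f_fun_def a_def b_def w_def)
  qed
  finally show ?thesis .
qed

end

section \<open>Two separated groups of points\<close>

lemma prod_split_at:
  fixes h :: "nat \<Rightarrow> 'b::comm_monoid_mult"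
  shows "(\<Prod>n\<in>{1..M + N}. h n) = (\<Prod>n\<in>{1..M}. h n) * (\<Prod>n\<in>{1..N}. h (M + n))"
    and "n \<ge> 1 \<Longrightarrow> (\<Prod>m\<in>{1..<M + n}. h m) = (\<Prod>m\<in>{1..M}. h m) * (\<Prod>m\<in>{1..<n}. h (M + m))"
proof -
  have r: "(\<Prod>n\<in>(\<lambda>n. M + n) ` A. h n) = (\<Prod>n\<in>A. h (M + n))" for A
    by (subst prod.reindex) auto
  have "{1..M + N} = {1..M} \<union> (\<lambda>n. M + n) ` {1..N}" by auto
  then have "(\<Prod>n\<in>{1..M + N}. h n) = (\<Prod>n\<in>{1..M}. h n) * (\<Prod>n\<in>(\<lambda>n. M + n) ` {1..N}. h n)"
    by (simp only:) (rule prod.union_disjoint, auto)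
  then show "(\<Prod>n\<in>{1..M + N}. h n) = (\<Prod>n\<in>{1..M}. h n) * (\<Prod>n\<in>{1..N}. h (M + n))"
    by (simp only: r)
  assume "n \<ge> 1"
  have "m \<in> {1..M} \<or> m \<in> (\<lambda>n. M + n) ` {1..<n}" if "m \<in> {1..<M + n}" for m
    using that by (cases "m \<le> M") (auto intro!: image_eqI[of _ _ "m - M"])
  then have "{1..<M + n} = {1..M} \<union> (\<lambda>n. M + n) ` {1..<n}"
    using \<open>n \<ge> 1\<close> by auto
  then have "(\<Prod>n\<in>{1..<M + n}. h n) = (\<Prod>n\<in>{1..M}. h n) * (\<Prod>n\<in>(\<lambda>n. M + n) ` {1..<n}. h n)"
    by (simp only:) (rule prod.union_disjoint, auto)
  then show "(\<Prod>m\<in>{1..<M + n}. h m) = (\<Prod>m\<in>{1..M}. h m) * (\<Prod>m\<in>{1..<n}. h (M + m))"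
    by (simp only: r)
qed

lemma sum_swap4:
  "(\<Sum>n\<in>A. \<Sum>m\<in>B. \<Sum>s\<in>C. \<Sum>t\<in>D. a s t * (u m s * v n t)) =
   (\<Sum>s\<in>C. \<Sum>t\<in>D. a s t * ((\<Sum>m\<in>B. u m s) * (\<Sum>n\<in>A. v n t :: complex)))"
proof -
  have "(\<Sum>s\<in>C. \<Sum>t\<in>D. a s t * ((\<Sum>m\<in>B. u m s) * (\<Sum>n\<in>A. v n t))) =
      (\<Sum>s\<in>C. \<Sum>t\<in>D. \<Sum>m\<in>B. \<Sum>n\<in>A. a s t * (u m s * v n t))"
    by (simp only: sum_product) (simp add: sum_distrib_left)
  also have "\<dots> = (\<Sum>s\<in>C. \<Sum>m\<in>B. \<Sum>t\<in>D. \<Sum>n\<in>A. a s t * (u m s * v n t))"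
    by (intro sum.cong refl sum.swap)
  also have "\<dots> = (\<Sum>s\<in>C. \<Sum>m\<in>B. \<Sum>n\<in>A. \<Sum>t\<in>D. a s t * (u m s * v n t))"
    by (intro sum.cong refl sum.swap)
  also have "\<dots> = (\<Sum>m\<in>B. \<Sum>s\<in>C. \<Sum>n\<in>A. \<Sum>t\<in>D. a s t * (u m s * v n t))"
    by (rule sum.swap)
  also have "\<dots> = (\<Sum>m\<in>B. \<Sum>n\<in>A. \<Sum>s\<in>C. \<Sum>t\<in>D. a s t * (u m s * v n t))"
    by (intro sum.cong refl sum.swap)
  also have "\<dots> = (\<Sum>n\<in>A. \<Sum>m\<in>B. \<Sum>s\<in>C. \<Sum>t\<in>D. a s t * (u m s * v n t))"
    by (rule sum.swap)
  finally show ?thesis by simp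
qed

lemma sum_node:
  fixes h :: "nat \<Rightarrow> 'b::comm_monoid_add"
  assumes "CARD('i::finite) = L - 1"
  shows "(\<Sum>i\<in>(UNIV :: 'i set). h (node i)) = (\<Sum>j\<in>{1..L - 1}. h j)"
  using sum.reindex_bij_betw[OF bij_betw_node[where 'i = 'i], of h] assms by simp

definition join :: "nat \<Rightarrow> nat \<Rightarrow> (nat \<Rightarrow> 'a) \<Rightarrow> (nat \<Rightarrow> 'a) \<Rightarrow> nat \<Rightarrow> 'a" where
  "join M N S T = (\<lambda>n. if n \<in> {1..M} then S n else if n \<in> {M + 1..M + N} then T (n - M) else undefined)"

lemma join_1: "n \<in> {1..M} \<Longrightarrow> join M N S T n = S n"
  and join_2: "n \<in> {1..N} \<Longrightarrow> join M N S T (M + n) = T n"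
  by (auto simp: join_def)

lemma bij_betw_join:
  "bij_betw (\<lambda>(S,T). join M N S T) (configs L M k \<times> configs L N k') (configs L (M + N) (join M N k k'))"
proof (rule bij_betw_byWitness[where f' = "\<lambda>U. (restrict U {1..M}, \<lambda>n\<in>{1..N}. U (M + n))"])
  show "\<forall>a\<in>configs L M k \<times> configs L N k'. (\<lambda>U. (restrict U {1..M}, \<lambda>n\<in>{1..N}. U (M + n))) ((\<lambda>(S,T). join M N S T) a) = a"
    by (auto simp: configs_def join_def PiE_iff extensional_def restrict_def fun_eq_iff)
  show "\<forall>a\<in>configs L (M + N) (join M N k k'). (\<lambda>(S,T). join M N S T) ((\<lambda>U. (restrict U {1..M}, \<lambda>n\<in>{1..N}. U (M + n))) a) = a"
    by (auto simp: configs_def join_def PiE_iff extensional_def restrict_def fun_eq_iff)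
  show "(\<lambda>(S,T). join M N S T) ` (configs L M k \<times> configs L N k') \<subseteq> configs L (M + N) (join M N k k')"
  proof safe
    fix S T assume S: "S \<in> configs L M k" and T: "T \<in> configs L N k'"
    show "join M N S T \<in> configs L (M + N) (join M N k k')"
      unfolding configs_def
    proof (rule PiE_I)
      fix n assume "n \<in> {1..M + N}"
      show "join M N S T n \<in> {U. U \<subseteq> {1..L} \<and> card U = join M N k k' n}"
      proof (cases "n \<le> M")
        case True
        then have n: "n \<in> {1..M}" using \<open>n \<in> {1..M + N}\<close> by auto
        show ?thesis unfolding join_1[OF n] using configsD[OF S n] by simp
      next
        case False
        then have n: "n - M \<in> {1..N}" "n = M + (n - M)" using \<open>n \<in> {1..M + N}\<close> by auto
        have "join M N S T (M + (n - M)) = T (n - M)" "join M N k k' (M + (n - M)) = k' (n - M)"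
          by (rule join_2[OF n(1)])+
        then show ?thesis using n(2) configsD[OF T n(1)] by simp
      qed
    qed (auto simp: join_def)
  qed
  show "(\<lambda>U. (restrict U {1..M}, \<lambda>n\<in>{1..N}. U (M + n))) ` configs L (M + N) (join M N k k') \<subseteq> configs L M k \<times> configs L N k'"
  proof safe
    fix U assume U: "U \<in> configs L (M + N) (join M N k k')"
    have "U n \<subseteq> {1..L} \<and> card (U n) = k n" if "n \<in> {1..M}" for n
      using configsD[OF U, of n] that by (simp add: join_def)
    then show "restrict U {1..M} \<in> configs L M k" by (auto simp: configs_def)
    have "U (M + n) \<subseteq> {1..L} \<and> card (U (M + n)) = k' n" if "n \<in> {1..N}" for n
      using configsD[OF U, of "M + n"] that by (simp add: join_def)
    then show "(\<lambda>n\<in>{1..N}. U (M + n)) \<in> configs L N k'" by (auto simp: configs_def)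
  qed
qed

context toda
begin

lemma y_at_scale: "y_at L T (c * v) s = c * y_at L T v s"
  by (simp add: y_at_def y_var_def)

lemma Psi_scale: "c \<noteq> 0 \<Longrightarrow> Psi T (c * v) T' (c * v') = Psi T v T' v'"
  by (simp add: Psi_def pf_def y_at_scale cong: if_cong)

text \<open>The argument of f for a site of the first group and a site of the second. For s > t
  crossing has replaced y / x by \<omega> x / y, so that after scaling x by \<epsilon> all factors
  are regular at \<epsilon> = 0.\<close>

definition coupling :: "nat set \<Rightarrow> complex \<Rightarrow> nat set \<Rightarrow> complex \<Rightarrow> nat \<Rightarrow> nat \<Rightarrow> complex" where
  "coupling S v T v' s t = (if s < t then 1 else om 1) * (y_at L S v s * inverse (y_at L T v' t))"

definition cross :: "nat \<Rightarrow> nat \<Rightarrow> (nat \<Rightarrow> nat set) \<Rightarrow> (nat \<Rightarrow> nat set) \<Rightarrow> (nat \<Rightarrow> complex) \<Rightarrow> (nat \<Rightarrow> complex) \<Rightarrow> complex \<Rightarrow> complex" where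
  "cross M N S T x y \<epsilon> = (\<Prod>n\<in>{1..N}. \<Prod>m\<in>{1..M}. \<Prod>s\<in>S m. \<Prod>t\<in>T n.
     if s = t then 1 else ff (\<epsilon> * coupling (S m) (x m) (T n) (y n) s t))"

lemma Psi_cross:
  assumes "\<epsilon> \<noteq> 0" "v \<noteq> 0" "v' \<noteq> 0"
  shows "Psi S (\<epsilon> * v) T v' = (\<Prod>s\<in>S. \<Prod>t\<in>T. if s = t then 1 else ff (\<epsilon> * coupling S v T v' s t))"
  unfolding Psi_def
proof (intro prod.cong refl)
  fix s t
  have nz: "y_at L S v s \<noteq> 0" "y_at L T v' t \<noteq> 0" using assms by (simp_all add: y_at_nonzero)
  have "ff (y_at L T v' t / (\<epsilon> * y_at L S v s)) = ff (om 1 * (\<epsilon> * y_at L S v s) / y_at L T v' t)"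
    using nz assms(1) by (intro ff_crossing_div) auto
  then show "pf s t (y_at L S (\<epsilon> * v) s) (y_at L T v' t) =
      (if s = t then 1 else ff (\<epsilon> * coupling S v T v' s t))"
    by (auto simp: pf_def y_at_scale coupling_def divide_inverse mult_ac)
qed

lemma Phi_join:
  assumes "\<epsilon> \<noteq> 0" "\<And>n. n \<in> {1..M} \<Longrightarrow> x n \<noteq> 0" "\<And>n. n \<in> {1..N} \<Longrightarrow> y n \<noteq> 0"
  shows "Phi L p (M + N) (join M N S T) (join M N (\<lambda>n. \<epsilon> * x n) y) =
    Phi L p M S x * Phi L p N T y * cross M N S T x y \<epsilon>"
proof -
  let ?U = "join M N S T" and ?z = "join M N (\<lambda>n. \<epsilon> * x n) y"
  let ?P = "\<lambda>m n. Psi (?U m) (?z m) (?U n) (?z n)"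
  have "Phi L p (M + N) ?U ?z = (\<Prod>n\<in>{1..M}. \<Prod>m\<in>{1..<n}. ?P m n) * (\<Prod>n\<in>{1..N}. \<Prod>m\<in>{1..<M + n}. ?P m (M + n))"
    unfolding Phi_eq by (rule prod_split_at)
  also have "(\<Prod>n\<in>{1..M}. \<Prod>m\<in>{1..<n}. ?P m n) = Phi L p M S x"
    unfolding Phi_eq
  proof (intro prod.cong refl)
    fix n m assume "n \<in> {1..M}" "m \<in> {1..<n}"
    then have "n \<in> {1..M}" "m \<in> {1..M}" by auto
    then show "?P m n = Psi (S m) (x m) (S n) (x n)"
      using Psi_scale[OF assms(1)] by (simp only: join_1)
  qed
  also have "(\<Prod>n\<in>{1..N}. \<Prod>m\<in>{1..<M + n}. ?P m (M + n)) =
      (\<Prod>n\<in>{1..N}. (\<Prod>m\<in>{1..M}. ?P m (M + n)) * (\<Prod>m\<in>{1..<n}. ?P (M + m) (M + n)))"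
    by (intro prod.cong refl prod_split_at(2)) auto
  also have "\<dots> = cross M N S T x y \<epsilon> * Phi L p N T y"
    unfolding prod.distrib
  proof (rule arg_cong2[where f = "(*)"])
    show "(\<Prod>n\<in>{1..N}. \<Prod>m\<in>{1..M}. ?P m (M + n)) = cross M N S T x y \<epsilon>"
      unfolding cross_def
    proof (intro prod.cong refl)
      fix n m assume nm: "n \<in> {1..N}" "m \<in> {1..M}"
      have "Psi (S m) (\<epsilon> * x m) (T n) (y n) =
          (\<Prod>s\<in>S m. \<Prod>t\<in>T n. if s = t then 1 else ff (\<epsilon> * coupling (S m) (x m) (T n) (y n) s t))"
        using nm assms by (intro Psi_cross) auto
      then show "?P m (M + n) =
          (\<Prod>s\<in>S m. \<Prod>t\<in>T n. if s = t then 1 else ff (\<epsilon> * coupling (S m) (x m) (T n) (y n) s t))"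
        using nm by (simp only: join_1 join_2)
    qed
    show "(\<Prod>n\<in>{1..N}. \<Prod>m\<in>{1..<n}. ?P (M + m) (M + n)) = Phi L p N T y"
      unfolding Phi_eq
    proof (intro prod.cong refl)
      fix n m assume "n \<in> {1..N}" "m \<in> {1..<n}"
      then have "n \<in> {1..N}" "m \<in> {1..N}" by auto
      then show "?P (M + m) (M + n) = Psi (T m) (y m) (T n) (y n)"
        by (simp only: join_2)
    qed
  qed
  finally show ?thesis by (simp add: mult_ac)
qed

definition chi :: "(nat \<Rightarrow> complex) \<Rightarrow> nat \<Rightarrow> (nat \<Rightarrow> nat set) \<Rightarrow> complex" where
  "chi \<zeta> N S = (\<Prod>n\<in>{1..N}. \<Prod>s\<in>S n. \<zeta> s)"

lemma chi_join: "chi \<zeta> (M + N) (join M N S T) = chi \<zeta> M S * chi \<zeta> N T"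
  unfolding chi_def prod_split_at by (intro arg_cong2[where f = "(*)"] prod.cong) (auto simp: join_def)

lemma JZ_eq: "JZ N k \<zeta> x = (\<Sum>S\<in>configs L N k. chi \<zeta> N S * Phi L p N S x)"
  by (simp add: JZ_def chi_def)

lemma JZ_join:
  assumes "\<epsilon> \<noteq> 0" "\<And>n. n \<in> {1..M} \<Longrightarrow> x n \<noteq> 0" "\<And>n. n \<in> {1..N} \<Longrightarrow> y n \<noteq> 0"
  shows "JZ (M + N) (join M N k k') \<zeta> (join M N (\<lambda>n. \<epsilon> * x n) y) =
    (\<Sum>S\<in>configs L M k. \<Sum>T\<in>configs L N k'.
       (chi \<zeta> M S * Phi L p M S x * (chi \<zeta> N T * Phi L p N T y)) * cross M N S T x y \<epsilon>)"
proof -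
  have "JZ (M + N) (join M N k k') \<zeta> (join M N (\<lambda>n. \<epsilon> * x n) y) =
      (\<Sum>ST\<in>configs L M k \<times> configs L N k'. chi \<zeta> (M + N) (case ST of (S, T) \<Rightarrow> join M N S T) *
         Phi L p (M + N) (case ST of (S, T) \<Rightarrow> join M N S T) (join M N (\<lambda>n. \<epsilon> * x n) y))"
    unfolding JZ_eq by (rule sum.reindex_bij_betw[OF bij_betw_join, symmetric])
  also have "\<dots> = (\<Sum>(S,T)\<in>configs L M k \<times> configs L N k'.
       (chi \<zeta> M S * Phi L p M S x * (chi \<zeta> N T * Phi L p N T y)) * cross M N S T x y \<epsilon>)"
  proof (intro sum.cong refl)
    fix ST assume "ST \<in> configs L M k \<times> configs L N k'"
    obtain S T where ST: "ST = (S, T)" by (cases ST)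
    show "chi \<zeta> (M + N) (case ST of (S, T) \<Rightarrow> join M N S T) *
         Phi L p (M + N) (case ST of (S, T) \<Rightarrow> join M N S T) (join M N (\<lambda>n. \<epsilon> * x n) y) =
       (case ST of (S, T) \<Rightarrow>
         (chi \<zeta> M S * Phi L p M S x * (chi \<zeta> N T * Phi L p N T y)) * cross M N S T x y \<epsilon>)"
    proof -
      have "Phi L p (M + N) (join M N S T) (join M N (\<lambda>n. \<epsilon> * x n) y) =
          Phi L p M S x * Phi L p N T y * cross M N S T x y \<epsilon>"
        by (rule Phi_join) (use assms in auto)
      then show ?thesis by (simp only: ST prod.case chi_join mult_ac)
    qed
  qed
  finally show ?thesis by (simp add: sum.cartesian_product)
qed

lemma y_var_scale: "y_var L k (c * v) j = c * y_var L k v j"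
  by (simp add: y_var_def)

lemma no_polesD:
  assumes "no_poles L N k x" "m \<in> {1..N}" "n \<in> {1..N}" "m \<noteq> n" "j \<in> {1..k m}" "j' \<in> {1..k n}"
  shows "y_var L (k m) (x m) j / y_var L (k n) (x n) j' \<notin> {1, om 1}"
proof -
  have "\<forall>j\<in>{1..k m}. \<forall>j'\<in>{1..k n}. y_var L (k m) (x m) j / y_var L (k n) (x n) j' \<notin> {1, om 1}"
    using assms(1-4) unfolding no_poles_def by blast
  from bspec[OF bspec[OF this assms(5)] assms(6)] show ?thesis .
qed

text \<open>Ratios within a group do not depend on \<epsilon>, while mixed ratios are proportional
  to \<epsilon> or its inverse and avoid finitely many nonzero values when \<epsilon> is
  small.\<close>

lemma no_poles_join:
  assumes X: "no_poles L M k x" and Y: "no_poles L N k' y"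
  shows "eventually (\<lambda>\<epsilon>. no_poles L (M + N) (join M N k k') (join M N (\<lambda>n. \<epsilon> * x n) y)) (at 0)"
proof -
  have x: "x n \<noteq> 0" if "n \<in> {1..M}" for n using X that by (auto simp: no_poles_def)
  have y: "y n \<noteq> 0" if "n \<in> {1..N}" for n using Y that by (auto simp: no_poles_def)
  have ev: "eventually (\<lambda>\<epsilon>. \<epsilon> * c \<noteq> b) (at 0)" if "b \<noteq> 0" for b c :: complex
  proof -
    have "((\<lambda>\<epsilon>. \<epsilon> * c) \<longlongrightarrow> 0 * c) (at 0)" by (intro tendsto_intros)
    then show ?thesis using that by (intro tendsto_imp_eventually_ne) auto
  qed
  have "eventually (\<lambda>\<epsilon>. \<forall>m\<in>{1..M}. \<forall>n\<in>{1..N}. \<forall>j\<in>{1..k m}. \<forall>j'\<in>{1..k' n}. \<forall>b\<in>{1, om 1, inverse (om 1)}.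
      \<epsilon> * (y_var L (k m) (x m) j / y_var L (k' n) (y n) j') \<noteq> b) (at 0)"
    by (intro eventually_ball_finite ballI ev) auto
  moreover have "eventually (\<lambda>\<epsilon>::complex. \<epsilon> \<noteq> 0) (at 0)" by (simp add: eventually_at_filter)
  ultimately show ?thesis
  proof eventually_elim
    case (elim \<epsilon>)
    let ?k = "join M N k k'" and ?z = "join M N (\<lambda>n. \<epsilon> * x n) y"
    have split: "(n \<in> {1..M}) \<or> (\<exists>j\<in>{1..N}. n = M + j)" if "n \<in> {1..M + N}" for n
    proof (cases "n \<le> M")
      case False
      then have "n - M \<in> {1..N}" "n = M + (n - M)" using that by auto
      then show ?thesis by blast
    qed (use that in auto)
    have k1: "?k n = k n" "?z n = \<epsilon> * x n" if "n \<in> {1..M}" for n using that by (simp_all only: join_1)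
    have k2: "?k (M + n) = k' n" "?z (M + n) = y n" if "n \<in> {1..N}" for n using that by (simp_all only: join_2)
    have mixed: "y_var L (k m) (\<epsilon> * x m) j / y_var L (k' n) (y n) j' \<notin> {1, om 1}"
      "y_var L (k' n) (y n) j' / y_var L (k m) (\<epsilon> * x m) j \<notin> {1, om 1}"
      if mn: "m \<in> {1..M}" "n \<in> {1..N}" "j \<in> {1..k m}" "j' \<in> {1..k' n}" for m n j j'
    proof -
      define r where "r = y_var L (k m) (\<epsilon> * x m) j / y_var L (k' n) (y n) j'"
      have "\<forall>b\<in>{1, om 1, inverse (om 1)}. r \<noteq> b"
        using elim(1) mn unfolding r_def y_var_scale by (simp only: times_divide_eq_right) blast
      moreover have "y_var L (k' n) (y n) j' / y_var L (k m) (\<epsilon> * x m) j = inverse r"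
        by (simp add: r_def)
      ultimately show "y_var L (k m) (\<epsilon> * x m) j / y_var L (k' n) (y n) j' \<notin> {1, om 1}"
        "y_var L (k' n) (y n) j' / y_var L (k m) (\<epsilon> * x m) j \<notin> {1, om 1}"
        unfolding r_def[symmetric] by (auto simp: inverse_eq_iff_eq) (metis inverse_inverse_eq)
    qed
    show ?case
      unfolding no_poles_def
    proof (intro conjI ballI impI)
      fix n assume "n \<in> {1..M + N}"
      then show "?z n \<noteq> 0" using split[of n] k1 k2 x y elim(2) by auto
    next
      fix m n j j' assume mn: "m \<in> {1..M + N}" "n \<in> {1..M + N}" "m \<noteq> n" and j: "j \<in> {1..?k m}" "j' \<in> {1..?k n}"
      from split[OF mn(1)] split[OF mn(2)] consider
          "m \<in> {1..M}" "n \<in> {1..M}" | n' where "m \<in> {1..M}" "n' \<in> {1..N}" "n = M + n'"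
        | m' where "m' \<in> {1..N}" "m = M + m'" "n \<in> {1..M}"
        | m' n' where "m' \<in> {1..N}" "m = M + m'" "n' \<in> {1..N}" "n = M + n'" by blast
      then show "y_var L (?k m) (?z m) j / y_var L (?k n) (?z n) j' \<notin> {1, om 1}"
      proof cases
        case 1
        then show ?thesis
          using no_polesD[OF X 1 mn(3), of j j'] j elim(2) unfolding k1[OF 1(1)] k1[OF 1(2)] y_var_scale by simp
      next
        case 2
        then show ?thesis
          using mixed(1)[OF 2(1,2)] j unfolding 2(3) k1[OF 2(1)] k2[OF 2(2)] by blast
      next
        case 3
        then show ?thesis
          using mixed(2)[OF 3(3,1)] j unfolding 3(2) k1[OF 3(3)] k2[OF 3(1)] by blast
      next
        case 4
        then show ?thesis
          using no_polesD[OF Y 4(1,3)] j mn(3) unfolding 4(2,4) k2[OF 4(1)] k2[OF 4(3)] by simp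
      qed
    qed
  qed
qed

text \<open>\<open>psum\<close> and its counterpart \<open>nsum\<close> for inverse powers are the
  power sums over the sites with label s. Their totals over s are \<open>ptot\<close> and
  \<open>ntot\<close>: positions run through 1 to k n whatever the labels are, so the totals depend
  only on k and the points.\<close>

definition psum :: "nat \<Rightarrow> (nat \<Rightarrow> nat set) \<Rightarrow> (nat \<Rightarrow> complex) \<Rightarrow> nat \<Rightarrow> nat \<Rightarrow> complex" where
  "psum N S x m s = (\<Sum>n\<in>{1..N}. if s \<in> S n then y_at L (S n) (x n) s ^ m else 0)"

definition nsum :: "nat \<Rightarrow> (nat \<Rightarrow> nat set) \<Rightarrow> (nat \<Rightarrow> complex) \<Rightarrow> nat \<Rightarrow> nat \<Rightarrow> complex" where
  "nsum N S x m s = (\<Sum>n\<in>{1..N}. if s \<in> S n then inverse (y_at L (S n) (x n) s) ^ m else 0)"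

definition ptot :: "nat \<Rightarrow> (nat \<Rightarrow> nat) \<Rightarrow> (nat \<Rightarrow> complex) \<Rightarrow> nat \<Rightarrow> complex" where
  "ptot N k x m = (\<Sum>n\<in>{1..N}. \<Sum>j\<in>{1..k n}. y_var L (k n) (x n) j ^ m)"

definition ntot :: "nat \<Rightarrow> (nat \<Rightarrow> nat) \<Rightarrow> (nat \<Rightarrow> complex) \<Rightarrow> nat \<Rightarrow> complex" where
  "ntot N k x m = (\<Sum>n\<in>{1..N}. \<Sum>j\<in>{1..k n}. inverse (y_var L (k n) (x n) j) ^ m)"

lemma sum_over_labels:
  assumes S: "S \<in> configs L N k"
  shows "(\<Sum>s\<in>{1..L}. \<Sum>n\<in>{1..N}. if s \<in> S n then g (y_at L (S n) (x n) s) else (0::complex)) =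
    (\<Sum>n\<in>{1..N}. \<Sum>j\<in>{1..k n}. g (y_var L (k n) (x n) j))"
proof -
  have "(\<Sum>s\<in>{1..L}. \<Sum>n\<in>{1..N}. if s \<in> S n then g (y_at L (S n) (x n) s) else 0) =
      (\<Sum>n\<in>{1..N}. \<Sum>s\<in>{1..L}. if s \<in> S n then g (y_at L (S n) (x n) s) else 0)"
    by (rule sum.swap)
  also have "\<dots> = (\<Sum>n\<in>{1..N}. \<Sum>j\<in>{1..k n}. g (y_var L (k n) (x n) j))"
  proof (rule sum.cong[OF refl])
    fix n assume n: "n \<in> {1..N}"
    note Sn = configsD[OF S n]
    have "(\<Sum>s\<in>{1..L}. if s \<in> S n then g (y_at L (S n) (x n) s) else 0) = (\<Sum>s\<in>S n. g (y_at L (S n) (x n) s))"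
      using Sn(1) by (simp add: sum.If_cases Int_absorb1)
    also have "\<dots> = (\<Sum>s\<in>S n. g (y_var L (k n) (x n) (position (S n) s)))"
      using Sn(2) by (simp add: y_at_def)
    also have "\<dots> = (\<Sum>j\<in>{1..k n}. g (y_var L (k n) (x n) j))"
      using sum.reindex_bij_betw[OF position_bij[OF Sn(3)], of "\<lambda>j. g (y_var L (k n) (x n) j)"] Sn(2) by simp
    finally show "(\<Sum>s\<in>{1..L}. if s \<in> S n then g (y_at L (S n) (x n) s) else 0) = (\<Sum>j\<in>{1..k n}. g (y_var L (k n) (x n) j))" .
  qed
  finally show ?thesis .
qed

lemma sum_psum: "S \<in> configs L N k \<Longrightarrow> (\<Sum>s\<in>{1..L}. psum N S x m s) = ptot N k x m"
  unfolding psum_def ptot_def by (rule sum_over_labels)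

lemma sum_nsum: "S \<in> configs L N k \<Longrightarrow> (\<Sum>s\<in>{1..L}. nsum N S x m s) = ntot N k x m"
  unfolding nsum_def ntot_def by (rule sum_over_labels[where g = "\<lambda>y. inverse y ^ m"])

definition gam :: "'i::finite \<Rightarrow> nat \<Rightarrow> complex" where
  "gam i m = om (- ((of_nat L + 1 - 2 * of_nat (node i)) / 2) * of_nat m)"

definition ev :: "nat \<Rightarrow> (nat \<Rightarrow> nat set) \<Rightarrow> (nat \<Rightarrow> complex) \<Rightarrow> 'i::finite \<times> nat \<Rightarrow> complex" where
  "ev N S x = (\<lambda>(i, q). let m = q + 1 in
     \<Sum>n\<in>{1..N}. \<Sum>s\<in>S n. form (alpha i) (weight L s) *
       om (- ((of_nat L + 1 - 2 * of_nat s) / 2) * of_nat m) * y_at L (S n) (x n) s ^ m)"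

lemma E_hom_eq: "E_hom L N S x = alg_eval (ev N S x)"
  by (simp add: E_hom_def ev_def)

text \<open>Only the labels i and i + 1 pair with \<alpha>_i, with opposite signs, and their phases
  differ by the factor \<open>om (of_nat m)\<close>, where m = q + 1.\<close>

lemma ev_eq:
  fixes i :: "'i::finite"
  assumes C: "CARD('i) = L - 1" and S: "S \<in> configs L N k"
  shows "ev N S x (i, q) = gam i (Suc q) *
    (psum N S x (Suc q) (node i) - om (of_nat (Suc q)) * psum N S x (Suc q) (Suc (node i)))"
proof -
  define m where "m = Suc q"
  have "(\<Sum>s\<in>S n. form (alpha i) (weight L s) *
       om (- ((of_nat L + 1 - 2 * of_nat s) / 2) * of_nat m) * y_at L (S n) (x n) s ^ m) =
     gam i m * ((if node i \<in> S n then y_at L (S n) (x n) (node i) ^ m else 0) -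
        om (of_nat m) * (if Suc (node i) \<in> S n then y_at L (S n) (x n) (Suc (node i)) ^ m else 0))"
    if n: "n \<in> {1..N}" for n
  proof -
    note Sn = configsD[OF S n]
    define c where "c s = om (- ((of_nat L + 1 - 2 * of_nat s) / 2) * of_nat m) * y_at L (S n) (x n) s ^ m" for s
    have "(\<Sum>s\<in>S n. form (alpha i) (weight L s) * om (- ((of_nat L + 1 - 2 * of_nat s) / 2) * of_nat m) * y_at L (S n) (x n) s ^ m) =
        (\<Sum>s\<in>S n. (if node i = s then c s else 0) - (if Suc (node i) = s then c s else 0))"
    proof (rule sum.cong[OF refl])
      fix s assume "s \<in> S n"
      then have "s \<in> {1..L}" using Sn(1) by blast
      then show "form (alpha i) (weight L s) * om (- ((of_nat L + 1 - 2 * of_nat s) / 2) * of_nat m) * y_at L (S n) (x n) s ^ m =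
          (if node i = s then c s else 0) - (if Suc (node i) = s then c s else 0)"
        using form_alpha_weight[OF L2 C] by (auto simp: c_def)
    qed
    also have "\<dots> = (if node i \<in> S n then c (node i) else 0) - (if Suc (node i) \<in> S n then c (Suc (node i)) else 0)"
      using Sn(3) by (simp add: sum_subtractf)
    also have "c (node i) = gam i m * y_at L (S n) (x n) (node i) ^ m"
      by (simp add: c_def gam_def)
    also have "c (Suc (node i)) = gam i m * om (of_nat m) * y_at L (S n) (x n) (Suc (node i)) ^ m"
    proof -
      have "- ((of_nat L + 1 - 2 * of_nat (Suc (node i))) / 2) * of_nat m =
          - ((of_nat L + 1 - 2 * of_nat (node i)) / 2) * of_nat m + (of_nat m :: complex)"
        by (simp add: field_simps)
      then show ?thesis by (simp only: c_def gam_def omega_pow_add)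
    qed
    finally show ?thesis by (simp only:) (simp add: algebra_simps)
  qed
  then have "ev N S x (i, q) = (\<Sum>n\<in>{1..N}. gam i m * ((if node i \<in> S n then y_at L (S n) (x n) (node i) ^ m else 0) -
        om (of_nat m) * (if Suc (node i) \<in> S n then y_at L (S n) (x n) (Suc (node i)) ^ m else 0)))"
    by (simp add: ev_def m_def del: power_Suc of_nat_Suc)
  also have "\<dots> = gam i m * (psum N S x m (node i) - om (of_nat m) * psum N S x m (Suc (node i)))"
    by (simp add: psum_def sum_distrib_left sum_subtractf right_diff_distrib del: power_Suc)
  finally show ?thesis by (simp only: m_def)
qed

end

section \<open>Invariant families from the expansion\<close>

lemma fps_expansion_eq_0:
  fixes F :: "complex fps"
  assumes F: "f has_fps_expansion F" and ev: "eventually (\<lambda>z. f z = 0) (at 0)"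
  shows "F = 0"
proof -
  have "isCont f 0" using has_fps_expansion_imp_continuous[OF F, of UNIV] by simp
  then have "(f \<longlongrightarrow> f 0) (at 0)" by (simp add: isCont_def)
  moreover have "(f \<longlongrightarrow> 0) (at 0)"
    using tendsto_eventually[OF ev] .
  ultimately have "f 0 = 0" using tendsto_unique[of "at (0::complex)"] by simp
  then have "eventually (\<lambda>z. f z = 0) (nhds 0)"
    using ev by (simp add: eventually_nhds_conv_at)
  then have "f has_fps_expansion 0" by (simp add: has_fps_expansion_0_iff)
  then show ?thesis using fps_expansion_unique_complex[OF F] by simp
qed

context toda
begin

definition zeta :: "complex ^ 'i::finite \<Rightarrow> nat \<Rightarrow> complex" where
  "zeta a s = om (form a (weight L s))"

lemma chi_zeta: "om (form a (\<Sum>n\<in>{1..N}. weight_set L (S n))) = chi (zeta a) N S"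
  unfolding chi_def zeta_def weight_set_def form_sum omega_pow_sum ..

lemma J_fun_eq:
  "J_fun L p N k a h x = (\<Sum>S\<in>configs L N k. chi (zeta a) N S * Phi L p N S x * alg_eval (ev N S x) h)"
  unfolding J_fun_def configs_def[symmetric] chi_zeta E_hom_eq ..

definition partial_nsum :: "nat \<Rightarrow> (nat \<Rightarrow> nat set) \<Rightarrow> (nat \<Rightarrow> complex) \<Rightarrow> nat \<Rightarrow> nat \<Rightarrow> complex" where
  "partial_nsum N T y m i = (\<Sum>t\<in>{1..i}. nsum N T y m t)"

text \<open>
  The coefficient of the generator \<open>(i, q)\<close> in the exponent of the cross factors, divided by the
  order \<open>q + 1\<close>, as read off from \<open>pairing_identity\<close>; the term with \<open>L\<close> in the denominator accounts
  for \<open>QQ L * P L\<close> there, by \<open>telescope_weighted\<close>.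
\<close>

definition Gz :: "nat \<Rightarrow> (nat \<Rightarrow> nat set) \<Rightarrow> (nat \<Rightarrow> complex) \<Rightarrow> 'i::finite \<times> nat \<Rightarrow> complex" where
  "Gz N T y = (\<lambda>(i, q). - (cm (Suc q) / of_nat (Suc q)) * inverse (gam i (Suc q)) *
     (partial_nsum N T y (Suc q) (node i) - of_nat (node i) / of_nat L * partial_nsum N T y (Suc q) L))"

definition cross_coeff :: "nat \<Rightarrow> nat \<Rightarrow> (nat \<Rightarrow> nat set) \<Rightarrow> (nat \<Rightarrow> nat set) \<Rightarrow> (nat \<Rightarrow> complex) \<Rightarrow> (nat \<Rightarrow> complex) \<Rightarrow> nat \<Rightarrow> complex" where
  "cross_coeff M N S T x y m = (\<Sum>n\<in>{1..N}. \<Sum>m'\<in>{1..M}. \<Sum>s\<in>S m'. \<Sum>t\<in>T n.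
     if s = t then 0 else cm m * coupling (S m') (x m') (T n) (y n) s t ^ m)"

definition cross_fps :: "nat \<Rightarrow> nat \<Rightarrow> (nat \<Rightarrow> nat set) \<Rightarrow> (nat \<Rightarrow> nat set) \<Rightarrow> (nat \<Rightarrow> complex) \<Rightarrow> (nat \<Rightarrow> complex) \<Rightarrow> complex fps" where
  "cross_fps M N S T x y = (\<Prod>n\<in>{1..N}. \<Prod>m\<in>{1..M}. \<Prod>s\<in>S m. \<Prod>t\<in>T n.
     if s = t then 1 else FF (coupling (S m) (x m) (T n) (y n) s t))"

lemma cross_fps_dlog: "has_dlog (cross_fps M N S T x y) (cross_coeff M N S T x y)"
proof -
  have "has_dlog (cross_fps M N S T x y) (\<lambda>m. \<Sum>n\<in>{1..N}. \<Sum>m'\<in>{1..M}. \<Sum>s\<in>S m'. \<Sum>t\<in>T n.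
     if s = t then 0 else cm m * coupling (S m') (x m') (T n) (y n) s t ^ m)"
    unfolding cross_fps_def
  proof (intro has_dlog_prod)
    fix n m s t
    show "has_dlog (if s = t then 1 else FF (coupling (S m) (x m) (T n) (y n) s t))
        (\<lambda>k. if s = t then 0 else cm k * coupling (S m) (x m) (T n) (y n) s t ^ k)"
      using has_dlog_1 FF_dlog by simp
  qed
  then show ?thesis by (simp add: cross_coeff_def[abs_def])
qed

lemma cross_fps_expansion: "cross M N S T x y has_fps_expansion cross_fps M N S T x y"
proof -
  have "(\<lambda>\<epsilon>. \<Prod>n\<in>{1..N}. \<Prod>m\<in>{1..M}. \<Prod>s\<in>S m. \<Prod>t\<in>T n.
     if s = t then 1 else ff (\<epsilon> * coupling (S m) (x m) (T n) (y n) s t)) has_fps_expansion cross_fps M N S T x y"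
    unfolding cross_fps_def
  proof (intro has_fps_expansion_prod)
    fix n m s t
    show "(\<lambda>\<epsilon>. if s = t then 1 else ff (\<epsilon> * coupling (S m) (x m) (T n) (y n) s t)) has_fps_expansion
        (if s = t then 1 else FF (coupling (S m) (x m) (T n) (y n) s t))"
      using FF_expansion by simp
  qed
  then show ?thesis by (simp add: cross_def[abs_def])
qed

lemma partial_nsum_L: "T \<in> configs L N k \<Longrightarrow> partial_nsum N T y m L = ntot N k y m"
  unfolding partial_nsum_def by (rule sum_nsum)

lemma cross_coeff_sums:
  assumes S: "S \<in> configs L M k" and T: "T \<in> configs L N k'"
  shows "cross_coeff M N S T x y m = cm m * (\<Sum>s\<in>{1..L}. \<Sum>t\<in>{1..L}.
    if s = t then 0 else (if s < t then 1 else om (of_nat m)) * (psum M S x m s * nsum N T y m t))"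
proof -
  define a where "a s t = (if s = t then 0 else (if s < t then 1 else om (of_nat m)) :: complex)" for s t :: nat
  define u where "u m' s = (if s \<in> S m' then y_at L (S m') (x m') s ^ m else 0)" for m' s
  define v where "v n t = (if t \<in> T n then inverse (y_at L (T n) (y n) t) ^ m else 0)" for n t
  have "(\<Sum>s\<in>S m'. \<Sum>t\<in>T n. if s = t then 0 else cm m * coupling (S m') (x m') (T n) (y n) s t ^ m) =
      cm m * (\<Sum>s\<in>{1..L}. \<Sum>t\<in>{1..L}. a s t * (u m' s * v n t))" if "n \<in> {1..N}" "m' \<in> {1..M}" for n m'
  proof -
    note Sm = configsD[OF S that(2)] and Tn = configsD[OF T that(1)]
    have "(\<Sum>s\<in>S m'. \<Sum>t\<in>T n. if s = t then 0 else cm m * coupling (S m') (x m') (T n) (y n) s t ^ m) =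
        (\<Sum>s\<in>S m'. \<Sum>t\<in>T n. cm m * (a s t * (u m' s * v n t)))"
      by (intro sum.cong refl)
        (auto simp: a_def u_def v_def coupling_def power_mult_distrib omega_pow_power)
    also have "\<dots> = (\<Sum>s\<in>S m'. \<Sum>t\<in>{1..L}. cm m * (a s t * (u m' s * v n t)))"
      using Tn(1) by (intro sum.cong refl sum.mono_neutral_left) (auto simp: v_def)
    also have "\<dots> = (\<Sum>s\<in>{1..L}. \<Sum>t\<in>{1..L}. cm m * (a s t * (u m' s * v n t)))"
      using Sm(1) by (intro sum.mono_neutral_left) (auto simp: u_def)
    finally show ?thesis by (simp add: sum_distrib_left)
  qed
  then have "cross_coeff M N S T x y m =
      (\<Sum>n\<in>{1..N}. \<Sum>m'\<in>{1..M}. cm m * (\<Sum>s\<in>{1..L}. \<Sum>t\<in>{1..L}. a s t * (u m' s * v n t)))"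
    unfolding cross_coeff_def by (intro sum.cong refl)
  also have "\<dots> = cm m * (\<Sum>n\<in>{1..N}. \<Sum>m'\<in>{1..M}. \<Sum>s\<in>{1..L}. \<Sum>t\<in>{1..L}. a s t * (u m' s * v n t))"
    by (simp add: sum_distrib_left)
  also have "\<dots> = cm m * (\<Sum>s\<in>{1..L}. \<Sum>t\<in>{1..L}. a s t * ((\<Sum>m'\<in>{1..M}. u m' s) * (\<Sum>n\<in>{1..N}. v n t)))"
    by (simp only: sum_swap4)
  also have "\<dots> = cm m * (\<Sum>s\<in>{1..L}. \<Sum>t\<in>{1..L}.
    if s = t then 0 else (if s < t then 1 else om (of_nat m)) * (psum M S x m s * nsum N T y m t))"
    unfolding psum_def nsum_def u_def v_def a_def
    by (intro arg_cong2[where f = "(*)"] sum.cong refl) auto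
  finally show ?thesis .
qed

text \<open>The remainder in \<open>pairing_identity\<close> is absorbed by
  \<open>telescope_weighted\<close> when L divides m and is 0 otherwise, as \<open>ntot\<close>
  vanishes. Absorbing it moves the fraction 1 / L of the label-independent term into the terms
  \<open>Gz\<close>, whence the factor 1 - 1 / L.\<close>

lemma cross_coeff_eq:
  assumes C: "CARD('i::finite) = L - 1"
    and S: "S \<in> configs L M k" and T: "T \<in> configs L N k'" and m: "m \<ge> 1"
    and Q: "L dvd m \<or> ntot N k' y m = 0"
  shows "cross_coeff M N S T x y m = cm m * ntot N k' y m * ptot M k x m * (1 - 1 / of_nat L) +
    of_nat m * (\<Sum>i\<in>UNIV. Gz N T y (i :: 'i, m - 1) * ev M S x (i, m - 1))"
proof -
  define P where "P s = psum M S x m s" for s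
  define QQ where "QQ i = partial_nsum N T y m i" for i
  define z where "z = om (of_nat m)"
  have L1: "L \<ge> 1" and Lnz: "(of_nat L :: complex) \<noteq> 0" using L2 by auto
  have Ptot: "(\<Sum>s\<in>{1..L}. P s) = ptot M k x m" unfolding P_def by (rule sum_psum[OF S])
  have QL: "QQ L = ntot N k' y m" unfolding QQ_def by (rule partial_nsum_L[OF T])
  have "of_nat m * (\<Sum>i\<in>UNIV. Gz N T y (i :: 'i, m - 1) * ev M S x (i, m - 1)) =
      (\<Sum>i\<in>(UNIV :: 'i set). - cm m * (QQ (node i) - of_nat (node i) / of_nat L * QQ L) * (P (node i) - z * P (Suc (node i))))"
    unfolding sum_distrib_left
  proof (rule sum.cong[OF refl])
    fix i :: 'i
    have e: "ev M S x (i, m - 1) = gam i m * (P (node i) - z * P (Suc (node i)))"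
      using ev_eq[OF C S, of x i "m - 1"] m by (simp add: P_def z_def)
    have g: "Gz N T y (i, m - 1) = - (cm m / of_nat m) * inverse (gam i m) * (QQ (node i) - of_nat (node i) / of_nat L * QQ L)"
      using m by (simp add: Gz_def QQ_def)
    have "gam i m \<noteq> 0" "(of_nat m :: complex) \<noteq> 0" using m by (auto simp: gam_def)
    then show "of_nat m * (Gz N T y (i, m - 1) * ev M S x (i, m - 1)) =
        - cm m * (QQ (node i) - of_nat (node i) / of_nat L * QQ L) * (P (node i) - z * P (Suc (node i)))"
      unfolding e g by (simp add: field_simps)
  qed
  also have "\<dots> = (\<Sum>j\<in>{1..L - 1}. - cm m * (QQ j - of_nat j / of_nat L * QQ L) * (P j - z * P (Suc j)))"
    by (rule sum_node[OF C])
  also have "\<dots> = - cm m * ((\<Sum>j\<in>{1..L - 1}. QQ j * (P j - z * P (Suc j))) -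
      QQ L / of_nat L * (\<Sum>j\<in>{1..L - 1}. of_nat j * (P j - z * P (Suc j))))"
    by (simp add: sum_distrib_left sum_subtractf[symmetric] algebra_simps diff_divide_distrib)
  finally have G: "of_nat m * (\<Sum>i\<in>UNIV. Gz N T y (i :: 'i, m - 1) * ev M S x (i, m - 1)) =
    - cm m * ((\<Sum>j\<in>{1..L - 1}. QQ j * (P j - z * P (Suc j))) -
      QQ L / of_nat L * (\<Sum>j\<in>{1..L - 1}. of_nat j * (P j - z * P (Suc j))))" .
  have cc: "cross_coeff M N S T x y m = cm m * (QQ L * (\<Sum>s\<in>{1..L}. P s) - QQ L * P L -
      (\<Sum>i\<in>{1..L - 1}. QQ i * (P i - z * P (Suc i))))"
    unfolding cross_coeff_sums[OF S T] P_def z_def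
    by (subst pairing_identity[OF L1, of QQ]) (simp_all add: QQ_def partial_nsum_def)
  have disj: "QQ L = 0 \<or> (\<Sum>j\<in>{1..L - 1}. of_nat j * (P j - z * P (Suc j))) = (\<Sum>s\<in>{1..L}. P s) - of_nat L * P L"
  proof (cases "QQ L = 0")
    case False
    then have "L dvd m" using Q QL by simp
    then have "z = 1" unfolding z_def using omega_pow_of_nat_eq_1_iff[of L m] L2 by simp
    then show ?thesis using telescope_weighted[OF L1, of P] by simp
  qed simp
  have alg: "c * (q * sp - q * pl - u) = c * q * sp * (1 - 1 / of_nat L) + - c * (u - q / of_nat L * v)"
    if "q = 0 \<or> v = sp - of_nat L * pl" for c q sp pl u v :: complex
    using that Lnz by (auto simp: field_simps)
  show ?thesis
    unfolding G Ptot[symmetric] QL[symmetric] cc by (rule alg[OF disj])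
qed

text \<open>The element written h_a(y) in the overview: the labels of y are summed over, and those
  of x enter only through the evaluation of \<open>hexp\<close>.\<close>

definition hfam :: "nat \<Rightarrow> nat \<Rightarrow> (nat \<Rightarrow> nat) \<Rightarrow> (nat \<Rightarrow> complex) \<Rightarrow> complex ^ 'i::finite \<Rightarrow> 'i alg" where
  "hfam l N k y a = (\<Sum>T\<in>configs L N k. alg_scale (chi (zeta a) N T * Phi L p N T y) (hexp l (Gz N T y)))"

lemma zeta_reflection:
  assumes "CARD('i::finite) = L - 1" "s \<in> {1..L}"
  shows "zeta (simple_reflection (i :: 'i) a) s = (zeta a \<circ> Transposition.transpose (node i) (Suc (node i))) s"
  using form_reflection_weight[OF L2 assms, of i a] by (simp add: zeta_def)

lemma JZ_reflection:
  assumes C: "CARD('i::finite) = L - 1" and np: "no_poles L N k x"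
  shows "JZ N k (zeta (simple_reflection (i :: 'i) a)) x = JZ N k (zeta a) x"
proof -
  have "JZ N k (zeta (simple_reflection i a)) x =
      JZ N k (zeta a \<circ> Transposition.transpose (node i) (Suc (node i))) x"
    unfolding JZ_def
  proof (rule sum.cong[OF refl], rule arg_cong2[where f = "(*)"])
    fix S assume S: "S \<in> configs L N k"
    show "(\<Prod>n\<in>{1..N}. prod (zeta (simple_reflection i a)) (S n)) =
      (\<Prod>n\<in>{1..N}. prod (zeta a \<circ> Transposition.transpose (node i) (Suc (node i))) (S n))"
      using configsD(1)[OF S] zeta_reflection[OF C] by (intro prod.cong refl) blast
  qed simp
  also have "\<dots> = JZ N k (zeta a) x"
    using node_range[of i] C L2 by (intro JZ_swap np) auto
  finally show ?thesis .
qed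

theorem J_fun_hfam_reflection:
  fixes i :: "'i::finite"
  assumes C: "CARD('i::finite) = L - 1" and X: "no_poles L M k x" and Y: "no_poles L N k' y"
    and Q: "\<And>m. m \<in> {1..l} \<Longrightarrow> L dvd m \<or> ntot N k' y m = 0"
  shows "J_fun L p M k (simple_reflection i a) (hfam l N k' y (simple_reflection i a)) x =
    J_fun L p M k a (hfam l N k' y a) x"
proof -
  define A where "A \<zeta> S = chi \<zeta> M S * Phi L p M S x" for \<zeta> S
  define B where "B \<zeta> T = chi \<zeta> N T * Phi L p N T y" for \<zeta> T
  define D where "D n \<zeta> = (\<Sum>S\<in>configs L M k. \<Sum>T\<in>configs L N k'. A \<zeta> S * B \<zeta> T *
      hx n (\<lambda>g :: 'i \<times> nat. Gz N T y g * ev M S x g))" for n \<zeta>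
  define F where "F \<zeta> = (\<Sum>S\<in>configs L M k. \<Sum>T\<in>configs L N k'. fps_const (A \<zeta> S * B \<zeta> T) * cross_fps M N S T x y)" for \<zeta>
  \<comment> \<open>R is the part of the cross factors common to all S and T. Its constant term is
    1, which allows the sums \<open>D n\<close> to be recovered from the coefficients of F by
    induction on n.\<close>
  obtain R where R: "has_dlog R (\<lambda>m. cm m * ntot N k' y m * ptot M k x m * (1 - 1 / of_nat L))"
    using has_dlog_exists by blast
  have nth: "fps_nth (F \<zeta>) n = (\<Sum>j=0..n. fps_nth R j * D (n - j) \<zeta>)" if n: "n \<le> l" for n \<zeta>
  proof -
    have key: "fps_nth (cross_fps M N S T x y) n =
        fps_nth (R * Abs_fps (\<lambda>n. hx n (\<lambda>g :: 'i \<times> nat. Gz N T y g * ev M S x g))) n"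
      if S: "S \<in> configs L M k" and T: "T \<in> configs L N k'" for S T
    proof (rule has_dlog_unique_upto[OF cross_fps_dlog has_dlog_mult[OF R has_dlog_hx] _ n])
      fix m assume m: "m \<in> {1..l}"
      then show "cross_coeff M N S T x y m = cm m * ntot N k' y m * ptot M k x m * (1 - 1 / of_nat L) +
          of_nat m * (\<Sum>i\<in>UNIV. Gz N T y (i :: 'i, m - 1) * ev M S x (i, m - 1))"
        using Q[OF m] by (intro cross_coeff_eq[OF C S T]) auto
    qed
    have "fps_nth (F \<zeta>) n = (\<Sum>S\<in>configs L M k. \<Sum>T\<in>configs L N k'. A \<zeta> S * B \<zeta> T *
        (\<Sum>j=0..n. fps_nth R j * hx (n - j) (\<lambda>g :: 'i \<times> nat. Gz N T y g * ev M S x g)))"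
      unfolding F_def fps_sum_nth fps_mult_left_const_nth
      by (intro sum.cong refl arg_cong2[where f = "(*)"]) (simp only: key, simp add: fps_mult_nth)
    also have "\<dots> = (\<Sum>S\<in>configs L M k. \<Sum>T\<in>configs L N k'. \<Sum>j=0..n. fps_nth R j * (A \<zeta> S * B \<zeta> T *
        hx (n - j) (\<lambda>g :: 'i \<times> nat. Gz N T y g * ev M S x g)))"
      by (simp add: sum_distrib_left mult_ac)
    also have "\<dots> = (\<Sum>S\<in>configs L M k. \<Sum>j=0..n. \<Sum>T\<in>configs L N k'. fps_nth R j * (A \<zeta> S * B \<zeta> T *
        hx (n - j) (\<lambda>g :: 'i \<times> nat. Gz N T y g * ev M S x g)))"
      by (intro sum.cong refl sum.swap)
    also have "\<dots> = (\<Sum>j=0..n. \<Sum>S\<in>configs L M k. \<Sum>T\<in>configs L N k'. fps_nth R j * (A \<zeta> S * B \<zeta> T *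
        hx (n - j) (\<lambda>g :: 'i \<times> nat. Gz N T y g * ev M S x g)))"
      by (rule sum.swap)
    finally show ?thesis by (simp add: D_def sum_distrib_left)
  qed
  let ?k = "join M N k k'" and ?z = "\<lambda>\<epsilon>. join M N (\<lambda>n. \<epsilon> * x n) y"
  have J: "JZ (M + N) ?k \<zeta> (?z \<epsilon>) = (\<Sum>S\<in>configs L M k. \<Sum>T\<in>configs L N k'. (A \<zeta> S * B \<zeta> T) * cross M N S T x y \<epsilon>)"
    if "\<epsilon> \<noteq> 0" for \<zeta> \<epsilon>
    unfolding A_def B_def using X Y that by (intro JZ_join) (auto simp: no_poles_def)
  have exp: "(\<lambda>\<epsilon>. \<Sum>S\<in>configs L M k. \<Sum>T\<in>configs L N k'. (A \<zeta> S * B \<zeta> T) * cross M N S T x y \<epsilon>) has_fps_expansion F \<zeta>" for \<zeta>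
    unfolding F_def by (intro has_fps_expansion_sum has_fps_expansion_cmult_left cross_fps_expansion)
  let ?a = "zeta a" and ?b = "zeta (simple_reflection i a)"
  have "eventually (\<lambda>\<epsilon>::complex. \<epsilon> \<noteq> 0) (at 0)" by (simp add: eventually_at_filter)
  with no_poles_join[OF X Y] have "eventually (\<lambda>\<epsilon>.
      (\<Sum>S\<in>configs L M k. \<Sum>T\<in>configs L N k'. (A ?b S * B ?b T) * cross M N S T x y \<epsilon>) -
      (\<Sum>S\<in>configs L M k. \<Sum>T\<in>configs L N k'. (A ?a S * B ?a T) * cross M N S T x y \<epsilon>) = 0) (at 0)"
    by eventually_elim (simp add: J[symmetric] JZ_reflection[OF C])
  from fps_expansion_eq_0[OF has_fps_expansion_diff[OF exp exp] this] have "F ?b = F ?a" by simp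
  note F_eq = this
  \<comment> \<open>The coefficient of order n in F is \<open>D n\<close> plus terms with
    \<open>D\<close> of smaller index.\<close>
  have D_eq: "n \<le> l \<Longrightarrow> D n ?b = D n ?a" for n
  proof (induction n rule: less_induct)
    case (less n)
    have R0: "fps_nth R 0 = 1" using R by (simp add: has_dlog_def)
    have split: "fps_nth (F \<zeta>) n = D n \<zeta> + (\<Sum>j=1..n. fps_nth R j * D (n - j) \<zeta>)" for \<zeta>
      unfolding nth[OF less.prems] by (simp add: sum.atLeast_Suc_atMost R0)
    have "(\<Sum>j=1..n. fps_nth R j * D (n - j) ?b) = (\<Sum>j=1..n. fps_nth R j * D (n - j) ?a)"
      using less by (intro sum.cong refl arg_cong2[where f = "(*)"]) auto
    then show ?case using split[of ?a] split[of ?b] F_eq by simp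
  qed
  have "J_fun L p M k b (hfam l N k' y b) x = D l (zeta b)" for b :: "complex ^ 'i"
    unfolding J_fun_eq D_def A_def B_def hfam_def
    by (simp add: alg_eval_sum alg_eval_scale alg_eval_hexp sum_distrib_left mult_ac)
  then show ?thesis using D_eq[of l] by simp
qed

end

section \<open>The dominant limit\<close>

lemma form_expand: "form a b = (\<Sum>i\<in>UNIV. a $ i * form (alpha i) b)"
  unfolding form_alpha by (simp add: form_def sum_distrib_left mult.assoc)

lemma prod_nonzero:
  fixes f :: "'a \<Rightarrow> complex"
  shows "(\<And>x. x \<in> A \<Longrightarrow> f x \<noteq> 0) \<Longrightarrow> prod f A \<noteq> 0"
  by (induction A rule: infinite_finite_induct) auto

lemma position_le:
  assumes "T \<subseteq> {1..L}"
  shows "position T s \<le> s"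
proof -
  have "position T s \<le> card {1..s}"
    unfolding position_def using assms by (intro card_mono) auto
  then show ?thesis by simp
qed

lemma position_interval:
  assumes "s \<in> {1..k}"
  shows "position {1..k} s = s"
proof -
  have "{t \<in> {1..k}. t \<le> s} = {1..s}" using assms by auto
  then show ?thesis by (simp add: position_def)
qed

context toda
begin

text \<open>Every label is at least its position in T, with equality throughout only for an initial
  segment.\<close>

lemma sum_labels_minimal:
  assumes T: "T \<subseteq> {1..L}" "card T = k"
  shows "(\<Sum>s\<in>{1..k}. s) \<le> (\<Sum>s\<in>T. s)" and "(\<Sum>s\<in>T. s) = (\<Sum>s\<in>{1..k}. s) \<Longrightarrow> T = {1..k}"
proof -
  have fin: "finite T" using T finite_subset by blast
  have eq: "(\<Sum>s\<in>T. position T s) = (\<Sum>s\<in>{1..k}. s)"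
    using sum.reindex_bij_betw[OF position_bij[OF fin], of "\<lambda>s. s"] T by simp
  show "(\<Sum>s\<in>{1..k}. s) \<le> (\<Sum>s\<in>T. s)"
    unfolding eq[symmetric] by (intro sum_mono position_le[OF T(1)])
  assume "(\<Sum>s\<in>T. s) = (\<Sum>s\<in>{1..k}. s)"
  then have "(\<Sum>s\<in>T. position T s) = (\<Sum>s\<in>T. s)" using eq by simp
  then have "\<forall>s\<in>T. position T s = s"
    using sum_mono_inv[of "position T" T "\<lambda>s. s"] position_le[OF T(1)] fin by blast
  then have "position T ` T = T" by simp
  then show "T = {1..k}" using position_bij[OF fin] T by (simp add: bij_betw_def)
qed

definition dom_config :: "nat \<Rightarrow> (nat \<Rightarrow> nat) \<Rightarrow> nat \<Rightarrow> nat set" where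
  "dom_config N k = (\<lambda>n\<in>{1..N}. {1..k n})"

text \<open>By \<open>scale_chi\<close> this sum alone decides the exponential rate of the weight of
  a configuration along \<open>path\<close>; the smallest value dominates.\<close>

definition label_sum :: "nat \<Rightarrow> (nat \<Rightarrow> nat set) \<Rightarrow> nat" where
  "label_sum N S = (\<Sum>n\<in>{1..N}. \<Sum>s\<in>S n. s)"

lemma dom_config_in: "(\<And>n. n \<in> {1..N} \<Longrightarrow> k n \<le> L) \<Longrightarrow> dom_config N k \<in> configs L N k"
  by (auto simp: dom_config_def configs_def)

lemma label_sum_minimal:
  assumes S: "S \<in> configs L N k"
  shows "label_sum N (dom_config N k) \<le> label_sum N S"
    and "label_sum N S = label_sum N (dom_config N k) \<Longrightarrow> S = dom_config N k"
proof -
  have *: "(\<Sum>s\<in>dom_config N k n. s) = (\<Sum>s\<in>{1..k n}. s)" if "n \<in> {1..N}" for n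
    using that by (simp add: dom_config_def)
  have le: "(\<Sum>s\<in>dom_config N k n. s) \<le> (\<Sum>s\<in>S n. s)" if "n \<in> {1..N}" for n
    unfolding *[OF that] using sum_labels_minimal(1) configsD[OF S that] by blast
  show "label_sum N (dom_config N k) \<le> label_sum N S"
    unfolding label_sum_def by (rule sum_mono[OF le])
  assume "label_sum N S = label_sum N (dom_config N k)"
  then have eq: "(\<Sum>s\<in>S n. s) = (\<Sum>s\<in>dom_config N k n. s)" if "n \<in> {1..N}" for n
    using sum_mono_inv[of "\<lambda>n. \<Sum>s\<in>dom_config N k n. s" "{1..N}" "\<lambda>n. \<Sum>s\<in>S n. s"] le that
    unfolding label_sum_def by auto
  show "S = dom_config N k"
  proof
    fix n
    show "S n = dom_config N k n"
    proof (cases "n \<in> {1..N}")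
      case True
      then show ?thesis
        using sum_labels_minimal(2)[OF configsD(1,2)[OF S True]] eq[OF True] *[OF True] by (simp add: dom_config_def)
    next
      case False
      then have "S n = undefined" using S unfolding configs_def by (rule PiE_arb[rotated])
      then show ?thesis by (simp only: dom_config_def restrict_apply False if_False)
    qed
  qed
qed

text \<open>A path to infinity in the dominant chamber: \<open>\<langle>path \<tau>, H\<^sub>s\<rangle> = - \<i> \<tau> ((L + 1) / 2 - s)\<close>.\<close>

definition path :: "real \<Rightarrow> complex ^ 'i::finite" where
  "path \<tau> = (\<chi> i. - \<i> * of_real \<tau> * (of_nat (node i) * (of_nat L - of_nat (node i)) / 2))"

lemma zeta_path:
  assumes C: "CARD('i::finite) = L - 1" and s: "s \<in> {1..L}"
  shows "zeta (path \<tau> :: complex ^ 'i) s = exp (of_real (pi * \<tau> / L * (L + 1 - 2 * real s)))"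
proof -
  \<comment> \<open>r vanishes at 0 and at L, so the sum over the nodes extends to 0, ..., L and the
    labels s = 1 and s = L need no separate treatment.\<close>
  define r where "r j = - \<i> * of_real \<tau> * (of_nat j * (of_nat L - of_nat j) / 2)" for j :: nat
  have "form (path \<tau> :: complex ^ 'i) (weight L s) = (\<Sum>i\<in>(UNIV :: 'i set). r (node i) * ((if node i = s then 1 else 0) - (if Suc (node i) = s then 1 else 0)))"
  proof -
    have "(path \<tau> :: complex ^ 'i) $ i = r (node i)" for i by (simp add: path_def r_def)
    then show ?thesis
      by (subst form_expand) (simp only: form_alpha_weight[OF L2 C s] Suc_eq_plus1)
  qed
  also have "\<dots> = (\<Sum>j\<in>{1..L-1}. r j * ((if j = s then 1 else 0) - (if Suc j = s then 1 else 0)))"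
    by (rule sum_node[OF C])
  also have "\<dots> = (\<Sum>j\<in>{0..L}. r j * ((if j = s then 1 else 0) - (if Suc j = s then 1 else 0)))"
  proof (rule sum.mono_neutral_left)
    show "\<forall>j\<in>{0..L} - {1..L - 1}. r j * ((if j = s then 1 else 0) - (if Suc j = s then 1 else 0)) = 0"
    proof
      fix j assume "j \<in> {0..L} - {1..L - 1}"
      then have "j = 0 \<or> j = L" by auto
      then show "r j * ((if j = s then 1 else 0) - (if Suc j = s then 1 else 0)) = 0" by (auto simp: r_def)
    qed
  qed auto
  also have "\<dots> = (\<Sum>j\<in>{0..L}. (if j = s then r j else 0) - (if j = s - 1 then r j else 0))"
    using s by (intro sum.cong refl) auto
  also have "\<dots> = r s - r (s - 1)"
    using s by (auto simp: sum_subtractf)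
  also have "\<dots> = - \<i> * of_real \<tau> * ((of_nat L + 1 - 2 * of_nat s) / 2)"
    using s by (cases s) (auto simp: r_def field_simps)
  finally have "form (path \<tau> :: complex ^ 'i) (weight L s) = - \<i> * of_real \<tau> * ((of_nat L + 1 - 2 * of_nat s) / 2)" .
  then have "zeta (path \<tau> :: complex ^ 'i) s =
      exp (2 * of_real pi * \<i> * (- \<i> * of_real \<tau> * ((of_nat L + 1 - 2 * of_nat s) / 2)) / of_nat L)"
    by (simp only: zeta_def omega_pow_def)
  also have "2 * of_real pi * \<i> * (- \<i> * of_real \<tau> * ((of_nat L + 1 - 2 * of_nat s) / 2)) / of_nat L =
      complex_of_real (pi * \<tau> / L * (L + 1 - 2 * real s))"
    using L2 by (simp add: field_simps)
  finally show ?thesis .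
qed

text \<open>The inverse of the weight of the dominant configuration at
  \<open>path \<tau>\<close>.\<close>

definition scale :: "nat \<Rightarrow> (nat \<Rightarrow> nat) \<Rightarrow> real \<Rightarrow> complex" where
  "scale N k \<tau> = exp (of_real (- (pi * \<tau> / L * ((L + 1) * real (\<Sum>n\<in>{1..N}. k n) - 2 * real (label_sum N (dom_config N k))))))"

lemma scale_chi:
  assumes C: "CARD('i::finite) = L - 1" and S: "S \<in> configs L N k"
  shows "scale N k \<tau> * chi (zeta (path \<tau> :: complex ^ 'i)) N S =
    exp (of_real (- (2 * pi / L * (real (label_sum N S) - real (label_sum N (dom_config N k)))) * \<tau>))"
proof -
  have "chi (zeta (path \<tau> :: complex ^ 'i)) N S = (\<Prod>n\<in>{1..N}. \<Prod>s\<in>S n. exp (of_real (pi * \<tau> / L * (L + 1 - 2 * real s))))"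
    unfolding chi_def using configsD(1)[OF S] zeta_path[OF C] by (intro prod.cong refl) blast
  also have "\<dots> = (\<Prod>n\<in>{1..N}. exp (of_real (\<Sum>s\<in>S n. pi * \<tau> / L * (L + 1 - 2 * real s))))"
    using configsD(3)[OF S] by (intro prod.cong refl) (simp add: exp_sum del: of_real_mult of_real_divide)
  also have "\<dots> = exp (of_real (\<Sum>n\<in>{1..N}. \<Sum>s\<in>S n. pi * \<tau> / L * (L + 1 - 2 * real s)))"
    by (simp only: of_real_sum) (simp add: exp_sum del: of_real_mult of_real_divide of_real_sum)
  also have "(\<Sum>n\<in>{1..N}. \<Sum>s\<in>S n. pi * \<tau> / L * (L + 1 - 2 * real s)) =
      pi * \<tau> / L * ((L + 1) * real (\<Sum>n\<in>{1..N}. k n) - 2 * real (label_sum N S))"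
  proof -
    have "(\<Sum>n\<in>{1..N}. \<Sum>s\<in>S n. pi * \<tau> / L * (L + 1 - 2 * real s)) =
        pi * \<tau> / L * (\<Sum>n\<in>{1..N}. \<Sum>s\<in>S n. (L + 1 - 2 * real s))"
      by (simp only: sum_distrib_left)
    also have "(\<Sum>n\<in>{1..N}. \<Sum>s\<in>S n. (L + 1 - 2 * real s)) = (\<Sum>n\<in>{1..N}. (L + 1) * real (k n) - 2 * real (\<Sum>s\<in>S n. s))"
      using configsD(2)[OF S] by (intro sum.cong refl) (simp add: sum_subtractf sum_distrib_left)
    finally show ?thesis
      by (simp add: sum_subtractf sum_distrib_left label_sum_def)
  qed
  finally show ?thesis
    unfolding scale_def by (simp add: exp_add[symmetric] algebra_simps diff_divide_distrib add_divide_distrib flip: of_real_mult of_real_add of_real_diff)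
qed

lemma dominant_limit:
  assumes C: "CARD('i::finite) = L - 1" and k: "\<And>n. n \<in> {1..N} \<Longrightarrow> k n \<le> L"
  shows "((\<lambda>\<tau>. scale N k \<tau> * (\<Sum>S\<in>configs L N k. chi (zeta (path \<tau> :: complex ^ 'i)) N S * v S)) \<longlongrightarrow>
    v (dom_config N k)) at_top"
proof -
  have lim: "((\<lambda>\<tau>. scale N k \<tau> * chi (zeta (path \<tau> :: complex ^ 'i)) N S) \<longlongrightarrow>
      (if S = dom_config N k then 1 else 0)) at_top" if S: "S \<in> configs L N k" for S
  proof (cases "S = dom_config N k")
    case True
    then show ?thesis using scale_chi[OF C S] by simp
  next
    case False
    define c where "c = 2 * pi / L * (real (label_sum N S) - real (label_sum N (dom_config N k)))"
    have "c > 0"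
      unfolding c_def using label_sum_minimal[OF S] False L2 by (intro mult_pos_pos) (auto simp: order_less_le)
    then have "filterlim (\<lambda>\<tau>. c * \<tau>) at_top at_top"
      by (intro filterlim_tendsto_pos_mult_at_top[OF tendsto_const]) (auto simp: filterlim_ident)
    then have "filterlim (\<lambda>\<tau>. - c * \<tau>) at_bot at_top"
      by (simp add: filterlim_uminus_at_bot)
    then have "((\<lambda>\<tau>. exp (- c * \<tau>)) \<longlongrightarrow> 0) at_top"
      by (rule filterlim_compose[OF exp_at_bot])
    then have "((\<lambda>\<tau>. complex_of_real (exp (- c * \<tau>))) \<longlongrightarrow> of_real 0) at_top"
      by (intro tendsto_of_real)
    then show ?thesis
      using False by (simp only: scale_chi[OF C S] c_def[symmetric] exp_of_real of_real_0 if_False)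
  qed
  have "((\<lambda>\<tau>. \<Sum>S\<in>configs L N k. (scale N k \<tau> * chi (zeta (path \<tau> :: complex ^ 'i)) N S) * v S) \<longlongrightarrow>
      (\<Sum>S\<in>configs L N k. (if S = dom_config N k then 1 else 0) * v S)) at_top"
    by (intro tendsto_sum tendsto_mult tendsto_const lim)
  also have "(\<Sum>S\<in>configs L N k. (if S = dom_config N k then 1 else 0) * v S) = v (dom_config N k)"
    using dom_config_in[OF k] finite_configs by (simp add: if_distrib[of "\<lambda>x. x * _"] cong: if_cong)
  finally show ?thesis by (simp add: sum_distrib_left mult.assoc)
qed

text \<open>The sites of a point differ from it by half-integral powers of \<omega>, whose 2L-th
  powers are 1. So one condition on the 2L-th powers of the points keeps the ratios of all sites off
  the poles 1, \<omega> and the zeros \<omega>^p, \<omega>^(1-p) of f; the 2L-th powers of the two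
  zeros are inverse to each other.\<close>

definition good :: "nat \<Rightarrow> (nat \<Rightarrow> nat) \<Rightarrow> (nat \<Rightarrow> complex) \<Rightarrow> bool" where
  "good N k x \<longleftrightarrow> (\<forall>n\<in>{1..N}. k n \<in> {1..L - 1} \<and> x n \<noteq> 0) \<and>
    (\<forall>m\<in>{1..N}. \<forall>n\<in>{1..N}. m \<noteq> n \<longrightarrow>
       x m ^ (2 * L) / x n ^ (2 * L) \<notin> {1, om (of_real p) ^ (2 * L), inverse (om (of_real p) ^ (2 * L))})"

lemma om_int_multiple: "om (of_nat L * of_int z) = 1"
proof -
  have "om (of_real (real_of_int z * real L)) = 1"
    using omega_pow_eq_1_iff[of L "real_of_int z * real L"] L2 by auto
  then show ?thesis by (simp add: mult.commute)
qed

lemma y_var_power: "y_var L k x j ^ (2 * L) = x ^ (2 * L)"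
proof -
  have "of_nat (2 * L) * ((of_nat k + 1 - 2 * of_nat j) / 2) = (of_nat L * of_int (int k + 1 - 2 * int j) :: complex)"
    by (simp add: field_simps)
  then have "om ((of_nat k + 1 - 2 * of_nat j) / 2) ^ (2 * L) = om (of_nat L * of_int (int k + 1 - 2 * int j))"
    by (simp only: omega_pow_power)
  also have "\<dots> = 1" by (rule om_int_multiple)
  finally show ?thesis by (simp add: y_var_def power_mult_distrib)
qed

lemma good_ratio:
  assumes "good N k x" "m \<in> {1..N}" "n \<in> {1..N}" "m \<noteq> n"
  shows "y_var L k1 (x m) j / y_var L k2 (x n) j' \<notin> {1, om 1, om (of_real p), om (1 - of_real p)}"
proof
  let ?r = "y_var L k1 (x m) j / y_var L k2 (x n) j'"
  assume "?r \<in> {1, om 1, om (of_real p), om (1 - of_real p)}"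
  moreover have "om 1 ^ (2 * L) = 1" using om_1_power_L by (simp add: mult.commute[of 2] power_mult)
  moreover have "om (1 - of_real p) ^ (2 * L) = inverse (om (of_real p) ^ (2 * L))"
    using \<open>om 1 ^ (2 * L) = 1\<close> by (simp add: omega_pow_diff power_divide inverse_eq_divide)
  ultimately have "?r ^ (2 * L) \<in> {1, om (of_real p) ^ (2 * L), inverse (om (of_real p) ^ (2 * L))}"
    by auto
  moreover have "?r ^ (2 * L) = x m ^ (2 * L) / x n ^ (2 * L)"
    by (simp only: power_divide y_var_power)
  ultimately show False using assms unfolding good_def by auto
qed

lemma good_no_poles:
  assumes "good N k x"
  shows "no_poles L N k x"
  unfolding no_poles_def using assms good_ratio[OF assms] by (auto simp: good_def)

lemma good_Phi_nonzero:
  assumes "good N k x"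
  shows "Phi L p N S x \<noteq> 0"
proof -
  have "ff (y_at L (S m) (x m) s / y_at L (S n) (x n) t) \<noteq> 0"
    if "m \<in> {1..N}" "n \<in> {1..N}" "m \<noteq> n" for m n s t
    using good_ratio[OF assms that] unfolding y_at_def f_fun_def by auto
  then show ?thesis
    unfolding Phi_def by (intro prod_nonzero) auto
qed

lemma exists_good:
  fixes \<pi> :: "nat \<Rightarrow> nat \<Rightarrow> complex"
  shows "\<exists>N k x. good N k x \<and>
    (\<forall>i\<in>{1..L - 1}. \<forall>m\<in>{1..l}. (\<Sum>n\<in>{n \<in> {1..N}. k n = i}. x n ^ m) = \<pi> i m)"
proof -
  let ?B = "{1, om (of_real p) ^ (2 * L), inverse (om (of_real p) ^ (2 * L))}"
  have "finite ?B" "\<And>b. b \<in> ?B \<Longrightarrow> inverse b \<in> ?B" "2 * L > 0" using L2 by auto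
  note ex = exists_generic_power_sums[OF this, of "L - 1" l \<pi>]
  define Q where "Q N k x \<longleftrightarrow> (\<forall>n\<in>{1..N}. k n \<in> {1..L - 1} \<and> x n \<noteq> 0) \<and>
    (\<forall>m\<in>{1..N}. \<forall>n\<in>{1..N}. m \<noteq> n \<longrightarrow> x m ^ (2 * L) / x n ^ (2 * L) \<notin> ?B) \<and>
    (\<forall>i\<in>{1..L - 1}. \<forall>m\<in>{1..l}. (\<Sum>n\<in>{n \<in> {1..N}. k n = i}. x n ^ m) = \<pi> i m)"
    for N :: nat and k :: "nat \<Rightarrow> nat" and x :: "nat \<Rightarrow> complex"
  have "\<exists>N k x. Q N k x" unfolding Q_def by (rule ex)
  then obtain N k x where "Q N k x" by blast
  note q = this[unfolded Q_def]
  note * = conjunct1[OF q] conjunct1[OF conjunct2[OF q]] conjunct2[OF conjunct2[OF q]]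
  have "good N k x" unfolding good_def using *(1,2) by blast
  then show ?thesis using *(3) by blast
qed

lemma good_inverse:
  assumes "good N k x"
  shows "good N k (\<lambda>n. inverse (x n))"
  unfolding good_def
proof (intro conjI ballI impI)
  fix m n assume mn: "m \<in> {1..N}" "n \<in> {1..N}" "m \<noteq> n"
  have "inverse (x m) ^ (2 * L) / inverse (x n) ^ (2 * L) = x n ^ (2 * L) / x m ^ (2 * L)"
    by (simp add: field_simps power_inverse)
  then show "inverse (x m) ^ (2 * L) / inverse (x n) ^ (2 * L) \<notin>
      {1, om (of_real p) ^ (2 * L), inverse (om (of_real p) ^ (2 * L))}"
    using assms mn unfolding good_def by auto
qed (use assms in \<open>auto simp: good_def\<close>)

lemma y_at_dom:
  assumes "n \<in> {1..N}" "s \<in> {1..k n}"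
  shows "y_at L (dom_config N k n) v s = v * om ((of_nat (k n) + 1 - 2 * of_nat s) / 2)"
proof -
  have "dom_config N k n = {1..k n}" using assms(1) by (simp add: dom_config_def)
  then show ?thesis
    by (simp only: y_at_def y_var_def position_interval[OF assms(2)]) simp
qed

definition kappa :: "'i::finite \<Rightarrow> nat \<Rightarrow> complex" where
  "kappa i m = gam i m * om ((1 - of_nat (node i)) / 2) ^ m"

text \<open>If k n > i, the site of label i is \<omega> times that of label i + 1 and the two
  contributions cancel; if k n < i, neither label occurs. Hence each node sees only the points with
  k n = i.\<close>

lemma ev_dom:
  fixes i :: "'i::finite"
  assumes C: "CARD('i) = L - 1" and k: "\<And>n. n \<in> {1..N} \<Longrightarrow> k n \<le> L"
  shows "ev N (dom_config N k) x (i, q) = kappa i (Suc q) * (\<Sum>n\<in>{n \<in> {1..N}. k n = node i}. x n ^ Suc q)"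
proof -
  define m where "m = Suc q"
  define j where "j = node i"
  have j: "j \<ge> 1" using node_range[of i] by (simp add: j_def)
  let ?S = "dom_config N k"
  have summand: "(if j \<in> ?S n then y_at L (?S n) (x n) j ^ m else 0) -
      om (of_nat m) * (if Suc j \<in> ?S n then y_at L (?S n) (x n) (Suc j) ^ m else 0) =
      (if k n = j then om ((1 - of_nat j) / 2) ^ m * x n ^ m else 0)" if n: "n \<in> {1..N}" for n
  proof -
    have mem: "s \<in> ?S n \<longleftrightarrow> 1 \<le> s \<and> s \<le> k n" for s using n by (auto simp: dom_config_def)
    consider "k n < j" | "k n = j" | "Suc j \<le> k n" by linarith
    then show ?thesis
    proof cases
      case 2
      then have "y_at L (?S n) (x n) j = x n * om ((1 - of_nat j) / 2)"
        using y_at_dom[OF n, of j k "x n"] j by (simp add: algebra_simps)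
      then show ?thesis using 2 j by (simp add: mem power_mult_distrib mult.commute)
    next
      case 3
      have "y_at L (?S n) (x n) j = om 1 * y_at L (?S n) (x n) (Suc j)"
        using y_at_dom[OF n, of j k "x n"] y_at_dom[OF n, of "Suc j" k "x n"] 3 j
        by (simp add: omega_pow_add[symmetric] field_simps)
      then show ?thesis using 3 j by (simp add: mem power_mult_distrib omega_pow_power)
    qed (use j in \<open>simp add: mem\<close>)
  qed
  have "ev N ?S x (i, q) = gam i m * (psum N ?S x m j - om (of_nat m) * psum N ?S x m (Suc j))"
    unfolding m_def j_def by (rule ev_eq[OF C dom_config_in[OF k]])
  also have "psum N ?S x m j - om (of_nat m) * psum N ?S x m (Suc j) =
      (\<Sum>n\<in>{1..N}. if k n = j then om ((1 - of_nat j) / 2) ^ m * x n ^ m else 0)"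
    unfolding psum_def sum_distrib_left sum_subtractf[symmetric] by (rule sum.cong[OF refl summand])
  also have "\<dots> = (\<Sum>n\<in>{n \<in> {1..N}. k n = j}. om ((1 - of_nat j) / 2) ^ m * x n ^ m)"
    by (rule sum.inter_filter[symmetric]) simp
  finally show ?thesis
    by (simp only: m_def j_def kappa_def sum_distrib_left mult.assoc)
qed

lemma kappa_nonzero: "kappa i m \<noteq> 0"
  by (simp add: kappa_def gam_def)

text \<open>Label u occurs in the dominant configuration exactly at the indices with k n \<ge> u, so
  these sums are triangular in the power sums for fixed k n.\<close>

lemma nsum_dom:
  assumes k: "\<And>n. n \<in> {1..N} \<Longrightarrow> k n \<in> {1..L - 1}" and u: "u \<ge> 1"
  shows "nsum N (dom_config N k) y m u = (\<Sum>j\<in>{u..L - 1}. om (- of_nat m * (of_nat j + 1 - 2 * of_nat u) / 2) *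
    (\<Sum>n\<in>{n \<in> {1..N}. k n = j}. inverse (y n) ^ m))"
proof -
  let ?S = "dom_config N k"
  define c where "c j = om (- of_nat m * (of_nat j + 1 - 2 * of_nat u) / 2)" for j :: nat
  have "nsum N ?S y m u = (\<Sum>n\<in>{1..N}. \<Sum>j\<in>{u..L - 1}. if k n = j then c j * inverse (y n) ^ m else 0)"
    unfolding nsum_def
  proof (rule sum.cong[OF refl])
    fix n assume n: "n \<in> {1..N}"
    have mem: "u \<in> ?S n \<longleftrightarrow> u \<le> k n" using n u by (auto simp: dom_config_def)
    have "inverse (y_at L (?S n) (y n) u) ^ m = c (k n) * inverse (y n) ^ m" if "u \<le> k n"
    proof -
      have "inverse (om ((of_nat (k n) + 1 - 2 * of_nat u) / 2)) ^ m = c (k n)"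
        unfolding omega_pow_minus[symmetric] omega_pow_power c_def
        by (rule arg_cong[of _ _ om]) (simp add: field_simps)
      then show ?thesis
        using y_at_dom[OF n, of u k "y n"] u that by (simp add: power_mult_distrib mult.commute)
    qed
    then show "(if u \<in> ?S n then inverse (y_at L (?S n) (y n) u) ^ m else 0) =
        (\<Sum>j\<in>{u..L - 1}. if k n = j then c j * inverse (y n) ^ m else 0)"
      using k[OF n] by (simp add: mem)
  qed
  also have "\<dots> = (\<Sum>j\<in>{u..L - 1}. \<Sum>n\<in>{1..N}. if k n = j then c j * inverse (y n) ^ m else 0)"
    by (rule sum.swap)
  also have "\<dots> = (\<Sum>j\<in>{u..L - 1}. \<Sum>n\<in>{n \<in> {1..N}. k n = j}. c j * inverse (y n) ^ m)"
    by (intro sum.cong refl sum.inter_filter[symmetric]) simp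
  finally show ?thesis by (simp only: c_def sum_distrib_left)
qed

text \<open>Three linear relations are inverted in turn: \<open>Gz\<close> in terms of the partial
  sums over labels, these in terms of the sums for single labels, and the latter in terms of the
  power sums of the points with fixed k n. The total \<open>ntot\<close> comes out proportional to G
  at the last node, which explains the hypothesis on G.\<close>

lemma exists_realization:
  fixes G :: "'i::finite \<times> nat \<Rightarrow> complex"
  assumes C: "CARD('i) = L - 1"
    and G: "\<And>i q. node i = L - 1 \<Longrightarrow> \<not> L dvd Suc q \<Longrightarrow> G (i, q) = 0"
  shows "\<exists>N k y. good N k y \<and> (\<forall>m\<in>{1..l}. L dvd m \<or> ntot N k y m = 0) \<and>
    (\<forall>i. \<forall>q<l. Gz N (dom_config N k) y (i, q) = G (i, q))"
proof -
  have inj: "inj (node :: 'i \<Rightarrow> nat)" by (auto simp: inj_def node_inj)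
  have range: "range (node :: 'i \<Rightarrow> nat) = {1..L - 1}"
    using bij_betw_node[where 'i = 'i] C by (simp add: bij_betw_def)
  define nd :: "nat \<Rightarrow> 'i" where "nd = inv node"
  have nd: "node (nd j) = j" if "j \<in> {1..L - 1}" for j
    using that range unfolding nd_def by (intro f_inv_into_f) auto
  have nd': "nd (node i) = i" for i unfolding nd_def using inj by simp
  define r where "r m j = - G (nd j, m - 1) * gam (nd j) m * of_nat m / cm m" for m j
  \<comment> \<open>\<open>Gz\<close> requires QQ(j) - (j / L) QQ(L) = r(j). Label L does not occur
    as k n < L, so QQ(L) = QQ(L-1), and j = L - 1 forces QQ(L) = L r(L-1).\<close>
  define QQ where "QQ m j = (if j = 0 then 0 else r m j + of_nat j * r m (L - 1))" for m j
  define Q where "Q m u = (if u \<le> L - 1 then QQ m u - QQ m (u - 1) else 0)" for m u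
  \<comment> \<open>Solves the triangular system of \<open>nsum_dom\<close>: multiplied by the phase
    \<open>om (- of_nat m * of_nat u)\<close>, it says that the sums over j \<ge> u are prescribed,
    so that the terms are differences of neighbours.\<close>
  define \<pi> where "\<pi> j m = om (of_nat m * (of_nat j + 1) / 2) *
     (om (- of_nat m * of_nat j) * Q m j - om (- of_nat m * of_nat (Suc j)) * Q m (Suc j))" for j m
  obtain N k x where x: "good N k x"
    "\<And>i m. i \<in> {1..L - 1} \<Longrightarrow> m \<in> {1..l} \<Longrightarrow> (\<Sum>n\<in>{n \<in> {1..N}. k n = i}. x n ^ m) = \<pi> i m"
    using exists_good[of l \<pi>] by blast
  \<comment> \<open>Inverted points, because \<open>nsum\<close> consists of inverse powers.\<close>
  define y where "y n = inverse (x n)" for n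
  have gy: "good N k y" unfolding y_def using good_inverse[OF x(1)] .
  have k: "k n \<in> {1..L - 1}" if "n \<in> {1..N}" for n using x(1) that by (auto simp: good_def)
  have kL: "k n \<le> L" if "n \<in> {1..N}" for n using k[OF that] by auto
  let ?S = "dom_config N k"
  have ns: "nsum N ?S y m u = Q m u" if u: "u \<ge> 1" and m: "m \<in> {1..l}" for u m
  proof -
    define F where "F j = om (- of_nat m * of_nat j) * Q m j" for j
    have "nsum N ?S y m u = (\<Sum>j\<in>{u..L - 1}. om (- of_nat m * (of_nat j + 1 - 2 * of_nat u) / 2) *
        (\<Sum>n\<in>{n \<in> {1..N}. k n = j}. inverse (y n) ^ m))"
      by (rule nsum_dom[OF _ u]) (fact k)
    also have "\<dots> = (\<Sum>j\<in>{u..L - 1}. om (- of_nat m * (of_nat j + 1 - 2 * of_nat u) / 2) * \<pi> j m)"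
    proof (intro sum.cong refl arg_cong2[where f = "(*)"])
      fix j assume "j \<in> {u..L - 1}"
      then have "j \<in> {1..L - 1}" using u by auto
      from x(2)[OF this m] show "(\<Sum>n\<in>{n \<in> {1..N}. k n = j}. inverse (y n) ^ m) = \<pi> j m"
        by (simp add: y_def)
    qed
    also have "\<dots> = (\<Sum>j\<in>{u..L - 1}. om (of_nat m * of_nat u) * (F j - F (Suc j)))"
    proof (rule sum.cong[OF refl])
      fix j
      have "om (- of_nat m * (of_nat j + 1 - 2 * of_nat u) / 2) * om (of_nat m * (of_nat j + 1) / 2) = om (of_nat m * of_nat u)"
        unfolding omega_pow_add[symmetric] by (rule arg_cong[of _ _ om]) (simp add: field_simps)
      then show "om (- of_nat m * (of_nat j + 1 - 2 * of_nat u) / 2) * \<pi> j m = om (of_nat m * of_nat u) * (F j - F (Suc j))"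
        unfolding \<pi>_def F_def by (simp only: mult.assoc[symmetric])
    qed
    also have "\<dots> = om (of_nat m * of_nat u) * (\<Sum>j\<in>{u..L - 1}. F j - F (Suc j))"
      by (simp only: sum_distrib_left)
    also have "\<dots> = Q m u"
    proof (cases "u \<le> L - 1")
      case True
      have "(\<Sum>j\<in>{u..L - 1}. F j - F (Suc j)) = F u - F (Suc (L - 1))"
        using sum_telescope''[of u "L - 1" "\<lambda>j. - F j"] sum_Suc_diff[of u "L - 1" "\<lambda>j. - F j"] True by simp
      also have "F (Suc (L - 1)) = 0" by (simp add: F_def Q_def)
      also have "om (of_nat m * of_nat u) * (F u - 0) = Q m u"
        by (simp add: F_def mult.assoc[symmetric] omega_pow_add[symmetric])
      finally show ?thesis by simp
    qed (simp add: Q_def)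
    finally show ?thesis .
  qed
  have pn: "partial_nsum N ?S y m j = QQ m j" if "j \<le> L - 1" and m: "m \<in> {1..l}" for j m
    using that(1)
  proof (induction j)
    case 0
    then show ?case by (simp add: partial_nsum_def QQ_def)
  next
    case (Suc j)
    then show ?case using ns[of "Suc j", OF _ m] by (simp add: partial_nsum_def Q_def)
  qed
  have pL: "partial_nsum N ?S y m L = of_nat L * r m (L - 1)" if m: "m \<in> {1..l}" for m
  proof -
    have "sum h {1..Suc n} = sum h {1..n} + h (Suc n)" for h :: "nat \<Rightarrow> complex" and n by simp
    from this[of "nsum N ?S y m" "L - 1"] have "partial_nsum N ?S y m L = partial_nsum N ?S y m (L - 1) + nsum N ?S y m L"
      unfolding partial_nsum_def using L2 by simp
    also have "nsum N ?S y m L = 0"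
    proof -
      have "\<not> L \<le> L - Suc 0" using L2 by linarith
      then show ?thesis using ns[of L, OF _ m] L2 by (simp add: Q_def)
    qed
    also have "partial_nsum N ?S y m (L - 1) = of_nat L * r m (L - 1)"
      using pn[of "L - 1", OF _ m] L2 by (simp add: QQ_def of_nat_diff algebra_simps)
    finally show ?thesis by simp
  qed
  have "L dvd m \<or> ntot N k y m = 0" if m: "m \<in> {1..l}" for m
  proof (cases "L dvd m")
    case False
    have "G (nd (L - 1), m - 1) = 0"
      using G[of "nd (L - 1)" "m - 1"] nd[of "L - 1"] L2 m False by simp
    then have "r m (L - 1) = 0" by (simp add: r_def)
    then show ?thesis using partial_nsum_L[OF dom_config_in[OF kL], where y = y and m = m] pL[OF m] by simp
  qed simp
  moreover have "Gz N ?S y (i, q) = G (i, q)" if q: "q < l" for i q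
  proof -
    have m: "Suc q \<in> {1..l}" using q by simp
    have ni: "node i \<in> {1..L - 1}" using range by blast
    have "partial_nsum N ?S y (Suc q) (node i) - of_nat (node i) / of_nat L * partial_nsum N ?S y (Suc q) L = r (Suc q) (node i)"
      using pn[OF _ m, of "node i"] ni L2 unfolding pL[OF m] by (simp add: QQ_def)
    moreover have "gam i (Suc q) \<noteq> 0" "cm (Suc q) \<noteq> 0" by (simp_all add: gam_def cm_nonzero)
    ultimately show ?thesis
      by (simp add: Gz_def r_def nd' field_simps del: of_nat_Suc)
  qed
  ultimately show ?thesis using gy by blast
qed

end

section \<open>Invariant bases and faithfulness\<close>

context toda
begin

lemma J_fun_add: "J_fun L p N k a (h + h') x = J_fun L p N k a h x + J_fun L p N k a h' x"
  by (simp add: J_fun_eq alg_eval_add distrib_left sum.distrib)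

lemma J_fun_scale: "J_fun L p N k a (alg_scale c h) x = c * J_fun L p N k a h x"
  by (simp add: J_fun_eq alg_eval_scale sum_distrib_left mult_ac)

lemma J_fun_0: "J_fun L p N k a 0 x = 0"
  by (simp add: J_fun_eq)

lemma J_fun_sum: "J_fun L p N k a (sum h A) x = (\<Sum>y\<in>A. J_fun L p N k a (h y) x)"
  by (induction A rule: infinite_finite_induct) (simp_all add: J_fun_add J_fun_0)

lemma J_fun_diff: "J_fun L p N k a (h - h') x = J_fun L p N k a h x - J_fun L p N k a h' x"
  using J_fun_add[of N k a "h - h'" h' x] by simp

definition invariant_families :: "nat \<Rightarrow> (complex ^ 'i::finite \<Rightarrow> 'i alg) set" where
  "invariant_families l = {H. (\<forall>a. H a \<in> alg_grade l) \<and> analytic_family H \<and>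
     (\<forall>i a M k x. no_poles L M k x \<longrightarrow>
        J_fun L p M k (simple_reflection i a) (H (simple_reflection i a)) x = J_fun L p M k a (H a) x)}"

text \<open>
  Multiplication by an element whose evaluation does not depend on the labels only rescales the
  functions \<open>J\<close>, so it preserves invariant families; in each degree not divisible by \<open>L\<close> it supplies
  the one direction that the families \<open>hfam\<close> miss in the dominant limit.
\<close>

definition label_free :: "nat \<Rightarrow> 'i::finite alg set" where
  "label_free d = {I \<in> alg_grade d. \<forall>M k x. \<exists>P. \<forall>S\<in>configs L M k. alg_eval (ev M S x) I = P}"

lemma label_free_1: "1 \<in> label_free 0"
  using single_in_alg_grade[of 0 0 1] by (auto simp: label_free_def)

lemma label_free_mult:
  assumes "I \<in> label_free d" "I' \<in> label_free d'"
  shows "I * I' \<in> label_free (d + d')"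
proof -
  have "\<exists>P. \<forall>S\<in>configs L M k. alg_eval (ev M S x) (I * I') = P" for M k x
  proof -
    obtain P P' where "\<forall>S\<in>configs L M k. alg_eval (ev M S x) I = P" "\<forall>S\<in>configs L M k. alg_eval (ev M S x) I' = P'"
      using assms unfolding label_free_def by blast
    then show ?thesis by (intro exI[of _ "P * P'"]) (simp add: alg_eval_mult)
  qed
  then show ?thesis using assms by (auto simp: label_free_def alg_grade_mult)
qed

definition beta :: "nat \<Rightarrow> nat \<Rightarrow> complex" where
  "beta m j = (\<Sum>t<j. om (of_nat m) ^ t)"

definition motion :: "nat \<Rightarrow> 'i::finite alg" where
  "motion q = (\<Sum>i\<in>UNIV. single (single (i, q) 1) (beta (Suc q) (node i) * inverse (gam i (Suc q))))"

lemma beta_last: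
  assumes "\<not> L dvd m"
  shows "om (of_nat m) * beta m (L - 1) = -1"
proof -
  define z where "z = om (of_nat m)"
  have z: "z \<noteq> 1" "z ^ L = 1"
    unfolding z_def using assms omega_pow_of_nat_eq_1_iff[of L] L2 by (auto simp: omega_pow_power simp flip: of_nat_mult)
  have "(\<Sum>t<L. z ^ t) = 0" using z by (simp add: geometric_sum)
  also have "L = Suc (L - 1)" using L2 by simp
  finally have "1 + z * (\<Sum>t<L - 1. z ^ t) = 0"
    unfolding sum.lessThan_Suc_shift by (simp add: sum_distrib_left)
  then show ?thesis by (simp add: beta_def z_def eq_neg_iff_add_eq_0 add.commute)
qed

lemma beta_telescope:
  "(\<Sum>j\<in>{1..n}. beta m j * (P j - om (of_nat m) * P (Suc j))) = (\<Sum>s\<in>{1..n}. P s) - om (of_nat m) * beta m n * P (Suc n)"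
proof (induction n)
  case (Suc n)
  have "beta m (Suc n) = 1 + om (of_nat m) * beta m n"
    unfolding beta_def sum.lessThan_Suc_shift by (simp add: sum_distrib_left)
  then show ?case using Suc by (simp add: algebra_simps)
qed (simp add: beta_def)

text \<open>The coefficients beta make the twisted differences telescope to P(1) + ... + P(L-1) - z
  beta(L-1) P(L), where z = \<omega>^(q+1). As z is an L-th root of unity other than 1,
  \<open>beta_last\<close> turns the last term into + P(L), and the total does not see the
  labels.\<close>

lemma motion_label_free:
  assumes C: "CARD('i::finite) = L - 1" and m: "\<not> L dvd Suc q"
  shows "(motion q :: 'i alg) \<in> label_free (Suc q)"
proof -
  have "alg_eval (ev M S x) (motion q :: 'i alg) = ptot M k x (Suc q)" if S: "S \<in> configs L M k" for M S k x
  proof -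
    define P where "P s = psum M S x (Suc q) s" for s
    have "alg_eval (ev M S x) (motion q :: 'i alg) =
        (\<Sum>i\<in>(UNIV :: 'i set). beta (Suc q) (node i) * (P (node i) - om (of_nat (Suc q)) * P (Suc (node i))))"
      unfolding motion_def alg_eval_sum alg_eval_single mono_eval_single power_one_right ev_eq[OF C S] P_def
      by (intro sum.cong refl) (simp add: gam_def)
    also have "\<dots> = (\<Sum>j\<in>{1..L - 1}. beta (Suc q) j * (P j - om (of_nat (Suc q)) * P (Suc j)))"
      by (rule sum_node[OF C])
    also have "\<dots> = (\<Sum>s\<in>{1..L - 1}. P s) + P (Suc (L - 1))"
      unfolding beta_telescope beta_last[OF m] by simp
    also have "\<dots> = (\<Sum>s\<in>{1..Suc (L - 1)}. P s)" by simp
    also have "Suc (L - 1) = L" using L2 by simp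
    also have "(\<Sum>s\<in>{1..L}. P s) = ptot M k x (Suc q)" unfolding P_def by (rule sum_psum[OF S])
    finally show ?thesis .
  qed
  then have "\<forall>M k x. \<exists>P. \<forall>S\<in>configs L M k. alg_eval (ev M S x) (motion q :: 'i alg) = P" by blast
  moreover have "(motion q :: 'i alg) \<in> alg_grade (Suc q)"
    unfolding motion_def by (intro alg_grade_sum single_in_alg_grade) (simp add: mdegree_single)
  ultimately show ?thesis by (simp add: label_free_def)
qed

lemma mult_hfam:
  "I * hfam l N k y a = (\<Sum>T\<in>configs L N k. alg_scale (chi (zeta a) N T * Phi L p N T y) (I * hexp l (Gz N T y)))"
  by (simp add: hfam_def sum_distrib_left alg_scale_mult(2))

lemma lookup_mult_hfam:
  "lookup (I * hfam l N k y a) m =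
    (\<Sum>T\<in>configs L N k. chi (zeta a) N T * (Phi L p N T y * lookup (I * hexp l (Gz N T y)) m))"
  by (simp add: mult_hfam lookup_sum mult.assoc)

lemma hfam_invariant:
  assumes C: "CARD('i::finite) = L - 1" and I: "I \<in> label_free d" and y: "good N k y"
    and Q: "\<And>m. m \<in> {1..l} \<Longrightarrow> L dvd m \<or> ntot N k y m = 0"
  shows "(\<lambda>a :: complex ^ 'i. I * hfam l N k y a) \<in> invariant_families (d + l)"
  unfolding invariant_families_def
proof (intro CollectI conjI allI impI)
  fix a :: "complex ^ 'i"
  have "hfam l N k y a \<in> alg_grade l"
    unfolding hfam_def by (intro alg_grade_sum alg_grade_scale hexp_in_grade)
  then show "I * hfam l N k y a \<in> alg_grade (d + l)"
    using I by (intro alg_grade_mult) (auto simp: label_free_def)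
next
  show "analytic_family (\<lambda>a :: complex ^ 'i. I * hfam l N k y a)"
    unfolding analytic_family_def lookup_mult_hfam chi_zeta[symmetric]
    by (intro allI entire_sum entire_mult entire_const entire_omega_pow)
next
  fix i :: 'i and a :: "complex ^ 'i" and M k' x assume X: "no_poles L M k' x"
  obtain P where P: "\<And>S. S \<in> configs L M k' \<Longrightarrow> alg_eval (ev M S x) I = P"
    using I unfolding label_free_def by blast
  have "J_fun L p M k' b (I * h) x = P * J_fun L p M k' b h x" for b h
    unfolding J_fun_eq sum_distrib_left using P by (intro sum.cong refl) (simp add: alg_eval_mult)
  then show "J_fun L p M k' (simple_reflection i a) (I * hfam l N k y (simple_reflection i a)) x =
      J_fun L p M k' a (I * hfam l N k y a) x"
    using J_fun_hfam_reflection[OF C X good_no_poles[OF y] Q] by simp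
qed

lemma good_le: "good N k x \<Longrightarrow> n \<in> {1..N} \<Longrightarrow> k n \<le> L"
proof -
  assume "good N k x" "n \<in> {1..N}"
  then have "k n \<in> {1..L - 1}" unfolding good_def by blast
  then show "k n \<le> L" by auto
qed

lemma hfam_limit:
  assumes C: "CARD('i::finite) = L - 1" and y: "good N k y"
  shows "((\<lambda>\<tau>. scale N k \<tau> * lookup (I * hfam l N k y (path \<tau> :: complex ^ 'i)) m) \<longlongrightarrow>
    Phi L p N (dom_config N k) y * lookup (I * hexp l (Gz N (dom_config N k) y)) m) at_top"
  unfolding lookup_mult_hfam
  by (rule dominant_limit[OF C good_le[OF y]])

section \<open>A functional that vanishes on all dominant limits vanishes on all monomials\<close>

context
  fixes phi :: "'i::finite alg \<Rightarrow> complex"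
  assumes C: "CARD('i) = L - 1"
    and phi: "Vector_Spaces.linear alg_scale (*) phi"
    and vanish: "\<And>d l I G. I \<in> label_free d \<Longrightarrow>
      (\<And>i q. node i = L - 1 \<Longrightarrow> \<not> L dvd Suc q \<Longrightarrow> G (i, q) = 0) \<Longrightarrow> phi (I * hexp l G) = 0"
begin

interpretation phi: Vector_Spaces.linear alg_scale "(*)" phi by (rule phi)

text \<open>The generators not reached by the families \<open>hfam\<close> in the dominant limit:
  their coefficient in \<open>Gz\<close> is there a multiple of \<open>ntot\<close>, which has to
  vanish in these degrees.\<close>

definition excluded :: "'i \<times> nat \<Rightarrow> bool" where
  "excluded g \<longleftrightarrow> node (fst g) = L - 1 \<and> \<not> L dvd Suc (snd g)"

text \<open>For G supported on the allowed generators, \<open>phi (I * hexp l G)\<close> is a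
  polynomial in the values of G. It vanishes identically, and its coefficients are the values of phi
  in question up to nonzero factors.\<close>

lemma phi_monomial_allowed:
  assumes I: "I \<in> label_free d" and m: "\<And>g. g \<in> keys m \<Longrightarrow> \<not> excluded g"
  shows "phi (I * single m 1) = 0"
proof -
  define l where "l = mdegree m"
  define M where "M = {m \<in> monoms l. \<forall>g\<in>keys m. \<not> excluded g}"
  have "finite M" unfolding M_def by (rule finite_subset[OF _ finite_monoms[of l]]) auto
  moreover have "m \<in> M" using m by (auto simp: M_def l_def monoms_def)
  ultimately have M: "finite M" "m \<in> M" by auto
  define b where "b \<mu> = phi (I * single \<mu> 1) * mexp (\<lambda>_. 1) \<mu>" for \<mu>
  have "(\<Sum>\<mu>\<in>M. b \<mu> * mono_eval v \<mu>) = 0" for v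
  proof -
    define G where "G g = (if excluded g then 0 else v g)" for g
    have "phi (I * hexp l G) = 0"
      by (rule vanish[OF I]) (simp add: G_def excluded_def)
    also have "I * hexp l G = (\<Sum>\<mu>\<in>monoms l. alg_scale (mexp G \<mu>) (I * single \<mu> 1))"
      by (simp add: hexp_def sum_distrib_left alg_scale_mult(2) alg_scale_single)
    also have "phi \<dots> = (\<Sum>\<mu>\<in>monoms l. mexp G \<mu> * phi (I * single \<mu> 1))"
      by (simp add: phi.sum phi.scale)
    also have "\<dots> = (\<Sum>\<mu>\<in>M. mexp G \<mu> * phi (I * single \<mu> 1))"
    proof (rule sum.mono_neutral_right)
      show "\<forall>\<mu>\<in>monoms l - M. mexp G \<mu> * phi (I * single \<mu> 1) = 0"
      proof
        fix \<mu> assume "\<mu> \<in> monoms l - M"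
        then obtain g where g: "g \<in> keys \<mu>" "excluded g" by (auto simp: M_def)
        then have "G g ^ lookup \<mu> g / fact (lookup \<mu> g) = 0" by (simp add: G_def in_keys_iff)
        then have "mexp G \<mu> = 0" unfolding mexp_def using g(1) by (intro prod_zero) auto
        then show "mexp G \<mu> * phi (I * single \<mu> 1) = 0" by simp
      qed
    qed (auto simp: M_def finite_monoms)
    also have "\<dots> = (\<Sum>\<mu>\<in>M. b \<mu> * mono_eval v \<mu>)"
    proof (rule sum.cong[OF refl])
      fix \<mu> assume "\<mu> \<in> M"
      then have "mexp G \<mu> = mexp v \<mu>"
        unfolding mexp_def by (intro prod.cong refl) (auto simp: G_def M_def)
      also have "\<dots> = mexp (\<lambda>_. 1) \<mu> * mono_eval v \<mu>"
        using mexp_mult[of "\<lambda>_. 1" v \<mu>] by simp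
      finally show "mexp G \<mu> * phi (I * single \<mu> 1) = b \<mu> * mono_eval v \<mu>"
        by (simp add: b_def)
    qed
    finally show ?thesis .
  qed
  from monomials_independent[OF M(1) this M(2)] have "b m = 0" .
  moreover have "mexp (\<lambda>_. 1) m \<noteq> 0" by (simp add: mexp_def)
  ultimately show ?thesis by (simp add: b_def)
qed

text \<open>Induction on the number of excluded generators in m. An excluded (i, q) has a nonzero
  coefficient in \<open>motion q\<close>, whose other generators are allowed. Replacing (i, q) by
  \<open>motion q\<close>, which is absorbed into I, leaves only monomials with fewer excluded
  generators.\<close>

lemma phi_monomial:
  "I \<in> label_free d \<Longrightarrow> (\<Sum>g\<in>{g \<in> keys m. excluded g}. lookup m g) = n \<Longrightarrow> phi (I * single m 1) = 0"
proof (induction n arbitrary: I d m)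
  case 0
  then have "\<forall>g\<in>{g \<in> keys m. excluded g}. lookup m g = 0" by (subst (asm) sum_eq_0_iff) auto
  then have "\<not> excluded g" if "g \<in> keys m" for g
    using that in_keys_iff[of g m] by blast
  then show ?case using phi_monomial_allowed[OF 0(1)] by blast
next
  case (Suc n)
  define wt where "wt m = (\<Sum>g\<in>{g \<in> keys m. excluded g}. lookup m g)" for m :: "'i monomial"
  have wt_sup: "wt m = (\<Sum>g\<in>K. if excluded g then lookup m g else 0)" if "finite K" "keys m \<subseteq> K" for K m
  proof -
    have "wt m = (\<Sum>g\<in>keys m. if excluded g then lookup m g else 0)"
      unfolding wt_def by (rule sum.inter_filter) simp
    also have "\<dots> = (\<Sum>g\<in>K. if excluded g then lookup m g else 0)"
      using that by (intro sum.mono_neutral_left) (auto simp: in_keys_iff)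
    finally show ?thesis .
  qed
  have wt_add: "wt (m + m') = wt m + wt m'" for m m'
  proof -
    let ?K = "keys m \<union> keys m'"
    have "keys (m + m') \<subseteq> ?K" by (rule keys_add)
    then show ?thesis
      by (simp add: wt_sup[of ?K] lookup_add sum.distrib[symmetric] if_distrib cong: if_cong)
  qed
  have wt_single: "wt (single g 1) = (if excluded g then 1 else 0)" for g
    by (subst wt_sup[of "{g}"]) auto
  have "\<exists>g\<in>keys m. excluded g"
    using Suc.prems(2) by (metis (no_types, lifting) empty_Collect_eq sum.empty nat.distinct(1))
  then obtain i q where g: "(i, q) \<in> keys m" "excluded (i, q)" by auto
  define m' where "m' = m - single (i, q) 1"
  have m: "m = single (i, q) 1 + m'"
    unfolding m'_def using g(1) by (intro poly_mapping_eqI) (auto simp: lookup_add lookup_minus lookup_single when_def in_keys_iff)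
  have wm': "wt m' = n"
    using Suc.prems(2) wt_add[of "single (i, q) 1" m'] wt_single[of "(i, q)"] g(2) by (simp add: m wt_def)
  have ndvd: "\<not> L dvd Suc q" and ni: "node i = L - 1" using g(2) by (auto simp: excluded_def)
  define c where "c j = beta (Suc q) (node j) * inverse (gam j (Suc q))" for j :: 'i
  have ci: "c i \<noteq> 0"
    using beta_last[OF ndvd] by (auto simp: c_def ni gam_def)
  have X: "single (single (j, q) 1) (c j) * single m' 1 = alg_scale (c j) (single (single (j, q) 1 + m') 1)" for j
    by (simp add: mult_single alg_scale_single)
  have "phi ((I * motion q) * single m' 1) = 0"
    using wm' by (intro Suc.IH[OF label_free_mult[OF Suc.prems(1) motion_label_free[OF C ndvd]]]) (simp add: wt_def)
  also have "(I * motion q) * single m' 1 = (\<Sum>j\<in>UNIV. alg_scale (c j) (I * single (single (j, q) 1 + m') 1))"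
    by (simp only: motion_def c_def[symmetric] sum_distrib_left sum_distrib_right mult.assoc X alg_scale_mult(2))
  also have "phi \<dots> = (\<Sum>j\<in>UNIV. c j * phi (I * single (single (j, q) 1 + m') 1))"
    by (simp add: phi.sum phi.scale)
  also have "\<dots> = (\<Sum>j\<in>{i}. c j * phi (I * single (single (j, q) 1 + m') 1))"
  proof (rule sum.mono_neutral_right)
    show "\<forall>j\<in>UNIV - {i}. c j * phi (I * single (single (j, q) 1 + m') 1) = 0"
    proof
      fix j assume "j \<in> UNIV - {i}"
      then have "node j \<noteq> L - 1" using ni node_inj[of j i] by auto
      then have "wt (single (j, q) 1 + m') = n"
        using wt_add[of "single (j, q) 1" m'] wt_single[of "(j, q)"] wm' by (simp add: excluded_def)
      then have "phi (I * single (single (j, q) 1 + m') 1) = 0"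
        by (intro Suc.IH[OF Suc.prems(1)]) (simp add: wt_def)
      then show "c j * phi (I * single (single (j, q) 1 + m') 1) = 0" by simp
    qed
  qed auto
  finally show ?case using ci by (simp add: m)
qed

end

lemma exists_invariant_basis:
  assumes C: "CARD('i::finite) = L - 1"
  shows "\<exists>hinv :: nat \<Rightarrow> complex ^ 'i \<Rightarrow> 'i alg. (\<forall>\<mu>\<in>{1..card (monoms l :: 'i monomial set)}. hinv \<mu> \<in> invariant_families l) \<and>
    generic (\<lambda>a. is_basis_of {1..card (monoms l :: 'i monomial set)} (\<lambda>\<mu>. hinv \<mu> a) (alg_grade l))"
proof -
  let ?M = "monoms l :: 'i monomial set"
  have "\<exists>is D. set is \<subseteq> (invariant_families l :: (complex ^ 'i \<Rightarrow> 'i alg) set) \<and> length is = card ?M \<and> entire D \<and> (\<exists>a. D a \<noteq> 0) \<and>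
     (\<forall>a. D a \<noteq> 0 \<longrightarrow> (\<forall>b. (\<forall>H\<in>set is. (\<Sum>m\<in>?M. b m * lookup (H a) m) = 0) \<longrightarrow> (\<forall>m\<in>?M. b m = 0)))"
  proof (rule analytic_families_nondegenerate[where q = path])
    show "finite ?M" by (rule finite_monoms)
    show "entire (\<lambda>a. lookup (H a) m)" if "H \<in> invariant_families l" for H :: "complex ^ 'i \<Rightarrow> 'i alg" and m
      using that by (simp add: invariant_families_def analytic_family_def)
  next
    fix b :: "'i monomial \<Rightarrow> complex"
    assume b: "\<And>H s v. H \<in> invariant_families l \<Longrightarrow>
      (\<forall>m\<in>?M. ((\<lambda>\<tau>. s \<tau> * lookup (H (path \<tau>)) m) \<longlongrightarrow> v m) at_top) \<Longrightarrow> (\<Sum>m\<in>?M. b m * v m) = 0"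
    define phi where "phi h = (\<Sum>m\<in>?M. b m * lookup h m)" for h
    have lin: "Vector_Spaces.linear alg_scale (*) phi"
      by unfold_locales (auto simp: phi_def lookup_add algebra_simps sum.distrib sum_distrib_left)
    have "phi (I * hexp l' G) = 0"
      if I: "I \<in> label_free d" and G: "\<And>i q. node i = L - 1 \<Longrightarrow> \<not> L dvd Suc q \<Longrightarrow> G (i, q) = 0"
      for d l' I and G :: "'i \<times> nat \<Rightarrow> complex"
    proof (cases "d + l' = l")
      \<comment> \<open>In the wrong degree there is nothing to show, since phi reads only monomials
        of degree l.\<close>
      case False
      have "I * hexp l' G \<in> alg_grade (d + l')"
        using I by (intro alg_grade_mult hexp_in_grade) (simp add: label_free_def)
      then have "lookup (I * hexp l' G) m = 0" if "m \<in> ?M" for m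
        using that False by (auto simp: alg_grade_eq monoms_def in_keys_iff)
      then show ?thesis by (simp add: phi_def)
    next
      case True
      obtain N k y where y: "good N k y" "\<forall>m\<in>{1..l'}. L dvd m \<or> ntot N k y m = 0"
        "\<And>i q. q < l' \<Longrightarrow> Gz N (dom_config N k) y (i, q) = G (i, q)"
        using exists_realization[OF C, of G l'] G by blast
      have hexp: "hexp l' (Gz N (dom_config N k) y) = hexp l' G"
      proof -
        have "mexp (Gz N (dom_config N k) y) m = mexp G m" if "m \<in> monoms l'" for m
          unfolding mexp_def
        proof (intro prod.cong refl)
          fix g assume "g \<in> keys m"
          then have "snd g < l'" using keys_mdegree[of g m] that by (simp add: monoms_def)
          then show "Gz N (dom_config N k) y g ^ lookup m g / fact (lookup m g) = G g ^ lookup m g / fact (lookup m g)"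
            using y(3)[of "snd g" "fst g"] by simp
        qed
        then show ?thesis by (simp add: hexp_def)
      qed
      let ?c = "Phi L p N (dom_config N k) y"
      have "(\<Sum>m\<in>?M. b m * (?c * lookup (I * hexp l' (Gz N (dom_config N k) y)) m)) = 0"
      proof (rule b)
        show "(\<lambda>a :: complex ^ 'i. I * hfam l' N k y a) \<in> invariant_families l"
          using hfam_invariant[OF C I y(1), of l'] y(2) True by simp
        show "\<forall>m\<in>?M. ((\<lambda>\<tau>. scale N k \<tau> * lookup (I * hfam l' N k y (path \<tau>)) m) \<longlongrightarrow>
            ?c * lookup (I * hexp l' (Gz N (dom_config N k) y)) m) at_top"
          using hfam_limit[OF C y(1)] by blast
      qed
      then have "?c * phi (I * hexp l' G) = 0"
        by (simp add: hexp phi_def sum_distrib_left mult_ac)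
      then show ?thesis using good_Phi_nonzero[OF y(1)] by simp
    qed
    note vanish = this
    show "\<forall>m\<in>?M. b m = 0"
    proof
      fix m assume m: "m \<in> ?M"
      have "phi (1 * single m 1) = 0"
        by (rule phi_monomial[OF C lin vanish label_free_1 refl])
      also have "phi (1 * single m 1) = (\<Sum>k\<in>?M. if k = m then b m else 0)"
        unfolding phi_def by (intro sum.cong) (auto simp: lookup_single when_def)
      also have "\<dots> = b m" using m by (simp add: finite_monoms)
      finally show "b m = 0" .
    qed
  qed
  then obtain Hs :: "(complex ^ 'i \<Rightarrow> 'i alg) list" and D where
    Hs: "set Hs \<subseteq> invariant_families l" "length Hs = card ?M" "entire D" "\<exists>a. D a \<noteq> 0"
    "\<And>a b. D a \<noteq> 0 \<Longrightarrow> (\<forall>H\<in>set Hs. (\<Sum>m\<in>?M. b m * lookup (H a) m) = 0) \<Longrightarrow> \<forall>m\<in>?M. b m = 0"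
    by blast
  define hinv where "hinv \<mu> = Hs ! (\<mu> - 1)" for \<mu>
  have inv: "hinv \<mu> \<in> invariant_families l" if "\<mu> \<in> {1..card ?M}" for \<mu>
  proof -
    have "hinv \<mu> \<in> set Hs" using that Hs(2) by (auto simp: hinv_def)
    then show ?thesis using Hs(1) by blast
  qed
  have "is_basis_of {1..card ?M} (\<lambda>\<mu>. hinv \<mu> a) (alg_grade l)" if "D a \<noteq> 0" for a
    unfolding alg_grade_eq
  proof (rule basis_of_trivial_annihilator[OF finite_monoms refl])
    show "keys (hinv \<mu> a) \<subseteq> ?M" if "\<mu> \<in> {1..card ?M}" for \<mu>
      using inv[OF that] by (auto simp: invariant_families_def alg_grade_eq)
    fix b assume b: "\<forall>\<mu>\<in>{1..card ?M}. (\<Sum>m\<in>?M. b m * lookup (hinv \<mu> a) m) = 0"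
    have "(\<Sum>m\<in>?M. b m * lookup (H a) m) = 0" if H: "H \<in> set Hs" for H
    proof -
      obtain j where "j < length Hs" "Hs ! j = H" using H by (auto simp: in_set_conv_nth)
      then have "Suc j \<in> {1..card ?M}" "hinv (Suc j) = H" using Hs(2) by (auto simp: hinv_def)
      then show ?thesis using b by blast
    qed
    then show "\<forall>m\<in>?M. b m = 0" using Hs(5)[OF \<open>D a \<noteq> 0\<close>] by blast
  qed
  then have "generic (\<lambda>a. is_basis_of {1..card ?M} (\<lambda>\<mu>. hinv \<mu> a) (alg_grade l))"
    unfolding generic_def using Hs(3,4) by (intro exI[of _ "\<lambda>n. D"]) auto
  then show ?thesis using inv by blast
qed

section \<open>Faithfulness: h is determined by its functions J\<close>

definition faithful :: "complex ^ 'i::finite \<Rightarrow> bool" where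
  "faithful a \<longleftrightarrow> (\<forall>h :: 'i alg. (\<forall>N k x. (\<forall>n\<in>{1..N}. k n \<in> {1..L - 1}) \<longrightarrow> no_poles L N k x \<longrightarrow>
     J_fun L p N k a h x = 0) \<longrightarrow> h = 0)"

text \<open>In bounded degree there are finitely many monomials, and their functions J are analytic
  in a. In the dominant limit they become the monomials evaluated at values of the generators which,
  by \<open>ev_dom\<close>, can be prescribed freely; independence of monomials gives nondegeneracy.
  The countably many degree bounds are then combined.\<close>

lemma generic_faithful:
  assumes C: "CARD('i::finite) = L - 1"
  shows "generic (faithful :: complex ^ 'i \<Rightarrow> bool)"
proof -
  define Q where "Q l a \<longleftrightarrow> (\<forall>h :: 'i alg. keys h \<subseteq> (\<Union>j\<le>l. monoms j) \<longrightarrow>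
     (\<forall>N k x. good N k x \<longrightarrow> J_fun L p N k a h x = 0) \<longrightarrow> h = 0)" for l and a :: "complex ^ 'i"
  have "generic (Q l)" for l
  proof -
    let ?M = "(\<Union>j\<le>l. monoms j) :: 'i monomial set"
    let ?J = "\<lambda>(N, k, x) (a :: complex ^ 'i) m. J_fun L p N k a (single m 1) x"
    have finM: "finite ?M" by (simp add: finite_monoms)
    define R where "R is D \<longleftrightarrow> set is \<subseteq> {(N, k, x). good N k x} \<and> length is = card ?M \<and> entire D \<and> (\<exists>a. D a \<noteq> 0) \<and>
     (\<forall>a. D a \<noteq> 0 \<longrightarrow> (\<forall>b. (\<forall>i\<in>set is. (\<Sum>m\<in>?M. b m * ?J i a m) = 0) \<longrightarrow> (\<forall>m\<in>?M. b m = 0)))"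
      for "is" and D :: "complex ^ 'i \<Rightarrow> complex"
    have "\<exists>is D. R is D"
      unfolding R_def
    proof (rule analytic_families_nondegenerate[OF finM, where q = path])
      fix i :: "nat \<times> (nat \<Rightarrow> nat) \<times> (nat \<Rightarrow> complex)" and m
      obtain N k x where "i = (N, k, x)" by (cases i)
      then show "entire (\<lambda>a. ?J i a m)"
        by (simp only: prod.case J_fun_eq chi_zeta[symmetric])
          (intro entire_sum entire_mult entire_const entire_omega_pow)
    next
      fix b :: "'i monomial \<Rightarrow> complex"
      assume b: "\<And>i s v. i \<in> {(N, k, x). good N k x} \<Longrightarrow>
        (\<forall>m\<in>?M. ((\<lambda>\<tau>. s \<tau> * ?J i (path \<tau>) m) \<longlongrightarrow> v m) at_top) \<Longrightarrow> (\<Sum>m\<in>?M. b m * v m) = 0"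
      have "(\<Sum>m\<in>?M. b m * mono_eval v m) = 0" for v
      proof -
        have inj: "inj (node :: 'i \<Rightarrow> nat)" by (auto simp: inj_def node_inj)
        define \<pi> where "\<pi> j m = v (inv node j, m - 1) / kappa (inv node j :: 'i) m" for j m
        obtain N k x where x: "good N k x"
          "\<forall>i\<in>{1..L - 1}. \<forall>m\<in>{1..l}. (\<Sum>n\<in>{n \<in> {1..N}. k n = i}. x n ^ m) = \<pi> i m"
          using exists_good[of l \<pi>] by blast
        note kL = good_le[OF x(1)]
        let ?S = "dom_config N k"
        have ev: "ev N ?S x (i, q) = v (i, q)" if q: "q < l" for i q
        proof -
          have "node i \<in> {1..L - 1}" "Suc q \<in> {1..l}" using node_range[of i] C q by auto
          then have "(\<Sum>n\<in>{n \<in> {1..N}. k n = node i}. x n ^ Suc q) = v (i, q) / kappa i (Suc q)"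
            using x(2) inj by (simp add: \<pi>_def del: power_Suc)
          then show ?thesis
            using ev_dom[OF C kL, where x = x and i = i and q = q] kappa_nonzero[of i "Suc q"] by simp
        qed
        have me: "mono_eval (ev N ?S x) m = mono_eval v m" if "m \<in> ?M" for m
          unfolding mono_eval_def
        proof (intro prod.cong refl)
          fix g assume "g \<in> keys m"
          then have "snd g < l" using keys_mdegree[of g m] that by (auto simp: monoms_def)
          then show "ev N ?S x g ^ lookup m g = v g ^ lookup m g" using ev[of "snd g" "fst g"] by simp
        qed
        have "(\<Sum>m\<in>?M. b m * (Phi L p N ?S x * mono_eval (ev N ?S x) m)) = 0"
        proof (rule b[of "(N, k, x)" "scale N k"])
          show "\<forall>m\<in>?M. ((\<lambda>\<tau>. scale N k \<tau> * ?J (N, k, x) (path \<tau>) m) \<longlongrightarrow>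
              Phi L p N ?S x * mono_eval (ev N ?S x) m) at_top"
            unfolding prod.case J_fun_eq alg_eval_single mult_1 mult.assoc
            by (intro ballI dominant_limit[OF C kL])
        qed (use x in auto)
        then have "Phi L p N ?S x * (\<Sum>m\<in>?M. b m * mono_eval v m) = 0"
          using me by (simp add: sum_distrib_left mult_ac)
        then show ?thesis using good_Phi_nonzero[OF x(1)] by simp
      qed
      then show "\<forall>m\<in>?M. b m = 0" using monomials_independent[OF finM] by blast
    qed
    then obtain "is" D where "R is D" by blast
    then have D: "set is \<subseteq> {(N, k, x). good N k x}" "entire D" "\<exists>a. D a \<noteq> 0"
      "\<And>a b. D a \<noteq> 0 \<Longrightarrow> (\<forall>i\<in>set is. (\<Sum>m\<in>?M. b m * ?J i a m) = 0) \<Longrightarrow> \<forall>m\<in>?M. b m = 0"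
      unfolding R_def by simp_all
    have "Q l a" if "D a \<noteq> 0" for a
      unfolding Q_def
    proof (intro allI impI)
      fix h :: "'i alg" assume h: "keys h \<subseteq> ?M" and J: "\<forall>N k x. good N k x \<longrightarrow> J_fun L p N k a h x = 0"
      have exp: "J_fun L p N k a h x = (\<Sum>m\<in>?M. lookup h m * J_fun L p N k a (single m 1) x)" for N k x
      proof -
        have "h = (\<Sum>m\<in>?M. alg_scale (lookup h m) (single m 1))"
          using alg_expand[OF finM h] by (simp add: alg_scale_single)
        then have "J_fun L p N k a h x = J_fun L p N k a (\<Sum>m\<in>?M. alg_scale (lookup h m) (single m 1)) x" by simp
        then show ?thesis by (simp only: J_fun_sum J_fun_scale)
      qed
      have "\<forall>i\<in>set is. (\<Sum>m\<in>?M. lookup h m * ?J i a m) = 0"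
      proof
        fix i assume "i \<in> set is"
        then obtain N k x where i: "i = (N, k, x)" "good N k x" using D(1) by auto
        then show "(\<Sum>m\<in>?M. lookup h m * ?J i a m) = 0" using J exp[of N k x] by simp
      qed
      then have "\<forall>m\<in>?M. lookup h m = 0" by (rule D(4)[OF that])
      then have "keys h = {}" using h in_keys_iff[of _ h] by blast
      then show "h = 0" by simp
    qed
    then show ?thesis
      unfolding generic_def using D(2,3) by (intro exI[of _ "\<lambda>n. D"]) auto
  qed
  then have "generic (\<lambda>a. \<forall>l\<in>UNIV. Q l a)" by (intro generic_countable) auto
  then show ?thesis
  proof (rule generic_mono)
    fix a :: "complex ^ 'i" assume Q: "\<forall>l\<in>UNIV. Q l a"
    show "faithful a"
      unfolding faithful_def
    proof (intro allI impI)
      fix h :: "'i alg" assume J: "\<forall>N k x. (\<forall>n\<in>{1..N}. k n \<in> {1..L - 1}) \<longrightarrow> no_poles L N k x \<longrightarrow> J_fun L p N k a h x = 0"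
      define l where "l = Max (insert 0 (mdegree ` keys h))"
      have "mdegree m \<le> l" if "m \<in> keys h" for m
        unfolding l_def using that by (intro Max_ge) auto
      then have "keys h \<subseteq> (\<Union>j\<le>l. monoms j)" by (auto simp: monoms_def)
      moreover have "J_fun L p N k a h x = 0" if "good N k x" for N k x
        using J good_no_poles[OF that] that unfolding good_def by blast
      ultimately show "h = 0" using Q unfolding Q_def by blast
    qed
  qed
qed

end

section \<open>The reflection maps\<close>

lemma generic_conj:
  assumes "generic P" "generic Q"
  shows "generic (\<lambda>a. P a \<and> Q a)"
proof -
  have "generic (\<lambda>a. \<forall>j\<in>{True, False}. (if j then P else Q) a)"
  proof (rule generic_countable)
    show "generic ((if j then P else Q))" for j
      using assms by simp
  qed simp
  then show ?thesis
  proof (rule generic_mono)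
    fix a assume *: "\<forall>j\<in>{True, False}. (if j then P else Q) a"
    show "P a \<and> Q a" using bspec[OF *, of True] bspec[OF *, of False] by simp
  qed
qed

lemma form_scaleR: "form (r *\<^sub>R a) b = r *\<^sub>R form a b"
  by (simp add: form_def scaleR_sum_right)

lemma bounded_linear_simple_reflection: "bounded_linear (simple_reflection i)"
proof -
  have "linear (simple_reflection i)"
    by (rule linearI)
      (simp_all add: simple_reflection_def form_linear form_scaleR vec_eq_iff algebra_simps)
  then show ?thesis by (rule linear_conv_bounded_linear[THEN iffD1])
qed

lemma simple_reflection_scale: "simple_reflection i (c *s a) = c *s simple_reflection i a"
  by (simp add: simple_reflection_def form_linear vec_eq_iff algebra_simps)

lemma simple_reflection_involution: "simple_reflection i (simple_reflection i a) = a"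
proof -
  have "form (alpha i) (alpha i) = 2" by (simp add: form_alpha_alpha cartan_def)
  then show ?thesis by (simp add: simple_reflection_def form_linear vec_eq_iff algebra_simps)
qed

lemma entire_compose_simple_reflection:
  assumes "entire F"
  shows "entire (\<lambda>a. F (simple_reflection i a))"
proof -
  obtain D where D: "\<And>a. (F has_derivative D a) (at a)" "\<And>a c v. D a (c *s v) = c * D a v"
    using assms unfolding entire_def by metis
  show ?thesis
  proof (rule entireI)
    show "((\<lambda>a. F (simple_reflection i a)) has_derivative (\<lambda>v. D (simple_reflection i a) (simple_reflection i v))) (at a)" for a
      by (rule has_derivative_compose[OF bounded_linear_imp_has_derivative[OF bounded_linear_simple_reflection] D(1)])
  qed (simp add: simple_reflection_scale D(2))
qed

lemma entire_compose_weyl: "w \<in> weyl_group \<Longrightarrow> entire F \<Longrightarrow> entire (\<lambda>a. F (w a))"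
proof (induction w arbitrary: F rule: weyl_group.induct)
  case (step w i)
  show ?case using step.IH[OF entire_compose_simple_reflection[OF step.prems, of i]] by simp
qed simp

lemma weyl_surj: "w \<in> weyl_group \<Longrightarrow> surj w"
proof (induction w rule: weyl_group.induct)
  case (step w i)
  have "surj (simple_reflection i)" using simple_reflection_involution by (metis surjI)
  then show ?case using step.IH by (rule comp_surj[rotated])
qed simp

text \<open>The elements are words in the generators. Countability makes a generic condition at a
  generic for all w a simultaneously.\<close>

lemma countable_weyl: "countable (weyl_group :: (complex ^ 'i::finite \<Rightarrow> complex ^ 'i) set)"
proof -
  define f :: "'i list \<Rightarrow> complex ^ 'i \<Rightarrow> complex ^ 'i"
    where "f is = foldr (\<circ>) (map simple_reflection is) id" for "is"
  have "w \<in> range f" if "w \<in> weyl_group" for w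
    using that
  proof (induction rule: weyl_group.induct)
    case id
    have "f [] = id" by (simp add: f_def)
    then show ?case by (metis rangeI)
  next
    case (step w i)
    then obtain "is" where "w = f is" by (elim rangeE)
    then have "simple_reflection i \<circ> w = f (i # is)"
      by (simp only: f_def list.map foldr_Cons comp_apply)
    then show ?case by (rule range_eqI)
  qed
  then have "weyl_group \<subseteq> f ` lists UNIV" by auto
  moreover have "countable (lists (UNIV :: 'i set))" by (intro countable_lists countable_finite) auto
  ultimately show ?thesis by (meson countable_image countable_subset)
qed

lemma generic_compose_weyl:
  fixes P :: "complex ^ 'i::finite \<Rightarrow> bool"
  assumes P: "generic P" and w: "w \<in> weyl_group"
  shows "generic (\<lambda>a. P (w a))"
proof -
  define Q where "Q F \<longleftrightarrow> (\<forall>n. entire (F n) \<and> (\<exists>a. F n a \<noteq> 0)) \<and> (\<forall>a. (\<forall>n. F n a \<noteq> 0) \<longrightarrow> P a)"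
    for F :: "nat \<Rightarrow> complex ^ 'i \<Rightarrow> complex"
  have "\<exists>F. Q F" using P unfolding generic_def Q_def .
  then obtain F where F: "Q F" by blast
  have "\<exists>a. F n (w a) \<noteq> 0" for n
    using F weyl_surj[OF w] unfolding Q_def by (metis surjD)
  then show ?thesis
    using F entire_compose_weyl[OF w] unfolding generic_def Q_def
    by (intro exI[of _ "\<lambda>n a. F n (w a)"]) simp
qed

context toda
begin

lemma invariant_families_weyl:
  assumes H: "H \<in> invariant_families l" and w: "w \<in> weyl_group" and x: "no_poles L M k x"
  shows "J_fun L p M k (w a) (H (w a)) x = J_fun L p M k a (H a) x"
  using w
proof (induction w rule: weyl_group.induct)
  case (step w i)
  then show ?case using H x by (simp add: invariant_families_def)
qed simp

lemma linear_extension_grade: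
  fixes b b' :: "nat \<Rightarrow> 'i::finite alg"
  assumes "is_basis_of {1..d} b (alg_grade l)"
  shows "\<exists>g. Vector_Spaces.linear alg_scale alg_scale g \<and> (\<forall>\<mu>\<in>{1..d}. g (b \<mu>) = b' \<mu>)"
proof -
  interpret vp: vector_space_pair "alg_scale :: complex \<Rightarrow> 'i alg \<Rightarrow> 'i alg" "alg_scale :: complex \<Rightarrow> 'i alg \<Rightarrow> 'i alg" ..
  have inj: "inj_on b {1..d}" and ind: "alg.independent (b ` {1..d})"
    using assms by (auto simp: is_basis_of_def)
  obtain g where g: "Vector_Spaces.linear alg_scale alg_scale g"
    "\<And>x. x \<in> b ` {1..d} \<Longrightarrow> g x = b' (the_inv_into {1..d} b x)"
    using vp.linear_independent_extend[OF ind, of "\<lambda>x. b' (the_inv_into {1..d} b x)"] by blast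
  have "g (b \<mu>) = b' \<mu>" if "\<mu> \<in> {1..d}" for \<mu>
    using g(2)[of "b \<mu>"] the_inv_into_f_f[OF inj that] that by simp
  then show ?thesis using g(1) by blast
qed

text \<open>In each degree the basis at a is sent to the family at w a. Invariance of J holds on the
  basis and extends by linearity.\<close>

lemma reflection_map_exists:
  fixes a :: "complex ^ 'i::finite" and hinv :: "nat \<Rightarrow> nat \<Rightarrow> complex ^ 'i \<Rightarrow> 'i alg"
  assumes inv: "\<And>l \<mu>. \<mu> \<in> {1..d l} \<Longrightarrow> hinv l \<mu> \<in> invariant_families l"
    and basis: "\<And>l. is_basis_of {1..d l} (\<lambda>\<mu>. hinv l \<mu> a) (alg_grade l)"
    and w: "w \<in> weyl_group"
  shows "\<exists>r. is_reflection_map L p a w r"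
proof -
  have "\<forall>l. \<exists>g. Vector_Spaces.linear alg_scale alg_scale g \<and> (\<forall>\<mu>\<in>{1..d l}. g (hinv l \<mu> a) = hinv l \<mu> (w a))"
  proof
    fix l
    show "\<exists>g. Vector_Spaces.linear alg_scale alg_scale g \<and> (\<forall>\<mu>\<in>{1..d l}. g (hinv l \<mu> a) = hinv l \<mu> (w a))"
      using linear_extension_grade[OF basis[of l], of "\<lambda>\<mu>. hinv l \<mu> (w a)"] .
  qed
  then obtain g where g: "\<And>l. Vector_Spaces.linear alg_scale alg_scale (g l)"
    "\<And>l \<mu>. \<mu> \<in> {1..d l} \<Longrightarrow> g l (hinv l \<mu> a) = hinv l \<mu> (w a)" by metis
  have J_g: "J_fun L p N k (w a) (g l v) x = J_fun L p N k a v x"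
    if x: "no_poles L N k x" and v: "v \<in> alg_grade l" for N k x l v
  proof -
    interpret gl: Vector_Spaces.linear alg_scale alg_scale "g l" by (rule g(1))
    have "v \<in> alg.span ((\<lambda>\<mu>. hinv l \<mu> a) ` {1..d l})"
      using basis[of l] v by (simp add: is_basis_of_def)
    then show ?thesis
    proof (induction rule: alg.span_induct_alt)
      case base
      show ?case by (simp add: gl.zero J_fun_0)
    next
      case (step c u y)
      then obtain \<mu> where \<mu>: "\<mu> \<in> {1..d l}" "u = hinv l \<mu> a" by auto
      have "J_fun L p N k (w a) (g l u) x = J_fun L p N k a u x"
        using g(2)[OF \<mu>(1)] invariant_families_weyl[OF inv[OF \<mu>(1)] w x, of a] \<mu>(2) by simp
      then show ?case using step by (simp add: gl.add gl.scale J_fun_add J_fun_scale)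
    qed
  qed
  \<comment> \<open>\<open>g l\<close> is a linear map on the whole algebra but is meaningful only
    in degree l; r applies to each monomial the map of its own degree.\<close>
  define r where "r h = (\<Sum>m\<in>keys h. alg_scale (lookup h m) (g (mdegree m) (single m 1)))" for h
  have r_sup: "r h = (\<Sum>m\<in>M. alg_scale (lookup h m) (g (mdegree m) (single m 1)))"
    if "finite M" "keys h \<subseteq> M" for M h
    unfolding r_def using that by (intro sum.mono_neutral_left) (auto simp: in_keys_iff)
  have r_add: "r (h + h') = r h + r h'" for h h'
  proof -
    let ?M = "keys h \<union> keys h'"
    have "keys (h + h') \<subseteq> ?M" by (rule keys_add)
    then show ?thesis
      by (simp add: r_sup[of ?M] lookup_add alg.scale_left_distrib sum.distrib)
  qed
  have r_scale: "r (alg_scale c h) = alg_scale c (r h)" for c h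
    by (simp add: r_sup[OF _ keys_alg_scale] alg.scale_sum_right r_sup[of "keys h" h])
  have "Vector_Spaces.linear alg_scale alg_scale r"
    by unfold_locales (auto simp: r_add r_scale)
  moreover have "J_fun L p N k a h x = J_fun L p N k (w a) (r h) x" if x: "no_poles L N k x" for h N k x
  proof -
    have "h = (\<Sum>m\<in>keys h. alg_scale (lookup h m) (single m 1))"
      using alg_expand[of "keys h" h] by (simp add: alg_scale_single)
    then have "J_fun L p N k a h x = J_fun L p N k a (\<Sum>m\<in>keys h. alg_scale (lookup h m) (single m 1)) x"
      by simp
    also have "\<dots> = (\<Sum>m\<in>keys h. lookup h m * J_fun L p N k (w a) (g (mdegree m) (single m 1)) x)"
      using J_g[OF x single_in_alg_grade[OF refl]] by (simp add: J_fun_sum J_fun_scale)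
    also have "\<dots> = J_fun L p N k (w a) (r h) x"
      by (simp add: r_def J_fun_sum J_fun_scale)
    finally show ?thesis .
  qed
  ultimately show ?thesis unfolding is_reflection_map_def by blast
qed

lemma faithfulD:
  fixes h h' :: "'i::finite alg"
  assumes "faithful (a :: complex ^ 'i)"
    and "\<And>N k x. \<forall>n\<in>{1..N}. k n \<in> {1..L - 1} \<Longrightarrow> no_poles L N k x \<Longrightarrow> J_fun L p N k a h x = J_fun L p N k a h' x"
  shows "h = h'"
proof -
  have "h - h' = 0"
    using assms(1) unfolding faithful_def by (rule allE[of _ "h - h'"]) (simp add: J_fun_diff assms(2))
  then show ?thesis by simp
qed

text \<open>Faithfulness at w a is used twice: it makes the reflection map unique, so that the
  definite description denotes it, and it identifies the image of H(a) with H(w a), since both have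
  the same functions J.\<close>

lemma reflection_map_invariant:
  fixes a :: "complex ^ 'i::finite"
  assumes ex: "\<exists>r. is_reflection_map L p a w r" and faithful: "faithful (w a)"
    and H: "H \<in> invariant_families l" and w: "w \<in> weyl_group"
  shows "reflection_map L p a w (H a) = H (w a)"
proof -
  obtain r where r: "is_reflection_map L p a w r" using ex by blast
  have unique: "r' = r" if "is_reflection_map L p a w r'" for r'
  proof
    fix h
    show "r' h = r h"
      by (rule faithfulD[OF faithful]) (use r that in \<open>unfold is_reflection_map_def, metis\<close>)
  qed
  have "reflection_map L p a w = r"
    unfolding reflection_map_def by (rule the_equality[where P = "is_reflection_map L p a w", OF r unique])
  moreover have "r (H a) = H (w a)"
  proof (rule faithfulD[OF faithful])
    fix N k x assume k: "\<forall>n\<in>{1..N}. k n \<in> {1..L - 1}" and x: "no_poles L N k x"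
    have "J_fun L p N k (w a) (r (H a)) x = J_fun L p N k a (H a) x"
      using r k x unfolding is_reflection_map_def by simp
    then show "J_fun L p N k (w a) (r (H a)) x = J_fun L p N k (w a) (H (w a)) x"
      using invariant_families_weyl[OF H w x] by simp
  qed
  ultimately show ?thesis by simp
qed

theorem exists_invariant_families:
  assumes C: "CARD('i::finite) = L - 1"
  shows "\<exists>hinv :: complex ^ 'i \<Rightarrow> nat \<Rightarrow> 'i alg.
     (\<forall>\<mu>\<in>{1..alg.dim (alg_grade l :: 'i alg set)}.
        (\<forall>a. hinv a \<mu> \<in> alg_grade l) \<and> analytic_family (\<lambda>a. hinv a \<mu>)) \<and>
     generic (\<lambda>a. is_basis_of {1..alg.dim (alg_grade l :: 'i alg set)} (hinv a) (alg_grade l)) \<and>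
     generic (\<lambda>a. \<forall>w\<in>weyl_group. \<forall>\<mu>\<in>{1..alg.dim (alg_grade l :: 'i alg set)}.
        reflection_map L p a w (hinv a \<mu>) = hinv (w a) \<mu>)"
proof -
  define d where "d l = card (monoms l :: 'i monomial set)" for l
  have dim: "alg.dim (alg_grade l :: 'i alg set) = d l" for l
    unfolding alg_grade_eq d_def by (rule alg_support_dim[OF finite_monoms])
  have "\<forall>l. \<exists>hinv :: nat \<Rightarrow> complex ^ 'i \<Rightarrow> 'i alg. (\<forall>\<mu>\<in>{1..d l}. hinv \<mu> \<in> invariant_families l) \<and>
    generic (\<lambda>a. is_basis_of {1..d l} (\<lambda>\<mu>. hinv \<mu> a) (alg_grade l))"
    unfolding d_def using exists_invariant_basis[OF C] by blast
  then obtain hinv :: "nat \<Rightarrow> nat \<Rightarrow> complex ^ 'i \<Rightarrow> 'i alg" where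
    inv: "\<And>l \<mu>. \<mu> \<in> {1..d l} \<Longrightarrow> hinv l \<mu> \<in> invariant_families l"
    and basis: "\<And>l. generic (\<lambda>a. is_basis_of {1..d l} (\<lambda>\<mu>. hinv l \<mu> a) (alg_grade l))"
    by metis
  \<comment> \<open>The reflection map acts on the whole algebra, so its existence calls for bases
    in all degrees at the same a, even though the claim concerns a single l.\<close>
  have all_basis: "generic (\<lambda>a. \<forall>l\<in>UNIV. is_basis_of {1..d l} (\<lambda>\<mu>. hinv l \<mu> a) (alg_grade l))"
    using basis by (intro generic_countable) auto
  have all_faithful: "generic (\<lambda>a :: complex ^ 'i. \<forall>w\<in>weyl_group. faithful (w a))"
    by (rule generic_countable[OF countable_weyl generic_compose_weyl[OF generic_faithful[OF C]]])
  note both = generic_conj[OF all_basis all_faithful]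
  have refl: "generic (\<lambda>a. \<forall>w\<in>weyl_group. \<forall>\<mu>\<in>{1..d l}. reflection_map L p a w (hinv l \<mu> a) = hinv l \<mu> (w a))"
    using both
  proof (rule generic_mono, intro ballI)
    fix a :: "complex ^ 'i" and w :: "complex ^ 'i \<Rightarrow> complex ^ 'i" and \<mu>
    assume *: "(\<forall>l\<in>UNIV. is_basis_of {1..d l} (\<lambda>\<mu>. hinv l \<mu> a) (alg_grade l)) \<and>
        (\<forall>w\<in>weyl_group. faithful (w a))"
      and w: "w \<in> weyl_group" and \<mu>: "\<mu> \<in> {1..d l}"
    have "\<exists>r. is_reflection_map L p a w r"
      using reflection_map_exists[OF inv _ w, of d] * by simp
    moreover have "faithful (w a)" using * w by simp
    ultimately show "reflection_map L p a w (hinv l \<mu> a) = hinv l \<mu> (w a)"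
      using reflection_map_invariant[OF _ _ inv[OF \<mu>] w] by blast
  qed
  show ?thesis
    unfolding dim
    by (rule exI[of _ "\<lambda>a \<mu>. hinv l \<mu> a"])
      (use inv basis[of l] refl in \<open>auto simp: invariant_families_def\<close>)
qed

end

theorem theorem6:
  fixes L l :: nat and p :: real
  assumes "L \<ge> 2" and "CARD('i::finite) = L - 1"
    and "p \<notin> \<rat>" and "0 < p" and "p < 1"
  shows "\<exists>hinv :: complex ^ 'i \<Rightarrow> nat \<Rightarrow> 'i alg.
     (\<forall>\<mu>\<in>{1..alg.dim (alg_grade l :: 'i alg set)}.
        (\<forall>a. hinv a \<mu> \<in> alg_grade l) \<and> analytic_family (\<lambda>a. hinv a \<mu>)) \<and>
     generic (\<lambda>a. is_basis_of {1..alg.dim (alg_grade l :: 'i alg set)} (hinv a) (alg_grade l)) \<and>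
     generic (\<lambda>a. \<forall>w\<in>weyl_group. \<forall>\<mu>\<in>{1..alg.dim (alg_grade l :: 'i alg set)}.
        reflection_map L p a w (hinv a \<mu>) = hinv (w a) \<mu>)"
proof -
  interpret toda L p
    by unfold_locales (use assms in auto)
  show ?thesis by (rule exists_invariant_families[OF assms(2)])
qed

end
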